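(* Let $\Sigma$ be an isothermic torus in $\mathbb{R}^3$ and let $F:\bar{\mathbb{R}}^3\to\bar{\mathbb{R}}^3$ be a conformal transformation of $\bar{\mathbb{R}}^3=\mathbb{R}^3\cup\{\infty\}$ which maps $\Sigma$ into a torus $F(\Sigma)$ lying in $\mathbb{R}^3$. Then the spectrum of the isothermic torus $\Sigma$ coincides with the spectrum of the isothermic torus $F(\Sigma)$.
   Context: Notation: $z=x+iy$, $\partial=\partial_z=\frac12(\partial_x-i\partial_y)$, $\bar\partial=\partial_{\bar z}=\frac12(\partial_x+i\partial_y)$. Surfaces are smooth. Isothermic torus: an immersed torus, given by a conformal immersion of $\mathbb{C}/\Lambda$, $\Lambda=\gamma_1\mathbb{Z}+\gamma_2\mathbb{Z}$ a lattice of rank $2$ in $\mathbb{C}$, with a conformal parameter $z=x+iy$ on $\mathbb{C}$ such that the first and second fundamental forms are $$\mathbf{I}=e^{2\alpha}(dx^2+dy^2),\qquad \mathbf{II}=e^{2\alpha}(k_1\,dx^2+k_2\,dy^2),$$ $k_1,k_2$ being the principal curvatures. Conformal transformations of $\bar{\mathbb{R}}^3$ map isothermic surfaces to isothermic surfaces; $z$ is also used as the conformal parameter on $F(\Sigma)$. Spectrum of an isothermic torus: consider the linear system with spectral parameter $\lambda\in\mathbb{C}$ for $\widehat\varphi:\mathbb{C}\to\mathbb{C}^4$, $$\widehat\varphi_z=\begin{pmatrix}\mathbf{U}&\lambda\mathbf{J}^-\\ \lambda\mathbf{J}^+&\mathbf{U}+\alpha_z\mathbf{E}\end{pmatrix}\widehat\varphi,\qquad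 \widehat\varphi_{\bar z}=\begin{pmatrix}\mathbf{V}&\lambda\mathbf{J}^+\\ \lambda\mathbf{J}^-&\mathbf{V}+\alpha_{\bar z}\mathbf{E}\end{pmatrix}\widehat\varphi,$$ with $$\mathbf{U}=\begin{pmatrix}\alpha_z&\frac{k_1-k_2}{4}e^{\alpha}\\-\frac{k_1+k_2}{4}e^{\alpha}&0\end{pmatrix},\quad \mathbf{V}=\begin{pmatrix}0&\frac{k_1+k_2}{4}e^{\alpha}\\ \frac{k_2-k_1}{4}e^{\alpha}&\alpha_{\bar z}\end{pmatrix},\quad \mathbf{J}^+=\begin{pmatrix}0&1\\0&0\end{pmatrix},\ \mathbf{J}^-=\begin{pmatrix}0&0\\1&0\end{pmatrix},\ \mathbf{E}=\begin{pmatrix}1&0\\0&1\end{pmatrix}.$$ For each $\lambda$ the solution space is four-dimensional and is preserved by the commuting translation operators $\widehat T_j\widehat\varphi(z)=\widehat\varphi(z+\gamma_j)$, $j=1,2$. The joint eigenvectors of $\widehat T_1,\widehat T_2$ are glued into a meromorphic function on a four-sheeted covering $\Gamma(\mathbf{U})\to\mathbb{C}$, $P\mapsto\lambda$, which ramifies where the operators cannot be diagonalized simultaneously; to each $P\in\Gamma(\mathbf{U})$ corresponds a unique (up to a multiple) joint eigenfunction with multipliers $\mu(\gamma_j,P)$ ($\widehat\varphi(z+\gamma_j)=\mu(\gamma_j,P)\widehat\varphi(z)$). The map $(\widehat\varphi_1,\widehat\varphi_2,\widehat\varphi_3,\widehat\varphi_4)\mapsto(\widehat\varphi_1,\widehat\varphi_2,-\widehat\varphi_3,-\widehat\varphi_4)$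 sends solutions for $\lambda$ to solutions for $-\lambda$ and induces an involution $\sigma$ of $\Gamma(\mathbf{U})$; the map $\mathcal{M}(P)=(\mu(\gamma_1,P),\mu(\gamma_2,P))\in\mathbb{C}^2$ descends to $\Gamma(\mathbf{U})/\sigma$. The spectrum of the isothermic torus is $\mathcal{M}(\Gamma(\mathbf{U})/\sigma)\subset\mathbb{C}^2$. Equivalently, this spectrum is the component, containing both asymptotic ends where $\mu(\gamma_j)\approx e^{\lambda_+\gamma_j}$ and $\mu(\gamma_j)\approx e^{\lambda_-\bar\gamma_j}$ as $\lambda_\pm\to\infty$, of the set of all pairs $(\mu_1,\mu_2)\in\mathbb{C}^2$ for which there is a nonzero $\psi:\mathbb{C}\to\mathbb{C}^2$ with $\psi(z+\gamma_j)=\mu_j\psi(z)$ and $\begin{pmatrix}U&\partial\\-\bar\partial&U\end{pmatrix}\psi=0$, where $U=\frac{k_1+k_2}{4}e^{\alpha}$. The spectra of the two tori are compared with respect to the same lattice $\Lambda$ and basis $\gamma_1,\gamma_2$ (the parameter $z$ on $\Sigma$ being carried to $F(\Sigma)$ by $F$); changing the basis by $\begin{pmatrix}a&b\\c&d\end{pmatrix}\in SL(2,\mathbb{Z})$ changes spectra by $(\mu_1,\mu_2)\mapsto(\mu_1^a\mu_2^b,\mu_1^c\mu_2^d)$. *)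

theory Defs
  imports "HOL-Analysis.Analysis"
begin

section \<open>Smooth maps\<close>

definition dir_deriv :: "('a::real_normed_vector \<Rightarrow> 'b::real_normed_vector) \<Rightarrow> 'a \<Rightarrow> 'a \<Rightarrow> 'b"
  where "dir_deriv f v x = frechet_derivative f (at x) v"

text \<open>The following two notions are meant for open sets \<open>S\<close>.\<close>

primrec Ck_on :: "nat \<Rightarrow> 'a::euclidean_space set \<Rightarrow> ('a \<Rightarrow> 'b::real_normed_vector) \<Rightarrow> bool" where
  "Ck_on 0 S f \<longleftrightarrow> continuous_on S f"
| "Ck_on (Suc n) S f \<longleftrightarrow> (\<forall>x\<in>S. f differentiable (at x)) \<and> (\<forall>v. Ck_on n S (dir_deriv f v))"

definition smooth_on :: "'a::euclidean_space set \<Rightarrow> ('a \<Rightarrow> 'b::real_normed_vector) \<Rightarrow> bool"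
  where "smooth_on S f \<longleftrightarrow> (\<forall>n. Ck_on n S f)"

definition conformal_on :: "'a::euclidean_space set \<Rightarrow> ('a \<Rightarrow> 'b::euclidean_space) \<Rightarrow> bool"
  where "conformal_on S f \<longleftrightarrow>
    (\<forall>x\<in>S. \<exists>c>0. \<forall>u v. dir_deriv f u x \<bullet> dir_deriv f v x = c * (u \<bullet> v))"


section \<open>Conformal transformations of the one-point compactification of space\<close>

type_synonym R3bar = "(real^3) option"

definition inversion :: "R3bar \<Rightarrow> R3bar" where
  "inversion p = (case p of None \<Rightarrow> Some 0
     | Some x \<Rightarrow> if x = 0 then None else Some ((1 / (norm x)\<^sup>2) *\<^sub>R x))"

text \<open>
  The conformal structure of \<open>\<real>\<^sup>3 \<union> {\<infinity>}\<close> (with \<open>None\<close> in the role of \<open>\<infinity>\<close>) is given by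
  the two charts that are inverse to \<open>Some\<close> and \<open>inversion \<circ> Some\<close>.  A conformal transformation
  is a homeomorphism whose four coordinate expressions are smooth and conformal; it may reverse
  the orientation.
\<close>

definition conformal_transformation :: "(R3bar \<Rightarrow> R3bar) \<Rightarrow> bool" where
  "conformal_transformation F \<longleftrightarrow>
     homeomorphic_map (Alexandroff_compactification euclidean)
       (Alexandroff_compactification euclidean) F \<and>
     (\<forall>A\<in>{id, inversion}. \<forall>B\<in>{id, inversion}.
        let S = {x. (B \<circ> F \<circ> A) (Some x) \<noteq> None};
            f = (\<lambda>x. the ((B \<circ> F \<circ> A) (Some x)))
        in smooth_on S f \<and> conformal_on S f)"


section \<open>Parametrised surfaces and isothermic tori\<close>

text \<open>The coordinates on \<open>\<complex>\<close> are \<open>z = x + \<i>y\<close>, so \<open>\<partial>\<^sub>x\<close> and \<open>\<partial>\<^sub>y\<close> are the derivatives in the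
  directions \<open>1\<close> and \<open>\<i>\<close>.\<close>

definition unit_normal :: "(complex \<Rightarrow> real^3) \<Rightarrow> complex \<Rightarrow> real^3" where
  "unit_normal X z =
     (let n = cross3 (dir_deriv X 1 z) (dir_deriv X \<i> z) in (1 / norm n) *\<^sub>R n)"

definition first_form :: "(complex \<Rightarrow> real^3) \<Rightarrow> complex \<Rightarrow> complex \<Rightarrow> complex \<Rightarrow> real" where
  "first_form X z u v = dir_deriv X u z \<bullet> dir_deriv X v z"

definition second_form :: "(complex \<Rightarrow> real^3) \<Rightarrow> complex \<Rightarrow> complex \<Rightarrow> complex \<Rightarrow> real" where
  "second_form X z u v = dir_deriv (dir_deriv X v) u z \<bullet> unit_normal X z"

text \<open>
  These are the only possible values of \<open>\<alpha>\<close>, \<open>k\<^sub>1\<close>, \<open>k\<^sub>2\<close> in the formulas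
  \<open>I = e\<^bsup>2\<alpha>\<^esup>(dx\<^sup>2 + dy\<^sup>2)\<close> and \<open>II = e\<^bsup>2\<alpha>\<^esup>(k\<^sub>1 dx\<^sup>2 + k\<^sub>2 dy\<^sup>2)\<close>.
\<close>

definition conf_exponent :: "(complex \<Rightarrow> real^3) \<Rightarrow> complex \<Rightarrow> real" where
  "conf_exponent X z = ln (first_form X z 1 1) / 2"

definition curv1 :: "(complex \<Rightarrow> real^3) \<Rightarrow> complex \<Rightarrow> real" where
  "curv1 X z = second_form X z 1 1 / first_form X z 1 1"

definition curv2 :: "(complex \<Rightarrow> real^3) \<Rightarrow> complex \<Rightarrow> real" where
  "curv2 X z = second_form X z \<i> \<i> / first_form X z \<i> \<i>"

text \<open>
  The condition on \<open>first_form\<close> makes \<open>X\<close> a conformal immersion, because its right-hand side is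
  positive definite.
\<close>

definition isothermic_torus :: "complex \<Rightarrow> complex \<Rightarrow> (complex \<Rightarrow> real^3) \<Rightarrow> bool" where
  "isothermic_torus \<gamma>\<^sub>1 \<gamma>\<^sub>2 X \<longleftrightarrow>
     \<gamma>\<^sub>1 \<noteq> \<gamma>\<^sub>2 \<and> independent {\<gamma>\<^sub>1, \<gamma>\<^sub>2} \<and>
     smooth_on UNIV X \<and>
     (\<forall>z. X (z + \<gamma>\<^sub>1) = X z \<and> X (z + \<gamma>\<^sub>2) = X z) \<and>
     (\<forall>z u v. first_form X z u v =
        exp (2 * conf_exponent X z) * (Re u * Re v + Im u * Im v)) \<and>
     (\<forall>z u v. second_form X z u v =
        exp (2 * conf_exponent X z) * (curv1 X z * Re u * Re v + curv2 X z * Im u * Im v))"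


section \<open>The linear system with a spectral parameter\<close>

definition d_z :: "(complex \<Rightarrow> complex) \<Rightarrow> complex \<Rightarrow> complex" where
  "d_z f z = (dir_deriv f 1 z - \<i> * dir_deriv f \<i> z) / 2"

definition d_zbar :: "(complex \<Rightarrow> complex) \<Rightarrow> complex \<Rightarrow> complex" where
  "d_zbar f z = (dir_deriv f 1 z + \<i> * dir_deriv f \<i> z) / 2"

text \<open>The space \<open>\<complex>\<^sup>4\<close> is written as \<open>\<complex>\<^sup>2 \<times> \<complex>\<^sup>2\<close>, following the block form of the system.\<close>

type_synonym C4 = "(complex^2) \<times> (complex^2)"

definition cscale :: "complex \<Rightarrow> C4 \<Rightarrow> C4" where
  "cscale c p = (c *s fst p, c *s snd p)"

definition block_apply ::
  "complex^2^2 \<Rightarrow> complex^2^2 \<Rightarrow> complex^2^2 \<Rightarrow> complex^2^2 \<Rightarrow> C4 \<Rightarrow> C4" where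
  "block_apply A B C D p = (A *v fst p + B *v snd p, C *v fst p + D *v snd p)"

definition d_z4 :: "(complex \<Rightarrow> C4) \<Rightarrow> complex \<Rightarrow> C4" where
  "d_z4 \<phi> z = ((\<chi> i. d_z (\<lambda>w. fst (\<phi> w) $ i) z), (\<chi> i. d_z (\<lambda>w. snd (\<phi> w) $ i) z))"

definition d_zbar4 :: "(complex \<Rightarrow> C4) \<Rightarrow> complex \<Rightarrow> C4" where
  "d_zbar4 \<phi> z = ((\<chi> i. d_zbar (\<lambda>w. fst (\<phi> w) $ i) z), (\<chi> i. d_zbar (\<lambda>w. snd (\<phi> w) $ i) z))"

definition alpha_z :: "(complex \<Rightarrow> real^3) \<Rightarrow> complex \<Rightarrow> complex" where
  "alpha_z X z = d_z (\<lambda>w. of_real (conf_exponent X w)) z"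

definition alpha_zbar :: "(complex \<Rightarrow> real^3) \<Rightarrow> complex \<Rightarrow> complex" where
  "alpha_zbar X z = d_zbar (\<lambda>w. of_real (conf_exponent X w)) z"

definition U_mat :: "(complex \<Rightarrow> real^3) \<Rightarrow> complex \<Rightarrow> complex^2^2" where
  "U_mat X z = vector
     [vector [alpha_z X z, of_real ((curv1 X z - curv2 X z) / 4 * exp (conf_exponent X z))],
      vector [of_real (- (curv1 X z + curv2 X z) / 4 * exp (conf_exponent X z)), 0]]"

definition V_mat :: "(complex \<Rightarrow> real^3) \<Rightarrow> complex \<Rightarrow> complex^2^2" where
  "V_mat X z = vector
     [vector [0, of_real ((curv1 X z + curv2 X z) / 4 * exp (conf_exponent X z))],
      vector [of_real ((curv2 X z - curv1 X z) / 4 * exp (conf_exponent X z)), alpha_zbar X z]]"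

definition J_plus :: "complex^2^2" where
  "J_plus = vector [vector [0, 1], vector [0, 0]]"

definition J_minus :: "complex^2^2" where
  "J_minus = vector [vector [0, 0], vector [1, 0]]"

text \<open>
  Here \<open>mat c\<close> is \<open>c\<close> times the unit matrix.  Differentiable solutions are automatically smooth,
  since the coefficients are smooth.
\<close>

definition solution :: "(complex \<Rightarrow> real^3) \<Rightarrow> complex \<Rightarrow> (complex \<Rightarrow> C4) \<Rightarrow> bool" where
  "solution X lam \<phi> \<longleftrightarrow>
     (\<forall>z. \<phi> differentiable (at z)) \<and>
     (\<forall>z. d_z4 \<phi> z =
        block_apply (U_mat X z) (mat lam ** J_minus)
                    (mat lam ** J_plus) (U_mat X z + mat (alpha_z X z)) (\<phi> z)) \<and>
     (\<forall>z. d_zbar4 \<phi> z =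
        block_apply (V_mat X z) (mat lam ** J_plus)
                    (mat lam ** J_minus) (V_mat X z + mat (alpha_zbar X z)) (\<phi> z))"


section \<open>The spectral curve and the spectrum\<close>

definition translation :: "complex \<Rightarrow> (complex \<Rightarrow> C4) \<Rightarrow> complex \<Rightarrow> C4" where
  "translation \<gamma> \<phi> z = \<phi> (z + \<gamma>)"

definition joint_eigenfunction ::
  "complex \<Rightarrow> complex \<Rightarrow> (complex \<Rightarrow> real^3) \<Rightarrow> complex \<Rightarrow> (complex \<Rightarrow> C4) \<Rightarrow> bool" where
  "joint_eigenfunction \<gamma>\<^sub>1 \<gamma>\<^sub>2 X lam \<phi> \<longleftrightarrow>
     solution X lam \<phi> \<and> (\<exists>z. \<phi> z \<noteq> 0) \<and>
     (\<forall>\<gamma>\<in>{\<gamma>\<^sub>1, \<gamma>\<^sub>2}. \<exists>m. translation \<gamma> \<phi> = (\<lambda>z. cscale m (\<phi> z)))"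

definition complex_line :: "(complex \<Rightarrow> C4) \<Rightarrow> (complex \<Rightarrow> C4) set" where
  "complex_line \<phi> = range (\<lambda>c z. cscale c (\<phi> z))"

type_synonym curve_point = "complex \<times> (complex \<Rightarrow> C4) set"

definition eigenlines ::
  "complex \<Rightarrow> complex \<Rightarrow> (complex \<Rightarrow> real^3) \<Rightarrow> complex \<Rightarrow> (complex \<Rightarrow> C4) set set" where
  "eigenlines \<gamma>\<^sub>1 \<gamma>\<^sub>2 X lam = {complex_line \<phi> |\<phi>. joint_eigenfunction \<gamma>\<^sub>1 \<gamma>\<^sub>2 X lam \<phi>}"

text \<open>
  A point \<open>P\<close> of the spectral curve is a value of the spectral parameter together with the
  line spanned by a joint eigenfunction; the projection to the spectral parameter is \<open>fst\<close>.
  Over a generic \<open>\<lambda>\<close> the commuting operators have exactly four joint eigenlines in the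
  four-dimensional solution space, i.e. they are simultaneously diagonalizable with a unique
  eigenbasis up to multiples.  These four sheets are glued over the remaining \<open>\<lambda>\<close>
  (ramification points, and points where the joint eigenspaces are too large) by taking the limits
  of eigenlines over neighbouring generic values.  In the finite-dimensional spaces of solutions
  all reasonable notions of convergence agree with the pointwise one.  The smooth curve is the
  normalization of this one, which has the same eigenlines and multipliers.
\<close>

definition generic_parameter ::
  "complex \<Rightarrow> complex \<Rightarrow> (complex \<Rightarrow> real^3) \<Rightarrow> complex \<Rightarrow> bool" where
  "generic_parameter \<gamma>\<^sub>1 \<gamma>\<^sub>2 X lam \<longleftrightarrow> card (eigenlines \<gamma>\<^sub>1 \<gamma>\<^sub>2 X lam) = 4"

definition spectral_curve ::
  "complex \<Rightarrow> complex \<Rightarrow> (complex \<Rightarrow> real^3) \<Rightarrow> curve_point set" where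
  "spectral_curve \<gamma>\<^sub>1 \<gamma>\<^sub>2 X =
     {(lam, complex_line \<phi>) |lam \<phi>. joint_eigenfunction \<gamma>\<^sub>1 \<gamma>\<^sub>2 X lam \<phi> \<and>
        (\<exists>lams \<phi>s. lams \<longlonglongrightarrow> lam \<and> (\<forall>z. (\<lambda>n. \<phi>s n z) \<longlonglongrightarrow> \<phi> z) \<and>
           (\<forall>n. generic_parameter \<gamma>\<^sub>1 \<gamma>\<^sub>2 X (lams n) \<and>
                joint_eigenfunction \<gamma>\<^sub>1 \<gamma>\<^sub>2 X (lams n) (\<phi>s n)))}"

definition multiplier :: "complex \<Rightarrow> curve_point \<Rightarrow> complex" where
  "multiplier \<gamma> P = (THE m. \<forall>\<phi>\<in>snd P. translation \<gamma> \<phi> = (\<lambda>z. cscale m (\<phi> z)))"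

definition multipliers :: "complex \<Rightarrow> complex \<Rightarrow> curve_point \<Rightarrow> complex \<times> complex" where
  "multipliers \<gamma>\<^sub>1 \<gamma>\<^sub>2 P = (multiplier \<gamma>\<^sub>1 P, multiplier \<gamma>\<^sub>2 P)"

definition sigma :: "curve_point \<Rightarrow> curve_point" where
  "sigma P = (- fst P, (\<lambda>\<phi> z. (fst (\<phi> z), - snd (\<phi> z))) ` snd P)"

definition sigma_rel ::
  "complex \<Rightarrow> complex \<Rightarrow> (complex \<Rightarrow> real^3) \<Rightarrow> (curve_point \<times> curve_point) set" where
  "sigma_rel \<gamma>\<^sub>1 \<gamma>\<^sub>2 X =
     {(P, Q). P \<in> spectral_curve \<gamma>\<^sub>1 \<gamma>\<^sub>2 X \<and> Q \<in> spectral_curve \<gamma>\<^sub>1 \<gamma>\<^sub>2 X \<and> (Q = P \<or> Q = sigma P)}"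

text \<open>
  Since \<open>multipliers\<close> is constant on each class \<open>C\<close> of the quotient by \<open>\<sigma>\<close>, the image of \<open>C\<close>
  has one element, the value of the descended map at \<open>C\<close>.
\<close>

definition spectrum :: "complex \<Rightarrow> complex \<Rightarrow> (complex \<Rightarrow> real^3) \<Rightarrow> (complex \<times> complex) set" where
  "spectrum \<gamma>\<^sub>1 \<gamma>\<^sub>2 X =
     (\<lambda>C. the_elem (multipliers \<gamma>\<^sub>1 \<gamma>\<^sub>2 ` C)) ` (spectral_curve \<gamma>\<^sub>1 \<gamma>\<^sub>2 X // sigma_rel \<gamma>\<^sub>1 \<gamma>\<^sub>2 X)"

end

theory Submission
  imports Defs
begin

text \<open>
  Liouville's theorem is needed only infinitesimally: in dimension three, flatness of the pulled back
  metric \<open>e\<^bsup>2u\<^esup> |dx|\<^sup>2\<close> says that the Hessian of \<open>u\<close> is \<open>du du - |du|\<^sup>2 / 2\<close>.  Along the surface, put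
  \<open>v = u \<circ> X\<close> and \<open>h = e\<^bsup>\<alpha>\<^esup> \<partial>\<^sub>N u / 2\<close>.  Together with the Gauss-Weingarten equations the Hessian
  identity becomes a closed system for the derivatives of \<open>v\<^sub>x\<close>, \<open>v\<^sub>y\<close> and \<open>h\<close>.  For \<open>\<lambda> \<noteq> 0\<close> it states
  exactly that, up to constant signs if \<open>F\<close> reverses the normal, the periodic gauge transformation
  \<open>(p, q) \<mapsto> e\<^bsup>v\<^esup> (p, q + \<lambda>\<^sup>-\<^sup>1 W p)\<close> with \<open>W = ((-h, v\<^sub>z), (v\<^sub>z\<^sub>b\<^sub>a\<^sub>r, h))\<close> carries the linear system of
  \<open>\<Sigma>\<close> to that of \<open>F(\<Sigma>)\<close>, with the same multipliers.  The value \<open>\<lambda> = 0\<close> is never generic, and the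
  points of the spectral curve over it are reached by a compactness argument.
\<close>

section \<open>Directional derivatives\<close>

text \<open>The upper half of the system dictates the gauge. Suppose that \<open>p\<close> is only
  rescaled by e^v, up to the sign in its second entry. The zbar-derivative of the first entry of
  \<open>p\<close> and the z-derivative of the second one contain \<open>q\<close> only through
  \<open>lam\<close> times \<open>q\<close>; writing the system of the image surface for the
  rescaled \<open>p\<close> and solving for the new \<open>q\<close> produces the matrix W and the
  factor 1/\<open>lam\<close>. The other two equations for \<open>p\<close> hold because \<alpha>
  grows by v and the Hopf coefficient changes at most its sign. In the equations for the new
  \<open>q\<close>, the coefficients of 1/\<open>lam\<close> are exactly the closed system for v_z,
  v_zbar and h. So the geometry has to deliver two things: this closed system, and the behaviour of
  \<alpha> and of the principal curvatures under F.

  The closed system is collected in a locale that no longer mentions F. It is symmetric under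
  exchange of the two surfaces, so one inclusion of spectra, proved inside the locale, yields the
  other one.\<close>

lemma dir_deriv_works:
  "f differentiable at x \<Longrightarrow> (f has_derivative (\<lambda>v. dir_deriv f v x)) (at x)"
  unfolding dir_deriv_def using frechet_derivative_works[of f "at x"] by simp

lemma dir_deriv_at: "(f has_derivative f') (at x) \<Longrightarrow> dir_deriv f v x = f' v"
  unfolding dir_deriv_def by (metis frechet_derivative_at)

lemma dir_deriv_scaleR:
  assumes "f differentiable at x"
  shows "dir_deriv f (r *\<^sub>R v) x = r *\<^sub>R dir_deriv f v x"
  using linear_cmul[OF has_derivative_linear[OF dir_deriv_works[OF assms]]] .

lemma dir_deriv_along_line:
  assumes "f differentiable at (y + t *\<^sub>R v)"
  shows "((\<lambda>s. f (y + s *\<^sub>R v)) has_vector_derivative dir_deriv f v (y + t *\<^sub>R v)) (at t)"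
proof -
  have "((\<lambda>s. y + s *\<^sub>R v) has_derivative (\<lambda>s. s *\<^sub>R v)) (at t)"
    by (auto intro!: derivative_eq_intros)
  from has_derivative_compose[OF this dir_deriv_works[OF assms]]
  show ?thesis
    using dir_deriv_scaleR[OF assms] by (simp add: has_vector_derivative_def)
qed

text \<open>The mean value theorem is used twice: first in s for f(x + s v + h w) - f(x + s v), then
  in the direction w for the derivative along v. The second difference is symmetric in v and w while
  the right-hand side is not, which is what the symmetry of second derivatives exploits.\<close>

lemma second_difference_mean_value:
  fixes f :: "'a::euclidean_space \<Rightarrow> real"
  assumes diff: "\<And>y. y \<in> ball x d \<Longrightarrow> f differentiable at y"
    and diff2: "\<And>y. y \<in> ball x d \<Longrightarrow> dir_deriv f v differentiable at y"
    and h: "0 < h" "h * (norm v + norm w) < d"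
  shows "\<exists>y\<in>ball x d. f (x + h *\<^sub>R v + h *\<^sub>R w) - f (x + h *\<^sub>R v) - f (x + h *\<^sub>R w) + f x =
    h\<^sup>2 * dir_deriv (dir_deriv f v) w y"
proof -
  have inb: "x + s *\<^sub>R v + t *\<^sub>R w \<in> ball x d" if "0 \<le> s" "s \<le> h" "0 \<le> t" "t \<le> h" for s t
  proof -
    have "norm (s *\<^sub>R v + t *\<^sub>R w) \<le> s * norm v + t * norm w"
      by (rule order_trans[OF norm_triangle_ineq]) (use that in auto)
    also have "\<dots> \<le> h * (norm v + norm w)"
      using that by (auto simp: distrib_left intro!: add_mono mult_right_mono)
    finally have "norm (s *\<^sub>R v + t *\<^sub>R w) < d"
      using h by simp
    moreover have "dist x (x + s *\<^sub>R v + t *\<^sub>R w) = norm (s *\<^sub>R v + t *\<^sub>R w)"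
      unfolding dist_norm by (metis add.assoc add_diff_cancel_left' norm_minus_commute)
    ultimately show ?thesis
      by simp
  qed
  have D1: "DERIV (\<lambda>s. f (x + s *\<^sub>R v + h *\<^sub>R w) - f (x + s *\<^sub>R v)) s :>
      dir_deriv f v (x + s *\<^sub>R v + h *\<^sub>R w) - dir_deriv f v (x + s *\<^sub>R v)"
    if "0 \<le> s" "s \<le> h" for s
  proof -
    have "f differentiable at ((x + h *\<^sub>R w) + s *\<^sub>R v)" "f differentiable at (x + s *\<^sub>R v)"
      using diff[OF inb[of s h]] diff[OF inb[of s 0]] that h by (simp_all add: add_ac)
    from has_vector_derivative_diff[OF this[THEN dir_deriv_along_line]]
    show ?thesis
      by (simp add: has_real_derivative_iff_has_vector_derivative add_ac)
  qed
  obtain s where s: "0 < s" "s < h"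
    and eq1: "(f (x + h *\<^sub>R v + h *\<^sub>R w) - f (x + h *\<^sub>R v)) - (f (x + h *\<^sub>R w) - f x)
      = h * (dir_deriv f v (x + s *\<^sub>R v + h *\<^sub>R w) - dir_deriv f v (x + s *\<^sub>R v))"
    using MVT2[OF h(1) D1] by auto
  have D2: "DERIV (\<lambda>t. dir_deriv f v (x + s *\<^sub>R v + t *\<^sub>R w)) t :>
      dir_deriv (dir_deriv f v) w (x + s *\<^sub>R v + t *\<^sub>R w)" if "0 \<le> t" "t \<le> h" for t
    using dir_deriv_along_line[OF diff2[OF inb[of s t]]] s that
    by (simp add: has_real_derivative_iff_has_vector_derivative)
  obtain t where t: "0 < t" "t < h"
    and eq2: "dir_deriv f v (x + s *\<^sub>R v + h *\<^sub>R w) - dir_deriv f v (x + s *\<^sub>R v)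
      = h * dir_deriv (dir_deriv f v) w (x + s *\<^sub>R v + t *\<^sub>R w)"
    using MVT2[OF h(1) D2] by auto
  show ?thesis
    using inb[of s t] s t eq1 eq2 by (intro bexI[of _ "x + s *\<^sub>R v + t *\<^sub>R w"])
      (auto simp: power2_eq_square)
qed

text \<open>Schwarz's theorem: both mixed derivatives equal the same second difference divided by
  h^2, at two points near x, and continuity at x brings them together.\<close>

lemma dir_deriv_commute_real:
  fixes f :: "'a::euclidean_space \<Rightarrow> real"
  assumes S: "open S" "x \<in> S" and f: "Ck_on (Suc (Suc 0)) S f"
  shows "dir_deriv (dir_deriv f v) w x = dir_deriv (dir_deriv f w) v x"
proof -
  let ?vw = "dir_deriv (dir_deriv f v) w" and ?wv = "dir_deriv (dir_deriv f w) v"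
  have cont: "continuous (at x) ?vw" "continuous (at x) ?wv"
    using S f by (auto simp: continuous_on_eq_continuous_at)
  have "\<bar>?vw x - ?wv x\<bar> \<le> e" if "e > 0" for e
  proof -
    obtain d1 where d1: "d1 > 0" "\<And>y. dist y x < d1 \<Longrightarrow> \<bar>?vw y - ?vw x\<bar> < e / 2"
      using cont(1) \<open>e > 0\<close> unfolding continuous_at_eps_delta dist_real_def
      by (metis half_gt_zero)
    obtain d2 where d2: "d2 > 0" "\<And>y. dist y x < d2 \<Longrightarrow> \<bar>?wv y - ?wv x\<bar> < e / 2"
      using cont(2) \<open>e > 0\<close> unfolding continuous_at_eps_delta dist_real_def
      by (metis half_gt_zero)
    obtain d3 where d3: "d3 > 0" "ball x d3 \<subseteq> S"
      using S by (auto simp: open_contains_ball)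
    define d where "d = min d1 (min d2 d3)"
    \<comment> \<open>The summand 1 keeps the denominator positive when v and w vanish; this h keeps
      the whole parallelogram inside the ball of radius d.\<close>
    define h where "h = d / (2 * (norm v + norm w + 1))"
    have d: "d > 0"
      using d1 d2 d3 by (simp add: d_def)
    have h: "0 < h"
      using d by (auto simp: h_def intro!: divide_pos_pos mult_pos_pos add_nonneg_pos)
    have "2 * (norm v + norm w + 1) \<noteq> 0"
      using norm_ge_zero[of v] norm_ge_zero[of w] unfolding distrib_left by linarith
    then have d_eq: "h * (2 * (norm v + norm w + 1)) = d"
      by (simp add: h_def)
    have "h * (norm v + norm w) < h * (2 * (norm v + norm w + 1))"
    proof (rule mult_strict_left_mono[OF _ h])
      show "norm v + norm w < 2 * (norm v + norm w + 1)"
        using norm_ge_zero[of v] norm_ge_zero[of w] unfolding distrib_left by linarith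
    qed
    then have hd: "h * (norm v + norm w) < d"
      unfolding d_eq .
    have diffs: "f differentiable at y" "dir_deriv f v differentiable at y"
        "dir_deriv f w differentiable at y" if "y \<in> ball x d" for y
      using f d3 that by (auto simp: d_def)
    obtain y where y: "y \<in> ball x d"
        "f (x + h *\<^sub>R v + h *\<^sub>R w) - f (x + h *\<^sub>R v) - f (x + h *\<^sub>R w) + f x = h\<^sup>2 * ?vw y"
      using second_difference_mean_value[of x d f v h w] diffs h hd by blast
    obtain z where z: "z \<in> ball x d"
        "f (x + h *\<^sub>R w + h *\<^sub>R v) - f (x + h *\<^sub>R w) - f (x + h *\<^sub>R v) + f x = h\<^sup>2 * ?wv z"
      using second_difference_mean_value[of x d f w h v] diffs h hd by (auto simp: add.commute)
    have "h\<^sup>2 * ?vw y = h\<^sup>2 * ?wv z"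
      using y(2) z(2) unfolding add.assoc[of x] add.commute[of "h *\<^sub>R v" "h *\<^sub>R w"]
      by linarith
    then have "?vw y = ?wv z"
      using h by simp
    moreover have "\<bar>?vw y - ?vw x\<bar> < e / 2" "\<bar>?wv z - ?wv x\<bar> < e / 2"
      using y z d1 d2 by (auto simp: d_def dist_commute)
    ultimately show ?thesis
      by linarith
  qed
  then have "\<bar>?vw x - ?wv x\<bar> \<le> 0"
    by (rule field_le_epsilon) simp
  then show ?thesis
    by simp
qed

lemma differentiable_inner_const:
  assumes "f differentiable at x"
  shows "(\<lambda>y. f y \<bullet> b) differentiable at x"
  using has_derivative_inner_left[OF dir_deriv_works[OF assms]] by (rule differentiableI)

lemma dir_deriv_inner_const:
  assumes "f differentiable at x"
  shows "dir_deriv (\<lambda>y. f y \<bullet> b) v x = dir_deriv f v x \<bullet> b"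
  by (rule dir_deriv_at) (rule has_derivative_inner_left[OF dir_deriv_works[OF assms]])

text \<open>\<open>dir_deriv\<close> is total, with arbitrary values where the function is not
  differentiable, so identities between derivatives are available on \<open>S\<close> only.
  Differentiability is local, and openness of \<open>S\<close> lets such identities pass to all
  higher derivatives.\<close>

lemma Ck_on_cong:
  assumes "open S" "\<And>x. x \<in> S \<Longrightarrow> f x = g x"
  shows "Ck_on n S f \<longleftrightarrow> Ck_on n S g"
  using assms(2)
proof (induction n arbitrary: f g)
  case 0
  then show ?case
    by (simp cong: continuous_on_cong)
next
  case (Suc n)
  have D: "(f has_derivative f') (at x) \<longleftrightarrow> (g has_derivative f') (at x)" if "x \<in> S" for x f'
    using has_derivative_transform_within_open[OF _ assms(1) that] Suc.prems by metis
  have "dir_deriv f v x = dir_deriv g v x" if "x \<in> S" for x v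
    unfolding dir_deriv_def frechet_derivative_def D[OF that] ..
  then have "Ck_on n S (dir_deriv f v) \<longleftrightarrow> Ck_on n S (dir_deriv g v)" for v
    by (intro Suc.IH)
  moreover have "f differentiable at x \<longleftrightarrow> g differentiable at x" if "x \<in> S" for x
    using D[OF that] by (simp add: differentiable_def)
  ultimately show ?case
    by simp
qed

lemma Ck_on_inner_const:
  assumes "open S" "Ck_on n S f"
  shows "Ck_on n S (\<lambda>y. f y \<bullet> b)"
  using assms(2)
proof (induction n arbitrary: f)
  case 0
  then show ?case
    by (auto intro!: continuous_intros)
next
  case (Suc n)
  then have "Ck_on n S (\<lambda>y. dir_deriv f v y \<bullet> b)" for v
    by simp
  moreover have "dir_deriv f v x \<bullet> b = dir_deriv (\<lambda>y. f y \<bullet> b) v x" if "x \<in> S" for v x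
    using Suc.prems that by (simp add: dir_deriv_inner_const)
  ultimately have "Ck_on n S (dir_deriv (\<lambda>y. f y \<bullet> b) v)" for v
    using Ck_on_cong[OF assms(1), of "\<lambda>y. dir_deriv f v y \<bullet> b"] by metis
  then show ?case
    using Suc.prems by (simp add: differentiable_inner_const)
qed

text \<open>Reduces to the real case componentwise, since the inner product with a fixed vector
  commutes with differentiation.\<close>

lemma dir_deriv_commute:
  fixes f :: "'a::euclidean_space \<Rightarrow> 'b::euclidean_space"
  assumes S: "open S" "x \<in> S" and f: "Ck_on (Suc (Suc 0)) S f"
  shows "dir_deriv (dir_deriv f v) w x = dir_deriv (dir_deriv f w) v x"
proof (rule euclidean_eqI)
  fix b :: 'b
  have *: "dir_deriv (dir_deriv (\<lambda>y. f y \<bullet> b) v) w x = dir_deriv (dir_deriv f v) w x \<bullet> b" for v w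
  proof -
    have d2: "dir_deriv f v differentiable at x"
      using f S by simp
    have "((\<lambda>y. dir_deriv f v y \<bullet> b) has_derivative
        (\<lambda>w. dir_deriv (dir_deriv f v) w x \<bullet> b)) (at x)"
      by (rule has_derivative_inner_left[OF dir_deriv_works[OF d2]])
    then have "((\<lambda>y. dir_deriv (\<lambda>y. f y \<bullet> b) v y) has_derivative
        (\<lambda>w. dir_deriv (dir_deriv f v) w x \<bullet> b)) (at x)"
      using f by (auto simp: dir_deriv_inner_const
          intro: has_derivative_transform_within_open[OF _ S])
    then show ?thesis
      by (rule dir_deriv_at)
  qed
  show "dir_deriv (dir_deriv f v) w x \<bullet> b = dir_deriv (dir_deriv f w) v x \<bullet> b"
    using dir_deriv_commute_real[OF S Ck_on_inner_const[OF S(1) f], of b v w] by (simp only: *)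
qed

section \<open>The Hessian of a conformal factor in dimension three\<close>

lemma dir_deriv_cong_open:
  assumes "open S" "x \<in> S" "\<And>y. y \<in> S \<Longrightarrow> f y = g y"
  shows "dir_deriv f v x = dir_deriv g v x"
proof -
  have "(f has_derivative f') (at x) \<longleftrightarrow> (g has_derivative f') (at x)" for f'
    using has_derivative_transform_within_open[OF _ assms(1,2)] assms(3) by metis
  then show ?thesis
    unfolding dir_deriv_def frechet_derivative_def by simp
qed

lemma dir_deriv_inner:
  assumes "f differentiable at x" "g differentiable at x"
  shows "dir_deriv (\<lambda>y. f y \<bullet> g y) v x = f x \<bullet> dir_deriv g v x + dir_deriv f v x \<bullet> g x"
  by (rule dir_deriv_at) (rule has_derivative_inner[OF assms[THEN dir_deriv_works]])

lemma dir_deriv_twice_inner: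
  assumes "f differentiable at x" "g differentiable at x"
  shows "dir_deriv (\<lambda>y. 2 * (f y \<bullet> g y)) v x =
    2 * (f x \<bullet> dir_deriv g v x + dir_deriv f v x \<bullet> g x)"
  by (rule dir_deriv_at)
    (rule has_derivative_mult_right[OF has_derivative_inner[OF assms[THEN dir_deriv_works]]])

lemma differentiable_inner:
  assumes "f differentiable at x" "g differentiable at x"
  shows "(\<lambda>y. f y \<bullet> g y) differentiable at x"
  using has_derivative_inner[OF assms[THEN dir_deriv_works]] by (rule differentiableI)

text \<open>Parseval's identity. The normalised frame consists of the rows of a square matrix Q with
  Q Q^T = 1; in finite dimension this gives Q^T Q = 1, so Q preserves inner products.\<close>

lemma inner_orthogonal_frame:
  fixes F :: "'n::finite \<Rightarrow> real^'n"
  assumes F: "\<And>i j. F i \<bullet> F j = (if i = j then c else 0)" and c: "c > 0"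
  shows "c * (a \<bullet> b) = (\<Sum>i\<in>UNIV. (a \<bullet> F i) * (b \<bullet> F i))"
proof -
  define Q :: "real^'n^'n" where "Q = (\<chi> i. (1 / sqrt c) *\<^sub>R F i)"
  have "Q ** transpose Q = mat 1"
  proof -
    have "(Q ** transpose Q) $ i $ j = (Q $ i) \<bullet> (Q $ j)" for i j
      by (simp add: matrix_matrix_mult_def transpose_def inner_vec_def)
    moreover have "(Q $ i) \<bullet> (Q $ j) = (if i = j then 1 else 0)" for i j
      using c by (simp add: Q_def F)
    ultimately show ?thesis
      by (simp add: vec_eq_iff mat_def)
  qed
  then have "transpose Q ** Q = mat 1"
    by (simp add: matrix_left_right_inverse)
  then have "a \<bullet> b = (transpose Q ** Q *v a) \<bullet> b"
    by simp
  also have "\<dots> = (Q *v a) \<bullet> (Q *v b)"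
    by (simp only: matrix_vector_mul_assoc[symmetric] transpose_matrix_vector dot_lmul_matrix)
  also have "\<dots> = (\<Sum>i\<in>UNIV. (a \<bullet> F i) * (b \<bullet> F i)) / c"
    using c unfolding inner_vec_def[of "Q *v a"] sum_divide_distrib
    by (intro sum.cong) (auto simp: Q_def matrix_vector_mul_component inner_commute)
  finally show ?thesis
    using c by (simp add: field_simps)
qed

section \<open>Metric, Christoffel symbols and curvature of a conformal map of space\<close>

locale conformal_map =
  fixes S :: "(real^3) set" and f :: "real^3 \<Rightarrow> real^3"
  assumes open_S: "open S" and smooth: "smooth_on S f" and conformal: "conformal_on S f"
begin

abbreviation D1 where "D1 v \<equiv> dir_deriv f v"
abbreviation D2 where "D2 v w \<equiv> dir_deriv (dir_deriv f v) w"

lemma Ck: "Ck_on n S f"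
  using smooth by (simp add: smooth_on_def)

lemma
  assumes "x \<in> S"
  shows differentiable_f: "f differentiable at x"
    and differentiable_D1: "D1 v differentiable at x"
    and differentiable_D2: "D2 v w differentiable at x"
  using Ck[of "Suc (Suc (Suc 0))"] assms by auto

lemma D2_commute: "x \<in> S \<Longrightarrow> D2 v w x = D2 w v x"
  by (rule dir_deriv_commute[OF open_S _ Ck])

lemma D3_commute: "x \<in> S \<Longrightarrow> dir_deriv (D2 v w) t x = dir_deriv (D2 v t) w x"
  by (rule dir_deriv_commute[OF open_S]) (use Ck[of "Suc (Suc (Suc 0))"] in auto)

text \<open>\<open>conformal_on\<close> only asserts that a factor exists at each point. The squared
  length of one column of the Jacobian is a formula for it that can be differentiated.\<close>

definition c :: "real^3 \<Rightarrow> real" where "c x = D1 (axis 1 1) x \<bullet> D1 (axis 1 1) x"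

abbreviation C1 where "C1 v \<equiv> dir_deriv c v"
abbreviation C2 where "C2 v w \<equiv> dir_deriv (dir_deriv c v) w"

lemma
  assumes "x \<in> S"
  shows c_pos: "c x > 0" and D1_inner: "D1 v x \<bullet> D1 w x = c x * (v \<bullet> w)"
proof -
  obtain k where k: "k > 0" "\<And>u v. D1 u x \<bullet> D1 v x = k * (u \<bullet> v)"
    using conformal assms by (auto simp: conformal_on_def)
  have "c x = k"
    using k(2) by (simp add: c_def inner_axis_axis)
  with k show "c x > 0" "D1 v x \<bullet> D1 w x = c x * (v \<bullet> w)"
    by auto
qed

lemma differentiable_c: "x \<in> S \<Longrightarrow> c differentiable at x"
  unfolding c_def[abs_def] by (intro differentiable_inner differentiable_D1)

lemma C1_eq: "x \<in> S \<Longrightarrow> C1 v x = 2 * (D2 (axis 1 1) v x \<bullet> D1 (axis 1 1) x)"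
  unfolding c_def[abs_def] by (simp add: dir_deriv_inner differentiable_D1 inner_commute)

lemma differentiable_C1:
  assumes "x \<in> S"
  shows "C1 v differentiable at x"
proof -
  have "((\<lambda>x. 2 * (D2 (axis 1 1) v x \<bullet> D1 (axis 1 1) x)) has_derivative (\<lambda>w. 2 *
      (D2 (axis 1 1) v x \<bullet> D2 (axis 1 1) w x + dir_deriv (D2 (axis 1 1) v) w x \<bullet> D1 (axis 1 1) x)))
      (at x)"
    by (intro has_derivative_mult_right has_derivative_inner dir_deriv_works differentiable_D1[OF assms]
        differentiable_D2[OF assms])
  from has_derivative_transform_within_open[OF this open_S assms, of "C1 v"] show ?thesis
    by (intro differentiableI) (auto simp: C1_eq)
qed

text \<open>Inherited from the symmetry of the third derivatives of \<open>f\<close>: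
  differentiating \<open>C1_eq\<close> once more gives an expression that is symmetric in the two
  directions.\<close>

lemma C2_commute:
  assumes x: "x \<in> S"
  shows "C2 v w x = C2 w v x"
proof -
  have "C2 v w x = 2 * (D2 (axis 1 1) v x \<bullet> D2 (axis 1 1) w x
      + dir_deriv (D2 (axis 1 1) v) w x \<bullet> D1 (axis 1 1) x)" for v w
  proof -
    have "C2 v w x = dir_deriv (\<lambda>y. 2 * (D2 (axis 1 1) v y \<bullet> D1 (axis 1 1) y)) w x"
      by (rule dir_deriv_cong_open[OF open_S x]) (simp add: C1_eq)
    then show ?thesis
      by (simp add: dir_deriv_twice_inner differentiable_D1 differentiable_D2 x)
  qed
  then show ?thesis
    by (simp add: D3_commute[OF x, of _ v w] inner_commute)
qed

lemma D2_D1_sum: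
  assumes x: "x \<in> S"
  shows "D2 v t x \<bullet> D1 w x + D2 w t x \<bullet> D1 v x = C1 t x * (v \<bullet> w)"
proof -
  have "dir_deriv (\<lambda>y. D1 v y \<bullet> D1 w y) t x = dir_deriv (\<lambda>y. c y * (v \<bullet> w)) t x"
    by (rule dir_deriv_cong_open[OF open_S x]) (simp add: D1_inner)
  moreover have "dir_deriv (\<lambda>y. c y * (v \<bullet> w)) t x = C1 t x * (v \<bullet> w)"
    by (rule dir_deriv_at)
      (rule has_derivative_mult_left[OF dir_deriv_works[OF differentiable_c[OF x]]])
  ultimately show ?thesis
    by (simp add: dir_deriv_inner differentiable_D1 x inner_commute)
qed

text \<open>The Koszul formula. Three permuted instances of the product rule
  \<open>D2_D1_sum\<close> are combined, and the symmetry of \<open>D2\<close> isolates a single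
  term; the result gives the Christoffel symbols of the pulled back metric.\<close>

lemma D2_D1:
  assumes x: "x \<in> S"
  shows "2 * (D2 v t x \<bullet> D1 w x) = C1 t x * (v \<bullet> w) + C1 v x * (t \<bullet> w) - C1 w x * (v \<bullet> t)"
  using D2_D1_sum[OF x, of v t w] D2_D1_sum[OF x, of t v w] D2_D1_sum[OF x, of v w t]
    D2_commute[OF x, of v t] D2_commute[OF x, of v w] D2_commute[OF x, of t w]
  by (simp add: inner_commute)

lemma D3_D1:
  assumes x: "x \<in> S"
  shows "2 * (D2 v t x \<bullet> D2 w s x + dir_deriv (D2 v t) s x \<bullet> D1 w x) =
    C2 t s x * (v \<bullet> w) + C2 v s x * (t \<bullet> w) - C2 w s x * (v \<bullet> t)"
proof -
  have "dir_deriv (\<lambda>y. 2 * (D2 v t y \<bullet> D1 w y)) s x =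
      dir_deriv (\<lambda>y. C1 t y * (v \<bullet> w) + C1 v y * (t \<bullet> w) - C1 w y * (v \<bullet> t)) s x"
    by (rule dir_deriv_cong_open[OF open_S x]) (simp add: D2_D1)
  moreover have "dir_deriv (\<lambda>y. C1 t y * (v \<bullet> w) + C1 v y * (t \<bullet> w) - C1 w y * (v \<bullet> t)) s x =
      C2 t s x * (v \<bullet> w) + C2 v s x * (t \<bullet> w) - C2 w s x * (v \<bullet> t)"
    by (rule dir_deriv_at) (intro has_derivative_add has_derivative_diff has_derivative_mult_left
        dir_deriv_works differentiable_C1[OF x])
  ultimately show ?thesis
    by (simp add: dir_deriv_twice_inner differentiable_D1 differentiable_D2 x)
qed

text \<open>This expresses that the pulled back metric \<open>c (v \<bullet> w)\<close> is flat.\<close>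

lemma flatness:
  assumes x: "x \<in> S"
  shows "2 * (D2 v t x \<bullet> D2 w s x) - 2 * (D2 v s x \<bullet> D2 w t x) =
    C2 v s x * (t \<bullet> w) - C2 w s x * (v \<bullet> t) - C2 v t x * (s \<bullet> w) + C2 w t x * (v \<bullet> s)"
  using D3_D1[OF x, of v t w s] D3_D1[OF x, of v s w t] D3_commute[OF x, of v t s]
    C2_commute[OF x, of t s]
  by simp

text \<open>The columns of the Jacobian form an orthogonal frame of squared length \<open>c\<close>.
  Expanding in it replaces products of second derivatives of \<open>f\<close> by Christoffel
  symbols, so that \<open>flatness\<close> becomes an equation in \<open>c\<close> alone.\<close>

lemma D2_D2:
  assumes x: "x \<in> S"
  shows "c x * (D2 v t x \<bullet> D2 w s x) =
    (\<Sum>i\<in>UNIV. (D2 v t x \<bullet> D1 (axis i 1) x) * (D2 w s x \<bullet> D1 (axis i 1) x))"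
  by (rule inner_orthogonal_frame) (auto simp: D1_inner x c_pos inner_axis_axis)

lemma hessian_axis:
  assumes x: "x \<in> S"
  shows "4 * c x * C2 (axis i 1) (axis j 1) x =
    6 * C1 (axis i 1) x * C1 (axis j 1) x - (if i = j then \<Sum>k\<in>UNIV. (C1 (axis k 1) x)\<^sup>2 else 0)"
proof -
  define K where "K i = C1 (axis i 1) x" for i
  define H where "H i j = C2 (axis i 1) (axis j 1) x" for i j
  define \<delta> :: "3 \<Rightarrow> 3 \<Rightarrow> real" where "\<delta> i j = (if i = j then 1 else 0)" for i j
  \<comment> \<open>Twice the Christoffel symbol of the first kind in the coordinate frame;
    \<open>flat\<close> below is then the vanishing of the curvature tensor with indices.\<close>
  define A where "A i j k = K j * \<delta> i k + K i * \<delta> j k - K k * \<delta> i j" for i j k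
  have A: "2 * (D2 (axis i 1) (axis j 1) x \<bullet> D1 (axis k 1) x) = A i j k" for i j k
    by (simp add: D2_D1[OF x] A_def K_def \<delta>_def inner_axis_axis)
  have AA: "4 * c x * (D2 (axis i 1) (axis j 1) x \<bullet> D2 (axis k 1) (axis l 1) x) =
      (\<Sum>m\<in>UNIV. A i j m * A k l m)" for i j k l
    using D2_D2[OF x, of "axis i 1" "axis j 1" "axis k 1" "axis l 1"]
    by (simp add: sum_3 algebra_simps flip: A)
  have flat: "(\<Sum>m\<in>UNIV. A i j m * A k l m) - (\<Sum>m\<in>UNIV. A i l m * A k j m) =
      2 * c x * (H i l * \<delta> j k - H k l * \<delta> i j - H i j * \<delta> l k + H k j * \<delta> i l)" for i j k l
  proof -
    have "2 * c x * (2 * (D2 (axis i 1) (axis j 1) x \<bullet> D2 (axis k 1) (axis l 1) x)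
        - 2 * (D2 (axis i 1) (axis l 1) x \<bullet> D2 (axis k 1) (axis j 1) x)) =
      2 * c x * (H i l * \<delta> j k - H k l * \<delta> i j - H i j * \<delta> l k + H k j * \<delta> i l)"
      unfolding flatness[OF x] H_def \<delta>_def by (simp add: inner_axis_axis)
    then show ?thesis
      unfolding AA[symmetric] by (simp add: algebra_simps)
  qed
  have sym: "H i j = H j i" for i j
    by (simp add: H_def C2_commute[OF x])
  have neq: "(1::3) \<noteq> 2" "(1::3) \<noteq> 3" "(2::3) \<noteq> 3" "(2::3) \<noteq> 1" "(3::3) \<noteq> 1" "(3::3) \<noteq> 2"
    by simp_all
  \<comment> \<open>Here dimension three enters: each off-diagonal entry comes from a curvature
    component that repeats the third index, different from both.\<close>
  have off: "2 * c x * H 1 2 = 3 * K 1 * K 2" "2 * c x * H 1 3 = 3 * K 1 * K 3"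
      "2 * c x * H 2 3 = 3 * K 2 * K 3"
    using flat[of 1 3 3 2] flat[of 1 2 2 3] flat[of 2 1 1 3]
    by (simp_all add: sum_3 A_def \<delta>_def neq algebra_simps)
  \<comment> \<open>The curvatures of the three coordinate planes give the sums of two diagonal
    entries each, that is, three linear equations for the three entries.\<close>
  have diag: "4 * c x * H 1 1 = 6 * K 1 * K 1 - ((K 1)\<^sup>2 + (K 2)\<^sup>2 + (K 3)\<^sup>2)"
      "4 * c x * H 2 2 = 6 * K 2 * K 2 - ((K 1)\<^sup>2 + (K 2)\<^sup>2 + (K 3)\<^sup>2)"
      "4 * c x * H 3 3 = 6 * K 3 * K 3 - ((K 1)\<^sup>2 + (K 2)\<^sup>2 + (K 3)\<^sup>2)"
    using flat[of 1 2 2 1] flat[of 1 3 3 1] flat[of 2 3 3 2]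
    by (simp_all add: sum_3 A_def \<delta>_def neq algebra_simps power2_eq_square)
  have "\<forall>i j. 4 * c x * H i j = 6 * K i * K j - (if i = j then \<Sum>k\<in>UNIV. (K k)\<^sup>2 else 0)"
    unfolding forall_3 sum_3 using off diag sym[of 2 1] sym[of 3 1] sym[of 3 2]
    by (simp add: neq algebra_simps)
  then show ?thesis
    by (simp add: H_def K_def)
qed

section \<open>The logarithm of the conformal factor and its gradient\<close>

definition u :: "real^3 \<Rightarrow> real" where "u x = ln (c x) / 2"

text \<open>The gradient of \<open>u\<close>, written with the derivatives of \<open>c\<close> so
  that \<open>hessian\<close> applies when it is differentiated.\<close>

definition g :: "real^3 \<Rightarrow> real^3" where "g x = (\<Sum>i\<in>UNIV. (C1 (axis i 1) x / (2 * c x)) *\<^sub>R axis i 1)"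

lemma exp_u: "x \<in> S \<Longrightarrow> exp (2 * u x) = c x"
  by (simp add: u_def c_pos)

lemma axis_expansion: "(\<Sum>i\<in>UNIV. (v $ i) *\<^sub>R axis i 1) = (v :: real^3)"
  using basis_expansion[of v] by (simp add: scalar_mult_eq_scaleR)

lemma g_nth: "g x $ i = C1 (axis i 1) x / (2 * c x)"
  by (simp add: g_def axis_def if_distrib[of "\<lambda>y. _ * y"] cong: if_cong)

lemma C1_g:
  assumes x: "x \<in> S"
  shows "C1 v x = 2 * c x * (g x \<bullet> v)"
proof -
  have lin: "linear (\<lambda>v. C1 v x)"
    using has_derivative_linear[OF dir_deriv_works[OF differentiable_c[OF x]]] .
  have "C1 v x = C1 (\<Sum>i\<in>UNIV. (v $ i) *\<^sub>R axis i 1) x"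
    by (simp add: axis_expansion)
  also have "\<dots> = (\<Sum>i\<in>UNIV. v $ i * C1 (axis i 1) x)"
    by (simp add: linear_sum[OF lin] linear_cmul[OF lin])
  also have "\<dots> = 2 * c x * (g x \<bullet> v)"
    using c_pos[OF x] by (simp add: inner_vec_def g_nth sum_distrib_left mult.commute)
  finally show ?thesis .
qed

lemma hessian:
  assumes x: "x \<in> S"
  shows "C2 (axis i 1) v x = 2 * c x * (3 * g x $ i * (g x \<bullet> v) - (g x \<bullet> g x) / 2 * v $ i)"
proof -
  have lin: "linear (\<lambda>v. C2 (axis i 1) v x)"
    using has_derivative_linear[OF dir_deriv_works[OF differentiable_C1[OF x]]] .
  have H: "C2 (axis i 1) (axis j 1) x =
      2 * c x * (3 * g x $ i * g x $ j - (g x \<bullet> g x) / 2 * (if i = j then 1 else 0))" for j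
  proof -
    have C1: "C1 (axis k 1) x = 2 * c x * g x $ k" for k
      by (simp add: C1_g[OF x] inner_axis)
    have "4 * c x * C2 (axis i 1) (axis j 1) x = 4 * c x *
        (2 * c x * (3 * g x $ i * g x $ j - (g x \<bullet> g x) / 2 * (if i = j then 1 else 0)))"
      unfolding hessian_axis[OF x] C1
      by (simp add: inner_vec_def sum_3 algebra_simps power2_eq_square)
    then show ?thesis
      using c_pos[OF x] by simp
  qed
  have "C2 (axis i 1) v x = C2 (axis i 1) (\<Sum>j\<in>UNIV. (v $ j) *\<^sub>R axis j 1) x"
    by (simp add: axis_expansion)
  also have "\<dots> = (\<Sum>j\<in>UNIV. v $ j * C2 (axis i 1) (axis j 1) x)"
    by (simp add: linear_sum[OF lin] linear_cmul[OF lin])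
  also have "\<dots> = 2 * c x * (3 * g x $ i * (\<Sum>j\<in>UNIV. g x $ j * v $ j)
      - (g x \<bullet> g x) / 2 * (\<Sum>j\<in>UNIV. if i = j then v $ j else 0))"
    unfolding H sum_distrib_left sum_subtractf[symmetric]
    by (intro sum.cong) (auto simp: algebra_simps)
  also have "\<dots> = 2 * c x * (3 * g x $ i * (g x \<bullet> v) - (g x \<bullet> g x) / 2 * v $ i)"
    by (simp add: inner_vec_def)
  finally show ?thesis .
qed

lemma u_derivative:
  assumes x: "x \<in> S"
  shows "(u has_derivative (\<lambda>v. g x \<bullet> v)) (at x)"
proof -
  have "((\<lambda>x. ln (c x) / 2) has_derivative (\<lambda>v. C1 v x / c x / 2)) (at x)"
    using c_pos[OF x]
    by (auto intro!: derivative_eq_intros dir_deriv_works[OF differentiable_c[OF x]]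
        simp: field_simps)
  then show ?thesis
    using c_pos[OF x] by (simp add: u_def[abs_def] C1_g[OF x])
qed

text \<open>The Hessian identity for \<open>u\<close>. Since dc = 2 c du, the quotient rule
  subtracts two of the three products of \<open>g\<close> with itself in \<open>hessian\<close> and
  leaves one.\<close>

lemma g_derivative:
  assumes x: "x \<in> S"
  shows "(g has_derivative (\<lambda>v. (g x \<bullet> v) *\<^sub>R g x - ((g x \<bullet> g x) / 2) *\<^sub>R v)) (at x)"
proof -
  have "((\<lambda>x. C1 (axis i 1) x / (2 * c x)) has_derivative
      (\<lambda>v. g x $ i * (g x \<bullet> v) - (g x \<bullet> g x) / 2 * v $ i)) (at x)" for i
  proof -
    have "((\<lambda>x. C1 (axis i 1) x / (2 * c x)) has_derivative
      (\<lambda>v. (C2 (axis i 1) v x * (2 * c x) - C1 (axis i 1) x * (2 * C1 v x))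
        / (2 * c x * (2 * c x)))) (at x)"
      using c_pos[OF x] by (intro has_derivative_divide' has_derivative_mult_right dir_deriv_works
          differentiable_C1[OF x] differentiable_c[OF x]) auto
    moreover have "(C2 (axis i 1) v x * (2 * c x) - C1 (axis i 1) x * (2 * C1 v x))
        / (2 * c x * (2 * c x)) = g x $ i * (g x \<bullet> v) - (g x \<bullet> g x) / 2 * v $ i" for v
      using c_pos[OF x] unfolding hessian[OF x] C1_g[OF x]
      by (simp add: inner_axis divide_simps) (simp add: algebra_simps)
    ultimately show ?thesis
      by simp
  qed
  then have "(g has_derivative
      (\<lambda>v. \<Sum>i\<in>UNIV. (g x $ i * (g x \<bullet> v) - (g x \<bullet> g x) / 2 * v $ i) *\<^sub>R axis i 1)) (at x)"
    unfolding g_def[abs_def] by (intro has_derivative_sum has_derivative_scaleR_left)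
  moreover have "(\<Sum>i\<in>UNIV. (g x $ i * (g x \<bullet> v) - (g x \<bullet> g x) / 2 * v $ i) *\<^sub>R axis i 1) =
      (g x \<bullet> v) *\<^sub>R g x - ((g x \<bullet> g x) / 2) *\<^sub>R v" for v
    using axis_expansion[of "(g x \<bullet> v) *\<^sub>R g x - ((g x \<bullet> g x) / 2) *\<^sub>R v"]
    by (simp add: mult.commute)
  ultimately show ?thesis
    by simp
qed

lemma D2_D1_g:
  assumes x: "x \<in> S"
  shows "D2 v t x \<bullet> D1 w x =
    exp (2 * u x) * ((g x \<bullet> t) * (v \<bullet> w) + (g x \<bullet> v) * (t \<bullet> w) - (g x \<bullet> w) * (v \<bullet> t))"
  using D2_D1[OF x, of v t w] by (simp add: C1_g[OF x] exp_u[OF x] algebra_simps)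

end

section \<open>Isothermic surfaces and their conformal images\<close>

lemma inner_tangent_normal_frame:
  fixes a b n p q :: "real^3"
  assumes "a \<bullet> a = E" "b \<bullet> b = E" "a \<bullet> b = 0" "n \<bullet> n = 1" "n \<bullet> a = 0" "n \<bullet> b = 0" and E: "E > 0"
  shows "E * (p \<bullet> q) = (p \<bullet> a) * (q \<bullet> a) + (p \<bullet> b) * (q \<bullet> b) + E * ((p \<bullet> n) * (q \<bullet> n))"
proof -
  define F :: "3 \<Rightarrow> real^3" where "F i = (if i = 1 then a else if i = 2 then b else sqrt E *\<^sub>R n)" for i
  have "\<forall>i j. F i \<bullet> F j = (if i = j then E else 0)"
    using assms by (simp add: forall_3 F_def inner_commute)
  with E have "E * (p \<bullet> q) = (\<Sum>i\<in>UNIV. (p \<bullet> F i) * (q \<bullet> F i))"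
    by (intro inner_orthogonal_frame) auto
  then show ?thesis
    using E by (simp add: sum_3 F_def)
qed

lemma unit_normal_conformal:
  assumes "dir_deriv X 1 z \<bullet> dir_deriv X 1 z = E" "dir_deriv X \<i> z \<bullet> dir_deriv X \<i> z = E"
    "dir_deriv X 1 z \<bullet> dir_deriv X \<i> z = 0" and E: "E > 0"
  shows "unit_normal X z = (1 / E) *\<^sub>R cross3 (dir_deriv X 1 z) (dir_deriv X \<i> z)"
    and "unit_normal X z \<bullet> unit_normal X z = 1"
    and "unit_normal X z \<bullet> dir_deriv X 1 z = 0"
    and "unit_normal X z \<bullet> dir_deriv X \<i> z = 0"
proof -
  let ?n = "cross3 (dir_deriv X 1 z) (dir_deriv X \<i> z)"
  have "(norm ?n)\<^sup>2 = (norm (dir_deriv X 1 z))\<^sup>2 * (norm (dir_deriv X \<i> z))\<^sup>2"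
    using norm_cross_dot[of "dir_deriv X 1 z" "dir_deriv X \<i> z"] assms
    by (simp add: power_mult_distrib)
  also have "\<dots> = E\<^sup>2"
    unfolding power2_norm_eq_inner assms by (simp add: power2_eq_square)
  finally have "(norm ?n)\<^sup>2 = E\<^sup>2" .
  then have n: "norm ?n = E"
    using E by (simp add: power2_eq_iff_nonneg)
  then show N: "unit_normal X z = (1 / E) *\<^sub>R ?n"
    by (simp add: unit_normal_def Let_def)
  show "unit_normal X z \<bullet> unit_normal X z = 1"
    using E n by (simp add: N dot_square_norm power2_eq_square)
  show "unit_normal X z \<bullet> dir_deriv X 1 z = 0" "unit_normal X z \<bullet> dir_deriv X \<i> z = 0"
    by (simp_all add: N dot_cross_self)
qed

text \<open>Total differentiability is part of the notion; the two partial derivatives merely name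
  the real-linear differential. This is what the passage to Wirtinger derivatives requires.\<close>

definition has_partials :: "(complex \<Rightarrow> 'a::real_normed_vector) \<Rightarrow> 'a \<Rightarrow> 'a \<Rightarrow> complex \<Rightarrow> bool" where
  "has_partials f fx fy z \<longleftrightarrow> (f has_derivative (\<lambda>t. Re t *\<^sub>R fx + Im t *\<^sub>R fy)) (at z)"

lemma has_derivative_imp_has_partials:
  assumes "(f has_derivative f') (at z)"
  shows "has_partials f (f' 1) (f' \<i>) z"
proof -
  have lin: "linear f'"
    using assms by (rule has_derivative_linear)
  have "f' t = Re t *\<^sub>R f' 1 + Im t *\<^sub>R f' \<i>" for t
  proof -
    have "f' t = f' (Re t *\<^sub>R 1 + Im t *\<^sub>R \<i>)"
      by (rule arg_cong[of _ _ f']) (simp add: complex_eq_iff)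
    then show ?thesis
      by (simp add: linear_add[OF lin] linear_cmul[OF lin])
  qed
  then have "f' = (\<lambda>t. Re t *\<^sub>R f' 1 + Im t *\<^sub>R f' \<i>)"
    by blast
  with assms show ?thesis
    unfolding has_partials_def by metis
qed

lemma has_partials_dir_deriv:
  "f differentiable at z \<Longrightarrow> has_partials f (dir_deriv f 1 z) (dir_deriv f \<i> z) z"
  by (rule has_derivative_imp_has_partials) (rule dir_deriv_works)

lemma has_partials_imp:
  assumes "has_partials f fx fy z"
  shows "f differentiable at z" "dir_deriv f 1 z = fx" "dir_deriv f \<i> z = fy"
  using assms dir_deriv_at[OF assms[unfolded has_partials_def]]
  by (auto simp: has_partials_def intro: differentiableI)

section \<open>Gauss and Weingarten equations in curvature line coordinates\<close>

locale isothermic_surface =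
  fixes X :: "complex \<Rightarrow> real^3"
  assumes smooth_X: "smooth_on UNIV X"
    and I: "first_form X z s t = exp (2 * conf_exponent X z) * (Re s * Re t + Im s * Im t)"
    and II: "second_form X z s t =
        exp (2 * conf_exponent X z) * (curv1 X z * Re s * Re t + curv2 X z * Im s * Im t)"
begin

abbreviation Xx where "Xx \<equiv> dir_deriv X 1"
abbreviation Xy where "Xy \<equiv> dir_deriv X \<i>"
abbreviation \<alpha> where "\<alpha> \<equiv> conf_exponent X"
abbreviation \<alpha>x where "\<alpha>x \<equiv> dir_deriv \<alpha> 1"
abbreviation \<alpha>y where "\<alpha>y \<equiv> dir_deriv \<alpha> \<i>"
abbreviation N where "N \<equiv> unit_normal X"
abbreviation k1 where "k1 \<equiv> curv1 X"
abbreviation k2 where "k2 \<equiv> curv2 X"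
abbreviation E where "E z \<equiv> exp (2 * \<alpha> z)"

lemma Ck_X: "Ck_on n UNIV X"
  using smooth_X by (simp add: smooth_on_def)

lemma
  shows differentiable_X: "X differentiable at z"
    and differentiable_X1: "dir_deriv X t differentiable at z"
    and continuous_X2: "continuous_on UNIV (dir_deriv (dir_deriv X t) s)"
  using Ck_X[of "Suc (Suc 0)"] by auto

lemma X2_commute: "dir_deriv (dir_deriv X t) s z = dir_deriv (dir_deriv X s) t z"
  by (rule dir_deriv_commute[OF open_UNIV _ Ck_X]) simp

lemma first_form_inner: "dir_deriv X s z \<bullet> dir_deriv X t z = E z * (Re s * Re t + Im s * Im t)"
  using I by (simp add: first_form_def)

lemma second_form_inner: "dir_deriv (dir_deriv X t) s z \<bullet> N z =
    E z * (k1 z * Re s * Re t + k2 z * Im s * Im t)"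
  using II by (simp add: second_form_def)

lemma tangent_inner [simp]:
  "Xx z \<bullet> Xx z = E z" "Xy z \<bullet> Xy z = E z" "Xx z \<bullet> Xy z = 0" "Xy z \<bullet> Xx z = 0"
  by (simp_all add: first_form_inner)

lemma N_inner [simp]: "N z \<bullet> N z = 1" "N z \<bullet> Xx z = 0" "N z \<bullet> Xy z = 0"
    "Xx z \<bullet> N z = 0" "Xy z \<bullet> N z = 0"
  using unit_normal_conformal(2-)[OF tangent_inner(1-3)] by (simp_all add: inner_commute)

lemma frame: "E z * (p \<bullet> q) = (p \<bullet> Xx z) * (q \<bullet> Xx z) + (p \<bullet> Xy z) * (q \<bullet> Xy z)
    + E z * ((p \<bullet> N z) * (q \<bullet> N z))"
  by (rule inner_tangent_normal_frame) auto

lemma \<alpha>_eq: "\<alpha> = (\<lambda>z. ln (Xx z \<bullet> Xx z) / 2)"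
  by (rule ext) simp

lemma differentiable_\<alpha>: "\<alpha> differentiable at z"
proof -
  have "0 < Xx z \<bullet> Xx z"
    by simp
  then have "((\<lambda>z. ln (Xx z \<bullet> Xx z)) has_derivative
      (\<lambda>h. (Xx z \<bullet> dir_deriv Xx h z + dir_deriv Xx h z \<bullet> Xx z) * inverse (Xx z \<bullet> Xx z))) (at z)"
    by (intro has_derivative_ln has_derivative_inner dir_deriv_works differentiable_X1)
  from has_derivative_divide'[OF this has_derivative_const[of 2]] show ?thesis
    unfolding \<alpha>_eq by (intro differentiableI) auto
qed

lemma E_derivative: "dir_deriv E t z = 2 * E z * dir_deriv \<alpha> t z"
  by (rule dir_deriv_at) (auto intro!: derivative_eq_intros dir_deriv_works[OF differentiable_\<alpha>])

lemma X2_inner_sum: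
  assumes "\<And>z. dir_deriv X s z \<bullet> dir_deriv X t z = \<delta> * E z"
  shows "dir_deriv (dir_deriv X s) r z \<bullet> dir_deriv X t z + dir_deriv (dir_deriv X t) r z \<bullet> dir_deriv X s z =
    \<delta> * (2 * E z * dir_deriv \<alpha> r z)"
proof -
  have "dir_deriv (\<lambda>z. \<delta> * E z) r z = \<delta> * dir_deriv E r z"
    unfolding E_derivative
    by (rule dir_deriv_at) (auto intro!: derivative_eq_intros dir_deriv_works[OF differentiable_\<alpha>])
  then show ?thesis
    using dir_deriv_inner[OF differentiable_X1[of s] differentiable_X1[of t], where v = r]
    by (simp add: assms E_derivative inner_commute)
qed

text \<open>Tangential part of the Gauss equations. Differentiating the three products of the
  coordinate tangents in both directions gives six equations, and the symmetry of the mixed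
  derivative resolves them.\<close>

lemma X2_tangent:
  "dir_deriv Xx 1 z \<bullet> Xx z = E z * \<alpha>x z" "dir_deriv Xx 1 z \<bullet> Xy z = - E z * \<alpha>y z"
  "dir_deriv Xx \<i> z \<bullet> Xx z = E z * \<alpha>y z" "dir_deriv Xx \<i> z \<bullet> Xy z = E z * \<alpha>x z"
  "dir_deriv Xy 1 z \<bullet> Xx z = E z * \<alpha>y z" "dir_deriv Xy 1 z \<bullet> Xy z = E z * \<alpha>x z"
  "dir_deriv Xy \<i> z \<bullet> Xx z = - E z * \<alpha>x z" "dir_deriv Xy \<i> z \<bullet> Xy z = E z * \<alpha>y z"
  using X2_inner_sum[of 1 1 1 1 z] X2_inner_sum[of 1 1 1 \<i> z] X2_inner_sum[of \<i> \<i> 1 1 z]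
    X2_inner_sum[of \<i> \<i> 1 \<i> z] X2_inner_sum[of 1 \<i> 0 1 z] X2_inner_sum[of 1 \<i> 0 \<i> z]
    X2_commute[of 1 \<i> z]
  by simp_all

lemma X2_normal: "dir_deriv Xx 1 z \<bullet> N z = E z * k1 z" "dir_deriv Xx \<i> z \<bullet> N z = 0"
    "dir_deriv Xy 1 z \<bullet> N z = 0" "dir_deriv Xy \<i> z \<bullet> N z = E z * k2 z"
  by (simp_all add: second_form_inner)

lemma N_eq: "N z = exp (- 2 * \<alpha> z) *\<^sub>R cross3 (Xx z) (Xy z)"
  using unit_normal_conformal(1)[OF tangent_inner(1-3)] by (simp add: exp_minus inverse_eq_divide)

lemma differentiable_N: "N differentiable at z"
proof -
  have bil: "bounded_bilinear cross3"
    using bilinear_cross by (simp add: bilinear_conv_bounded_bilinear)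
  have "(\<lambda>z. cross3 (Xx z) (Xy z)) differentiable at z"
    using bounded_bilinear.FDERIV[OF bil dir_deriv_works[OF differentiable_X1] dir_deriv_works[OF differentiable_X1]]
    by (rule differentiableI)
  moreover have "((\<lambda>z. exp (- 2 * \<alpha> z)) has_derivative (\<lambda>h. exp (- 2 * \<alpha> z) * (- 2 * dir_deriv \<alpha> h z))) (at z)"
    by (auto intro!: derivative_eq_intros dir_deriv_works[OF differentiable_\<alpha>])
  then have "(\<lambda>z. exp (- 2 * \<alpha> z)) differentiable at z"
    by (rule differentiableI)
  ultimately have "(\<lambda>z. exp (- 2 * \<alpha> z) *\<^sub>R cross3 (Xx z) (Xy z)) differentiable at z"
    by (intro differentiable_scaleR)
  then show ?thesis
    unfolding N_eq[abs_def] .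
qed

text \<open>Weingarten equations, obtained by differentiating that N has length one and is
  orthogonal to the tangents.\<close>

lemma N_derivative_inner:
  shows "dir_deriv N s z \<bullet> N z = 0"
    and "dir_deriv N s z \<bullet> dir_deriv X t z = - (dir_deriv (dir_deriv X t) s z \<bullet> N z)"
proof -
  have "dir_deriv (\<lambda>z. N z \<bullet> N z) s z = 0"
    by (rule dir_deriv_at) simp
  then show "dir_deriv N s z \<bullet> N z = 0"
    unfolding dir_deriv_inner[OF differentiable_N differentiable_N] by (simp add: inner_commute)
  have X_expand: "dir_deriv X t z = Re t *\<^sub>R Xx z + Im t *\<^sub>R Xy z" for z
    by (rule dir_deriv_at) (rule has_partials_dir_deriv[OF differentiable_X, unfolded has_partials_def])
  have 0: "N z \<bullet> dir_deriv X t z = 0" for z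
    unfolding X_expand by (simp add: inner_add_right)
  have "dir_deriv (\<lambda>z. N z \<bullet> dir_deriv X t z) s z = 0"
    unfolding 0 by (rule dir_deriv_at) simp
  then show "dir_deriv N s z \<bullet> dir_deriv X t z = - (dir_deriv (dir_deriv X t) s z \<bullet> N z)"
    unfolding dir_deriv_inner[OF differentiable_N differentiable_X1] by (simp add: inner_commute)
qed

end

lemma has_partialsI:
  assumes "(f has_derivative f') (at z)" "f' 1 = a" "f' \<i> = b"
  shows "has_partials f a b z"
  using has_derivative_imp_has_partials[OF assms(1)] assms(2,3) by simp

lemma has_partials_eq_rhs:
  "has_partials f a b z \<Longrightarrow> a = a' \<Longrightarrow> b = b' \<Longrightarrow> has_partials f a' b' z"
  by simp

text \<open>Interface between geometry and linear system: the surfaces enter only through conformal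
  exponents and principal curvatures. The sign \<epsilon> is one constant for the whole surface.
  Since no map of space occurs, the locale can be instantiated with the two surfaces
  exchanged.\<close>

locale conformal_change =
  fixes X Y :: "complex \<Rightarrow> real^3" and \<epsilon> :: real and v vx vy h :: "complex \<Rightarrow> real"
  assumes \<epsilon>: "\<epsilon> = 1 \<or> \<epsilon> = - 1"
    and differentiable_conf_exponent: "conf_exponent X differentiable at z"
    and conf_exponent_Y: "conf_exponent Y z = conf_exponent X z + v z"
    and curv1_Y: "exp (conf_exponent Y z) * curv1 Y z = \<epsilon> * (exp (conf_exponent X z) * curv1 X z - 2 * h z)"
    and curv2_Y: "exp (conf_exponent Y z) * curv2 Y z = \<epsilon> * (exp (conf_exponent X z) * curv2 X z - 2 * h z)"
    and v_partials: "has_partials v (vx z) (vy z) z"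
    and vx_partials: "has_partials vx
      (((vx z)\<^sup>2 - (vy z)\<^sup>2) / 2 - 2 * (h z)\<^sup>2 + dir_deriv (conf_exponent X) 1 z * vx z
        - dir_deriv (conf_exponent X) \<i> z * vy z + 2 * (exp (conf_exponent X z) * curv1 X z) * h z)
      (vx z * vy z + dir_deriv (conf_exponent X) \<i> z * vx z + dir_deriv (conf_exponent X) 1 z * vy z) z"
    and vy_partials: "has_partials vy
      (vx z * vy z + dir_deriv (conf_exponent X) \<i> z * vx z + dir_deriv (conf_exponent X) 1 z * vy z)
      (((vy z)\<^sup>2 - (vx z)\<^sup>2) / 2 - 2 * (h z)\<^sup>2 - dir_deriv (conf_exponent X) 1 z * vx z
        + dir_deriv (conf_exponent X) \<i> z * vy z + 2 * (exp (conf_exponent X z) * curv2 X z) * h z) z"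
    and h_partials: "has_partials h
      (dir_deriv (conf_exponent X) 1 z * h z + vx z * h z - exp (conf_exponent X z) * curv1 X z * vx z / 2)
      (dir_deriv (conf_exponent X) \<i> z * h z + vy z * h z - exp (conf_exponent X z) * curv2 X z * vy z / 2) z"

section \<open>Geometry of the image surface\<close>

locale conformal_image = isothermic_surface X + conformal_map S f
  for X :: "complex \<Rightarrow> real^3" and S f +
  assumes X_in_S: "X z \<in> S"
begin

definition v where "v z = u (X z)"
abbreviation (input) G where "G z \<equiv> g (X z)"
definition vx where "vx z = G z \<bullet> Xx z"
definition vy where "vy z = G z \<bullet> Xy z"
definition h where "h z = exp (\<alpha> z) * (G z \<bullet> N z) / 2"
definition Y where "Y z = f (X z)"

lemma E_eq: "E z = exp (\<alpha> z) * exp (\<alpha> z)"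
  by (simp flip: exp_add)

lemma G_derivative: "((\<lambda>z. G z) has_derivative
    (\<lambda>s. (G z \<bullet> dir_deriv X s z) *\<^sub>R G z - ((G z \<bullet> G z) / 2) *\<^sub>R dir_deriv X s z)) (at z)"
  using has_derivative_compose[OF dir_deriv_works[OF differentiable_X] g_derivative[OF X_in_S]] .

lemma image_partials_v: "has_partials v (vx z) (vy z) z"
proof -
  have "((\<lambda>z. u (X z)) has_derivative (\<lambda>s. G z \<bullet> dir_deriv X s z)) (at z)"
    using has_derivative_compose[OF dir_deriv_works[OF differentiable_X] u_derivative[OF X_in_S]] .
  then show ?thesis
    unfolding v_def[abs_def] by (rule has_partialsI) (simp_all add: vx_def vy_def)
qed

lemma G_inner_derivative:
  assumes "w differentiable at z"
  shows "((\<lambda>z. G z \<bullet> w z) has_derivative (\<lambda>s. (G z \<bullet> dir_deriv X s z) * (G z \<bullet> w z)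
     - (G z \<bullet> G z) / 2 * (dir_deriv X s z \<bullet> w z) + G z \<bullet> dir_deriv w s z)) (at z)"
  using has_derivative_inner[OF G_derivative dir_deriv_works[OF assms]]
  by (simp add: inner_diff_left algebra_simps)

text \<open>Pythagoras in the tangent-normal frame. It rewrites the term |du|^2 of the Hessian in
  \<open>vx\<close>, \<open>vy\<close> and \<open>h\<close>, and this is why the system
  closes.\<close>

lemma G_norm: "(G z \<bullet> G z) * E z = (vx z)\<^sup>2 + (vy z)\<^sup>2 + 4 * (h z)\<^sup>2"
proof -
  have "4 * (h z)\<^sup>2 = E z * ((G z \<bullet> N z) * (G z \<bullet> N z))"
    unfolding E_eq by (simp add: h_def power2_eq_square)
  then show ?thesis
    using frame[of z "G z" "G z"] by (simp add: vx_def vy_def power2_eq_square mult.commute)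
qed

text \<open>Meant for second derivatives of \<open>X\<close> as \<open>p\<close>: then the premises
  are the Gauss equations, and du of such a vector becomes linear in \<open>vx\<close>,
  \<open>vy\<close> and \<open>h\<close>.\<close>

lemma G_frame:
  assumes "p \<bullet> Xx z = E z * a" "p \<bullet> Xy z = E z * b" "p \<bullet> N z = E z * k"
  shows "G z \<bullet> p = a * vx z + b * vy z + 2 * (exp (\<alpha> z) * k) * h z"
proof -
  have "E z * (G z \<bullet> p) = E z * (a * vx z + b * vy z + E z * (G z \<bullet> N z) * k)"
    unfolding frame[of z "G z" p] assms by (simp add: vx_def vy_def algebra_simps)
  then have "G z \<bullet> p = a * vx z + b * vy z + E z * (G z \<bullet> N z) * k"
    by simp
  also have "E z * (G z \<bullet> N z) * k = 2 * (exp (\<alpha> z) * k) * h z"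
    unfolding E_eq h_def by simp
  finally show ?thesis .
qed

lemma G_N_frame:
  assumes "p \<bullet> Xx z = - (E z * a)" "p \<bullet> Xy z = - (E z * b)" "p \<bullet> N z = 0"
  shows "G z \<bullet> p = - (a * vx z) - b * vy z"
  using G_frame[of p z "- a" "- b" 0] assms by simp

text \<open>The derivative of du(X_x) is the Hessian of \<open>u\<close> on two tangent vectors plus
  du of a second derivative of \<open>X\<close>. The first part gives the quadratic terms by
  \<open>G_norm\<close>, the second one the linear terms by \<open>G_frame\<close>.\<close>

lemma image_partials_vx: "has_partials vx
      (((vx z)\<^sup>2 - (vy z)\<^sup>2) / 2 - 2 * (h z)\<^sup>2 + \<alpha>x z * vx z - \<alpha>y z * vy z + 2 * (exp (\<alpha> z) * k1 z) * h z)
      (vx z * vy z + \<alpha>y z * vx z + \<alpha>x z * vy z) z"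
proof -
  have "((\<lambda>z. G z \<bullet> Xx z) has_derivative (\<lambda>s. (G z \<bullet> dir_deriv X s z) * vx z
     - (G z \<bullet> G z) / 2 * (dir_deriv X s z \<bullet> Xx z) + G z \<bullet> dir_deriv Xx s z)) (at z)"
    unfolding vx_def by (rule G_inner_derivative) (rule differentiable_X1)
  then have "has_partials vx (vx z * vx z - (G z \<bullet> G z) / 2 * E z + G z \<bullet> dir_deriv Xx 1 z)
     (vx z * vy z + G z \<bullet> dir_deriv Xx \<i> z) z"
    unfolding vx_def[abs_def] vy_def by (rule has_partialsI) (simp_all add: mult.commute)
  moreover have "G z \<bullet> dir_deriv Xx 1 z = \<alpha>x z * vx z + (- \<alpha>y z) * vy z + 2 * (exp (\<alpha> z) * k1 z) * h z"
    by (rule G_frame) (simp_all add: X2_tangent X2_normal)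
  moreover have "G z \<bullet> dir_deriv Xx \<i> z = \<alpha>y z * vx z + \<alpha>x z * vy z + 2 * (exp (\<alpha> z) * 0) * h z"
    by (rule G_frame) (simp_all add: X2_tangent X2_normal)
  moreover have "vx z * vx z - (G z \<bullet> G z) / 2 * E z = ((vx z)\<^sup>2 - (vy z)\<^sup>2) / 2 - 2 * (h z)\<^sup>2"
    using G_norm[of z] by (simp add: power2_eq_square field_simps)
  ultimately show ?thesis
    by (elim has_partials_eq_rhs) linarith+
qed

lemma image_partials_vy: "has_partials vy
      (vx z * vy z + \<alpha>y z * vx z + \<alpha>x z * vy z)
      (((vy z)\<^sup>2 - (vx z)\<^sup>2) / 2 - 2 * (h z)\<^sup>2 - \<alpha>x z * vx z + \<alpha>y z * vy z + 2 * (exp (\<alpha> z) * k2 z) * h z) z"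
proof -
  have "((\<lambda>z. G z \<bullet> Xy z) has_derivative (\<lambda>s. (G z \<bullet> dir_deriv X s z) * vy z
     - (G z \<bullet> G z) / 2 * (dir_deriv X s z \<bullet> Xy z) + G z \<bullet> dir_deriv Xy s z)) (at z)"
    unfolding vy_def by (rule G_inner_derivative) (rule differentiable_X1)
  then have "has_partials vy (vx z * vy z + G z \<bullet> dir_deriv Xy 1 z)
     (vy z * vy z - (G z \<bullet> G z) / 2 * E z + G z \<bullet> dir_deriv Xy \<i> z) z"
    unfolding vx_def vy_def[abs_def] by (rule has_partialsI) simp_all
  moreover have "G z \<bullet> dir_deriv Xy 1 z = \<alpha>y z * vx z + \<alpha>x z * vy z + 2 * (exp (\<alpha> z) * 0) * h z"
    by (rule G_frame) (simp_all add: X2_tangent X2_normal)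
  moreover have "G z \<bullet> dir_deriv Xy \<i> z = (- \<alpha>x z) * vx z + \<alpha>y z * vy z + 2 * (exp (\<alpha> z) * k2 z) * h z"
    by (rule G_frame) (simp_all add: X2_tangent X2_normal)
  moreover have "vy z * vy z - (G z \<bullet> G z) / 2 * E z = ((vy z)\<^sup>2 - (vx z)\<^sup>2) / 2 - 2 * (h z)\<^sup>2"
    using G_norm[of z] by (simp add: power2_eq_square field_simps)
  ultimately show ?thesis
    by (elim has_partials_eq_rhs) linarith+
qed

lemma exp_\<alpha>_derivative:
  "((\<lambda>z. exp (\<alpha> z)) has_derivative (\<lambda>s. exp (\<alpha> z) * dir_deriv \<alpha> s z)) (at z)"
  by (auto intro!: derivative_eq_intros dir_deriv_works[OF differentiable_\<alpha>])

text \<open>The factor e^\<alpha> contributes the term with \<alpha>, and the product du du of the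
  Hessian contributes the derivative of v times \<open>h\<close>. The term with |du|^2 drops out
  because tangents are orthogonal to N. The curvature term is the Weingarten equation along a
  curvature line.\<close>

lemma image_partials_h: "has_partials h
      (\<alpha>x z * h z + vx z * h z - exp (\<alpha> z) * k1 z * vx z / 2)
      (\<alpha>y z * h z + vy z * h z - exp (\<alpha> z) * k2 z * vy z / 2) z"
proof -
  have "((\<lambda>z. exp (\<alpha> z) * (G z \<bullet> N z)) has_derivative (\<lambda>s. exp (\<alpha> z) *
      ((G z \<bullet> dir_deriv X s z) * (G z \<bullet> N z) - (G z \<bullet> G z) / 2 * (dir_deriv X s z \<bullet> N z)
        + G z \<bullet> dir_deriv N s z)
      + (exp (\<alpha> z) * dir_deriv \<alpha> s z) * (G z \<bullet> N z))) (at z)"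
    by (intro has_derivative_mult exp_\<alpha>_derivative G_inner_derivative differentiable_N)
  from has_derivative_mult_right[OF this, of "1 / 2"]
  have *: "(h has_derivative (\<lambda>s. (exp (\<alpha> z) *
      ((G z \<bullet> dir_deriv X s z) * (G z \<bullet> N z) - (G z \<bullet> G z) / 2 * (dir_deriv X s z \<bullet> N z)
        + G z \<bullet> dir_deriv N s z)
      + (exp (\<alpha> z) * dir_deriv \<alpha> s z) * (G z \<bullet> N z)) / 2)) (at z)"
    unfolding h_def[abs_def] by simp
  have "G z \<bullet> dir_deriv N 1 z = - (k1 z * vx z) - 0 * vy z"
    by (rule G_N_frame) (simp_all add: N_derivative_inner X2_normal)
  moreover have "G z \<bullet> dir_deriv N \<i> z = - (0 * vx z) - k2 z * vy z"
    by (rule G_N_frame) (simp_all add: N_derivative_inner X2_normal)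
  ultimately show ?thesis
    by (intro has_partialsI[OF *]) (simp_all add: h_def flip: vx_def vy_def, simp_all add: field_simps)
qed

lemma Y1: "dir_deriv Y t z = D1 (dir_deriv X t z) (X z)"
  unfolding Y_def[abs_def]
  by (rule dir_deriv_at) (rule has_derivative_compose[OF dir_deriv_works[OF differentiable_X]
        dir_deriv_works[OF differentiable_f[OF X_in_S]]])

lemma D1_expand:
  assumes x: "x \<in> S"
  shows "D1 w x = (\<Sum>i\<in>UNIV. (w $ i) *\<^sub>R D1 (axis i 1) x)"
proof -
  have lin: "linear (\<lambda>v. D1 v x)"
    using has_derivative_linear[OF dir_deriv_works[OF differentiable_f[OF x]]] .
  have "D1 w x = D1 (\<Sum>i\<in>UNIV. (w $ i) *\<^sub>R axis i 1) x"
    by (simp only: axis_expansion)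
  then show ?thesis
    by (simp only: linear_sum[OF lin] linear_cmul[OF lin])
qed

lemma D1_X_derivative: "((\<lambda>z. D1 w (X z)) has_derivative (\<lambda>s. D2 w (dir_deriv X s z) (X z))) (at z)"
  using has_derivative_compose[OF dir_deriv_works[OF differentiable_X]
      dir_deriv_works[OF differentiable_D1[OF X_in_S]]] .

text \<open>Direction and base point both vary with z here. Expanding the direction over the
  coordinate axes leaves products of scalar functions with derivatives in fixed directions.\<close>

lemma differentiable_D1_X:
  assumes "w differentiable at z"
  shows "(\<lambda>z. D1 (w z) (X z)) differentiable at z"
proof -
  have "(\<lambda>z. (w z $ i) *\<^sub>R D1 (axis i 1) (X z)) differentiable at z" for i
    using has_derivative_scaleR[OF bounded_linear.has_derivative[OF bounded_linear_vec_nth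
          dir_deriv_works[OF assms]] D1_X_derivative]
    by (rule differentiableI)
  then show ?thesis
    by (subst D1_expand[OF X_in_S]) (intro differentiable_sum, auto)
qed

lemma differentiable_Y1: "dir_deriv Y t differentiable at z"
  unfolding Y1[abs_def] by (rule differentiable_D1_X) (rule differentiable_X1)

text \<open>Testing against the image of a fixed vector w: the product of a tangent of
  \<open>Y\<close> with it is e^(2v) times the product upstairs. Differentiating this relation
  leaves one term with a second derivative of \<open>f\<close>, which the Koszul formula
  \<open>D2_D1_g\<close> evaluates.\<close>

lemma Y2_inner: "dir_deriv (dir_deriv Y t) s z \<bullet> D1 w (X z) = exp (2 * v z) *
   ((G z \<bullet> dir_deriv X s z) * (dir_deriv X t z \<bullet> w) + dir_deriv (dir_deriv X t) s z \<bullet> w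
    - (G z \<bullet> w) * (dir_deriv X s z \<bullet> dir_deriv X t z)
    + (G z \<bullet> dir_deriv X t z) * (dir_deriv X s z \<bullet> w))"
proof -
  have "((\<lambda>z. dir_deriv Y t z \<bullet> D1 w (X z)) has_derivative (\<lambda>s. dir_deriv Y t z \<bullet> D2 w (dir_deriv X s z) (X z)
      + dir_deriv (dir_deriv Y t) s z \<bullet> D1 w (X z))) (at z)"
    by (intro has_derivative_inner D1_X_derivative dir_deriv_works differentiable_Y1)
  moreover have "dir_deriv Y t z \<bullet> D1 w (X z) = exp (2 * v z) * (dir_deriv X t z \<bullet> w)" for z
    by (simp add: Y1 D1_inner[OF X_in_S] v_def exp_u[OF X_in_S])
  moreover have "((\<lambda>z. exp (2 * v z) * (dir_deriv X t z \<bullet> w)) has_derivative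
      (\<lambda>s. exp (2 * v z) * (dir_deriv (dir_deriv X t) s z \<bullet> w)
        + exp (2 * v z) * (2 * dir_deriv v s z) * (dir_deriv X t z \<bullet> w))) (at z)"
    by (auto intro!: derivative_eq_intros dir_deriv_works differentiable_X1
        has_partials_imp(1)[OF image_partials_v])
  ultimately have "dir_deriv Y t z \<bullet> D2 w (dir_deriv X s z) (X z)
      + dir_deriv (dir_deriv Y t) s z \<bullet> D1 w (X z) =
      exp (2 * v z) * (dir_deriv (dir_deriv X t) s z \<bullet> w)
        + exp (2 * v z) * (2 * dir_deriv v s z) * (dir_deriv X t z \<bullet> w)"
    by (metis (no_types, lifting) ext dir_deriv_at)
  moreover have "dir_deriv v s z = G z \<bullet> dir_deriv X s z"
    unfolding v_def[abs_def] by (rule dir_deriv_at)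
      (rule has_derivative_compose[OF dir_deriv_works[OF differentiable_X] u_derivative[OF X_in_S]])
  moreover have "dir_deriv Y t z \<bullet> D2 w (dir_deriv X s z) (X z) = exp (2 * v z) *
     ((G z \<bullet> dir_deriv X s z) * (w \<bullet> dir_deriv X t z) + (G z \<bullet> w) * (dir_deriv X s z \<bullet> dir_deriv X t z)
      - (G z \<bullet> dir_deriv X t z) * (w \<bullet> dir_deriv X s z))"
    using D2_D1_g[OF X_in_S, of w "dir_deriv X s z" z "dir_deriv X t z"]
    by (simp add: Y1 v_def inner_commute)
  ultimately show ?thesis
    by (simp add: algebra_simps inner_commute)
qed

abbreviation NY where "NY \<equiv> unit_normal Y"

lemma Y_tangent_inner:
  "dir_deriv Y 1 z \<bullet> dir_deriv Y 1 z = exp (2 * v z) * E z"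
  "dir_deriv Y \<i> z \<bullet> dir_deriv Y \<i> z = exp (2 * v z) * E z"
  "dir_deriv Y 1 z \<bullet> dir_deriv Y \<i> z = 0"
  by (simp_all add: Y1 D1_inner[OF X_in_S] v_def exp_u[OF X_in_S])

lemma conf_exponent_Y: "conf_exponent Y z = \<alpha> z + v z"
  unfolding conf_exponent_def[of Y] first_form_def Y_tangent_inner
  by (simp add: ln_mult)

text \<open>A conformal differential keeps the frame orthogonal, so it sends N to a multiple of the
  new normal, of length e^v. The quotient is therefore the sign that records whether the normal is
  preserved.\<close>

definition \<epsilon>_fun where "\<epsilon>_fun z = NY z \<bullet> D1 (N z) (X z) / exp (v z)"

text \<open>Expansion in the image of the frame of \<open>X\<close>, with N stretched by e^\<alpha>
  to the length of the tangents; the two tangential terms vanish because the new normal is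
  orthogonal to them.\<close>

lemma Y_frame: "exp (2 * v z) * (p \<bullet> NY z) = (p \<bullet> D1 (N z) (X z)) * (NY z \<bullet> D1 (N z) (X z))"
proof -
  have pos: "0 < exp (2 * v z) * E z"
    by simp
  have c: "c (X z) = exp (2 * v z)"
    by (simp add: v_def exp_u[OF X_in_S])
  have exp_exp: "exp (\<alpha> z) * (exp (\<alpha> z) * y) = exp (\<alpha> z * 2) * y" for y
    using exp_add[of "\<alpha> z" "\<alpha> z"] by (simp add: mult_2_right)
  note NY = unit_normal_conformal(2-)[OF Y_tangent_inner pos]
  define F :: "3 \<Rightarrow> real^3" where "F i = (if i = 1 then dir_deriv Y 1 z else if i = 2 then dir_deriv Y \<i> z
    else exp (\<alpha> z) *\<^sub>R D1 (N z) (X z))" for i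
  have "\<forall>i j. F i \<bullet> F j = (if i = j then exp (2 * v z) * E z else 0)"
    unfolding forall_3 F_def
    by (simp add: Y1 D1_inner[OF X_in_S] c E_eq)
  with pos have "exp (2 * v z) * E z * (p \<bullet> NY z) = (\<Sum>i\<in>UNIV. (p \<bullet> F i) * (NY z \<bullet> F i))"
    by (intro inner_orthogonal_frame) auto
  then have "E z * (exp (2 * v z) * (p \<bullet> NY z)) = E z * ((p \<bullet> D1 (N z) (X z)) * (NY z \<bullet> D1 (N z) (X z)))"
    by (simp add: sum_3 F_def NY algebra_simps exp_exp)
  then show ?thesis
    by simp
qed

lemma \<epsilon>_fun_square: "\<epsilon>_fun z * \<epsilon>_fun z = 1"
proof -
  have "NY z \<bullet> NY z = 1"
    by (rule unit_normal_conformal(2)[OF Y_tangent_inner]) simp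
  then show ?thesis
    using Y_frame[of z "NY z"] exp_add[of "v z" "v z"]
    unfolding \<epsilon>_fun_def times_divide_times_eq by (simp flip: mult_2)
qed

lemma Y2_normal: "exp (2 * v z) * (dir_deriv (dir_deriv Y t) s z \<bullet> NY z) = exp (2 * v z) *
  (\<epsilon>_fun z * exp (v z) *
    (dir_deriv (dir_deriv X t) s z \<bullet> N z - (G z \<bullet> N z) * (dir_deriv X s z \<bullet> dir_deriv X t z)))"
  if "s \<in> {1, \<i>}" "t \<in> {1, \<i>}"
  unfolding Y_frame Y2_inner \<epsilon>_fun_def using that by (auto simp: algebra_simps)

text \<open>Apart from the rescaling and the sign, both principal curvatures are shifted by the same
  normal derivative of \<open>u\<close>. Hence their difference, which enters the Hopf coefficient,
  is not shifted.\<close>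

lemma curv_Y:
  "exp (conf_exponent Y z) * curv1 Y z = \<epsilon>_fun z * (exp (\<alpha> z) * k1 z - 2 * h z)"
  "exp (conf_exponent Y z) * curv2 Y z = \<epsilon>_fun z * (exp (\<alpha> z) * k2 z - 2 * h z)"
proof -
  have vv: "exp (2 * v z) = exp (v z) * exp (v z)"
    by (simp flip: exp_add)
  have "dir_deriv (dir_deriv Y 1) 1 z \<bullet> NY z = \<epsilon>_fun z * exp (v z) * (E z * k1 z - (G z \<bullet> N z) * E z)"
    using Y2_normal[of 1 1 z] by (simp add: X2_normal)
  then show "exp (conf_exponent Y z) * curv1 Y z = \<epsilon>_fun z * (exp (\<alpha> z) * k1 z - 2 * h z)"
    unfolding curv1_def[of Y] second_form_def first_form_def Y_tangent_inner conf_exponent_Y vv E_eq exp_add h_def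
    by (simp add: field_simps)
  have "dir_deriv (dir_deriv Y \<i>) \<i> z \<bullet> NY z = \<epsilon>_fun z * exp (v z) * (E z * k2 z - (G z \<bullet> N z) * E z)"
    using Y2_normal[of \<i> \<i> z] by (simp add: X2_normal)
  then show "exp (conf_exponent Y z) * curv2 Y z = \<epsilon>_fun z * (exp (\<alpha> z) * k2 z - 2 * h z)"
    unfolding curv2_def[of Y] second_form_def first_form_def Y_tangent_inner conf_exponent_Y vv E_eq exp_add h_def
    by (simp add: field_simps)
qed

lemma continuous_\<epsilon>_fun: "continuous_on UNIV \<epsilon>_fun"
proof -
  have "continuous_on UNIV (dir_deriv Y t)" for t
    by (simp add: differentiable_Y1 differentiable_imp_continuous_on differentiable_on_def
        differentiable_at_withinI)
  moreover have "continuous_on UNIV (\<lambda>z. D1 (N z) (X z))"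
    by (simp add: differentiable_D1_X differentiable_N differentiable_imp_continuous_on
        differentiable_on_def differentiable_at_withinI)
  moreover have "continuous_on UNIV v"
    using has_partials_imp(1)[OF image_partials_v]
    by (simp add: differentiable_imp_continuous_on differentiable_on_def differentiable_at_withinI)
  moreover have "continuous_on UNIV \<alpha>"
    by (simp add: differentiable_\<alpha> differentiable_imp_continuous_on differentiable_on_def
        differentiable_at_withinI)
  moreover have "NY z = (1 / (exp (2 * v z) * E z)) *\<^sub>R cross3 (dir_deriv Y 1 z) (dir_deriv Y \<i> z)" for z
    by (rule unit_normal_conformal(1)[OF Y_tangent_inner]) simp
  ultimately show ?thesis
    unfolding \<epsilon>_fun_def[abs_def] by (auto intro!: continuous_intros continuous_on_cross)
qed

text \<open>The pointwise sign is continuous with values 1 and -1 on the connected plane, hence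
  constant.\<close>

lemma conformal_change: "\<exists>\<epsilon>. conformal_change X Y \<epsilon> v vx vy h"
proof -
  have val: "\<epsilon>_fun z \<in> {1, -1}" for z
    using \<epsilon>_fun_square[of z] by (auto simp: square_eq_1_iff)
  have "\<epsilon>_fun constant_on UNIV"
    using continuous_\<epsilon>_fun val
    by (intro continuous_finite_range_constant) (auto intro: finite_subset[of _ "{1, -1}"])
  then obtain e where e: "\<And>z. \<epsilon>_fun z = e"
    by (auto simp: constant_on_def)
  with val have "e = 1 \<or> e = - 1"
    by auto
  then have "conformal_change X Y e v vx vy h"
    by unfold_locales (simp_all only: differentiable_\<alpha> conf_exponent_Y curv_Y[unfolded conf_exponent_Y] e image_partials_v
        image_partials_vx image_partials_vy image_partials_h)
  then show ?thesis ..
qed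

end

section \<open>The gauge transformation\<close>

definition has_wirtinger :: "(complex \<Rightarrow> complex) \<Rightarrow> complex \<Rightarrow> complex \<Rightarrow> complex \<Rightarrow> bool" where
  "has_wirtinger f a b z \<longleftrightarrow> (f has_derivative (\<lambda>t. a * t + b * cnj t)) (at z)"

lemma has_partials_imp_has_wirtinger:
  assumes "has_partials f fx fy z"
  shows "has_wirtinger f ((fx - \<i> * fy) / 2) ((fx + \<i> * fy) / 2) z"
proof -
  have "Re t *\<^sub>R fx + Im t *\<^sub>R fy = (fx - \<i> * fy) / 2 * t + (fx + \<i> * fy) / 2 * cnj t" for t
    by (simp add: complex_eq_iff field_simps)
  with assms show ?thesis
    by (simp add: has_partials_def has_wirtinger_def)
qed

lemma differentiable_imp_has_wirtinger:
  "f differentiable at z \<Longrightarrow> has_wirtinger f (d_z f z) (d_zbar f z) z"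
  unfolding d_z_def d_zbar_def by (intro has_partials_imp_has_wirtinger has_partials_dir_deriv)

lemma has_wirtinger_imp:
  assumes "has_wirtinger f a b z"
  shows "f differentiable at z" "d_z f z = a" "d_zbar f z = b"
proof -
  have D: "dir_deriv f t z = a * t + b * cnj t" for t
    using assms unfolding has_wirtinger_def by (rule dir_deriv_at)
  show "f differentiable at z"
    using assms unfolding has_wirtinger_def by (rule differentiableI)
  show "d_z f z = a" "d_zbar f z = b"
    by (simp_all add: d_z_def d_zbar_def D field_simps)
qed

lemma has_wirtinger_eq_rhs:
  "has_wirtinger f a b z \<Longrightarrow> a = a' \<Longrightarrow> b = b' \<Longrightarrow> has_wirtinger f a' b' z"
  by simp

lemma has_wirtinger_const: "has_wirtinger (\<lambda>z. k) 0 0 z"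
  by (simp add: has_wirtinger_def)

lemma has_wirtinger_add:
  assumes "has_wirtinger f a b z" "has_wirtinger g a' b' z"
  shows "has_wirtinger (\<lambda>z. f z + g z) (a + a') (b + b') z"
  using has_derivative_add[OF assms[unfolded has_wirtinger_def]]
  by (simp add: has_wirtinger_def algebra_simps)

lemma has_wirtinger_diff:
  assumes "has_wirtinger f a b z" "has_wirtinger g a' b' z"
  shows "has_wirtinger (\<lambda>z. f z - g z) (a - a') (b - b') z"
  using has_derivative_diff[OF assms[unfolded has_wirtinger_def]]
  by (simp add: has_wirtinger_def algebra_simps)

lemma has_wirtinger_mult:
  assumes "has_wirtinger f a b z" "has_wirtinger g a' b' z"
  shows "has_wirtinger (\<lambda>z. f z * g z) (f z * a' + a * g z) (f z * b' + b * g z) z"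
  using has_derivative_mult[OF assms[unfolded has_wirtinger_def]]
  by (simp add: has_wirtinger_def algebra_simps)

lemma has_wirtinger_cmult:
  assumes "has_wirtinger f a b z"
  shows "has_wirtinger (\<lambda>z. k * f z) (k * a) (k * b) z"
  using has_wirtinger_mult[OF has_wirtinger_const assms] by simp

lemma has_wirtinger_of_real:
  fixes f :: "complex \<Rightarrow> real"
  assumes "has_partials f fx fy z"
  shows "has_wirtinger (\<lambda>z. of_real (f z)) ((fx - \<i> * fy) / 2) ((fx + \<i> * fy) / 2) z"
proof -
  have "((\<lambda>z. of_real (f z) :: complex) has_derivative (\<lambda>t. of_real (Re t *\<^sub>R fx + Im t *\<^sub>R fy))) (at z)"
    using assms unfolding has_partials_def by (rule has_derivative_of_real)
  then have "has_partials (\<lambda>z. of_real (f z) :: complex) (of_real fx) (of_real fy) z"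
    unfolding has_partials_def by (simp add: scaleR_conv_of_real)
  then show ?thesis
    by (rule has_partials_imp_has_wirtinger)
qed

lemma has_wirtinger_exp:
  fixes f :: "complex \<Rightarrow> real" and a b :: complex
  assumes "has_wirtinger (\<lambda>z. of_real (f z)) a b z"
  shows "has_wirtinger (\<lambda>z. of_real (exp (f z))) (of_real (exp (f z)) * a) (of_real (exp (f z)) * b) z"
proof -
  have "((\<lambda>z. exp (of_real (f z) :: complex)) has_derivative
      (\<lambda>t. exp (of_real (f z)) * (a * t + b * cnj t))) (at z)"
    using has_derivative_compose[OF assms[unfolded has_wirtinger_def]
        DERIV_exp[THEN has_field_derivative_imp_has_derivative]] by simp
  then show ?thesis
    by (simp add: has_wirtinger_def exp_of_real algebra_simps)
qed

lemma differentiable_axis: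
  assumes "f differentiable F"
  shows "(\<lambda>z. axis i (f z) :: complex^'n) differentiable F"
proof -
  have "linear (axis i :: complex \<Rightarrow> complex^'n)"
    by (rule linearI) (simp_all add: vec_eq_iff axis_def)
  then have "bounded_linear (axis i :: complex \<Rightarrow> complex^'n)"
    by (simp add: linear_linear)
  then show ?thesis
    using assms unfolding differentiable_def using bounded_linear.has_derivative by blast
qed

lemma differentiable_vec2_iff:
  fixes f :: "'a::real_normed_vector \<Rightarrow> complex^2"
  shows "f differentiable F \<longleftrightarrow> (\<lambda>z. f z $ 1) differentiable F \<and> (\<lambda>z. f z $ 2) differentiable F"
proof
  assume "f differentiable F"
  then show "(\<lambda>z. f z $ 1) differentiable F \<and> (\<lambda>z. f z $ 2) differentiable F"
    unfolding differentiable_def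
    using bounded_linear.has_derivative[OF bounded_linear_vec_nth] by blast
next
  assume "(\<lambda>z. f z $ 1) differentiable F \<and> (\<lambda>z. f z $ 2) differentiable F"
  then have "(\<lambda>z. axis 1 (f z $ 1) + axis 2 (f z $ 2) :: complex^2) differentiable F"
    by (intro differentiable_add differentiable_axis) auto
  moreover have "axis 1 (f z $ 1) + axis 2 (f z $ 2) = f z" for z
    by (simp add: vec_eq_iff forall_2 axis_def)
  ultimately show "f differentiable F"
    by simp
qed

lemma differentiable_C4_iff:
  fixes \<phi> :: "complex \<Rightarrow> C4"
  shows "\<phi> differentiable at z \<longleftrightarrow>
    (\<lambda>z. fst (\<phi> z) $ 1) differentiable at z \<and> (\<lambda>z. fst (\<phi> z) $ 2) differentiable at z \<and>
    (\<lambda>z. snd (\<phi> z) $ 1) differentiable at z \<and> (\<lambda>z. snd (\<phi> z) $ 2) differentiable at z"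
proof -
  have "\<phi> differentiable at z \<longleftrightarrow> (\<lambda>z. fst (\<phi> z)) differentiable at z \<and> (\<lambda>z. snd (\<phi> z)) differentiable at z"
  proof safe
    assume "\<phi> differentiable at z"
    then obtain D where "(\<phi> has_derivative D) (at z)"
      by (auto simp: differentiable_def)
    from has_derivative_fst[OF this] has_derivative_snd[OF this]
    show "(\<lambda>z. fst (\<phi> z)) differentiable at z" "(\<lambda>z. snd (\<phi> z)) differentiable at z"
      by (auto intro: differentiableI)
  next
    assume "(\<lambda>z. fst (\<phi> z)) differentiable at z" "(\<lambda>z. snd (\<phi> z)) differentiable at z"
    then have "(\<lambda>z. (fst (\<phi> z), snd (\<phi> z))) differentiable at z"
      by (rule differentiable_Pair)
    then show "\<phi> differentiable at z"
      by simp
  qed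
  then show ?thesis
    by (simp add: differentiable_vec2_iff conj_assoc)
qed

section \<open>The linear system as scalar equations, and the gauge map\<close>

definition mean_coeff :: "(complex \<Rightarrow> real^3) \<Rightarrow> complex \<Rightarrow> complex" where
  "mean_coeff X z = of_real ((curv1 X z + curv2 X z) / 4 * exp (conf_exponent X z))"

definition hopf_coeff :: "(complex \<Rightarrow> real^3) \<Rightarrow> complex \<Rightarrow> complex" where
  "hopf_coeff X z = of_real ((curv1 X z - curv2 X z) / 4 * exp (conf_exponent X z))"

lemma U_mat_eq: "U_mat X z = vector [vector [alpha_z X z, hopf_coeff X z], vector [- mean_coeff X z, 0]]"
proof -
  have "- (curv1 X z + curv2 X z) / 4 * exp (conf_exponent X z) =
      - ((curv1 X z + curv2 X z) / 4 * exp (conf_exponent X z))"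
    by (simp add: algebra_simps)
  then show ?thesis
    unfolding U_mat_def hopf_coeff_def mean_coeff_def by (simp only: of_real_minus)
qed

lemma V_mat_eq: "V_mat X z = vector [vector [0, mean_coeff X z], vector [- hopf_coeff X z, alpha_zbar X z]]"
proof -
  have "(curv2 X z - curv1 X z) / 4 * exp (conf_exponent X z) =
      - ((curv1 X z - curv2 X z) / 4 * exp (conf_exponent X z))"
    by (simp add: field_simps)
  then show ?thesis
    unfolding V_mat_def hopf_coeff_def mean_coeff_def by (simp only: of_real_minus)
qed

lemma solution_iff:
  "solution X lam \<phi> \<longleftrightarrow> (\<forall>z.
    has_wirtinger (\<lambda>z. fst (\<phi> z) $ 1)
      (alpha_z X z * fst (\<phi> z) $ 1 + hopf_coeff X z * fst (\<phi> z) $ 2)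
      (mean_coeff X z * fst (\<phi> z) $ 2 + lam * snd (\<phi> z) $ 2) z \<and>
    has_wirtinger (\<lambda>z. fst (\<phi> z) $ 2)
      (- mean_coeff X z * fst (\<phi> z) $ 1 + lam * snd (\<phi> z) $ 1)
      (- hopf_coeff X z * fst (\<phi> z) $ 1 + alpha_zbar X z * fst (\<phi> z) $ 2) z \<and>
    has_wirtinger (\<lambda>z. snd (\<phi> z) $ 1)
      (lam * fst (\<phi> z) $ 2 + 2 * alpha_z X z * snd (\<phi> z) $ 1 + hopf_coeff X z * snd (\<phi> z) $ 2)
      (alpha_zbar X z * snd (\<phi> z) $ 1 + mean_coeff X z * snd (\<phi> z) $ 2) z \<and>
    has_wirtinger (\<lambda>z. snd (\<phi> z) $ 2)
      (- mean_coeff X z * snd (\<phi> z) $ 1 + alpha_z X z * snd (\<phi> z) $ 2)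
      (lam * fst (\<phi> z) $ 1 - hopf_coeff X z * snd (\<phi> z) $ 1 + 2 * alpha_zbar X z * snd (\<phi> z) $ 2) z)"
  (is "_ \<longleftrightarrow> (\<forall>z. ?R z)")
proof -
  have iff: "has_wirtinger f a b z \<longleftrightarrow> f differentiable at z \<and> d_z f z = a \<and> d_zbar f z = b" for f a b z
    using has_wirtinger_imp differentiable_imp_has_wirtinger by blast
  have "\<phi> differentiable at z \<and> d_z4 \<phi> z =
        block_apply (U_mat X z) (mat lam ** J_minus)
                    (mat lam ** J_plus) (U_mat X z + mat (alpha_z X z)) (\<phi> z) \<and>
     d_zbar4 \<phi> z =
        block_apply (V_mat X z) (mat lam ** J_plus)
                    (mat lam ** J_minus) (V_mat X z + mat (alpha_zbar X z)) (\<phi> z) \<longleftrightarrow> ?R z" for z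
    unfolding iff differentiable_C4_iff
    by (auto simp: d_z4_def d_zbar4_def block_apply_def U_mat_eq V_mat_eq J_plus_def J_minus_def
        matrix_matrix_mult_def matrix_vector_mult_def mat_def vec_eq_iff forall_2 sum_2
        algebra_simps)
  then show ?thesis
    unfolding solution_def by blast
qed

text \<open>This is the matrix of the gauge transformation between the linear systems of \<open>X\<close> and \<open>F \<circ> X\<close>,
  where \<open>v\<close> is the logarithm of the conformal factor of \<open>F\<close> along \<open>X\<close>, \<open>h\<close> is \<open>e\<^bsup>\<alpha>\<^esup> / 2\<close> times its
  normal derivative, and \<open>\<epsilon>\<close> tells whether \<open>F\<close> preserves the normal.\<close>

definition gauge_map ::
  "real \<Rightarrow> (complex \<Rightarrow> real) \<Rightarrow> (complex \<Rightarrow> real) \<Rightarrow> (complex \<Rightarrow> real) \<Rightarrow> (complex \<Rightarrow> real) \<Rightarrow>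
    complex \<Rightarrow> complex \<Rightarrow> C4 \<Rightarrow> C4" where
  "gauge_map \<epsilon> v vx vy h lam z r =
    (let e = complex_of_real (exp (v z)); w = (vx z - \<i> * vy z) / 2; w' = (vx z + \<i> * vy z) / 2 in
     (vector [e * fst r $ 1, e * (\<epsilon> * fst r $ 2)],
      vector [e * (\<epsilon> * (snd r $ 1 + (1 / lam) * (w * fst r $ 2 - h z * fst r $ 1))),
              e * (snd r $ 2 + (1 / lam) * (w' * fst r $ 1 + h z * fst r $ 2))]))"

lemma C4_eq_iff: "(r::C4) = r' \<longleftrightarrow> fst r $ 1 = fst r' $ 1 \<and> fst r $ 2 = fst r' $ 2 \<and>
    snd r $ 1 = snd r' $ 1 \<and> snd r $ 2 = snd r' $ 2"
  by (auto simp: prod_eq_iff vec_eq_iff forall_2)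

lemma gauge_cscale: "gauge_map \<epsilon> v vx vy h lam z (cscale k r) = cscale k (gauge_map \<epsilon> v vx vy h lam z r)"
  by (simp add: C4_eq_iff gauge_map_def Let_def cscale_def algebra_simps)

text \<open>The matrix is block lower triangular with diagonal blocks e^v times signs, so its
  inverse has the same form. The off-diagonal block changes its sign, and \<open>h\<close> takes an
  additional \<epsilon> because the normal may have been reversed.\<close>

lemma gauge_inverse:
  assumes "\<epsilon> = 1 \<or> \<epsilon> = - 1"
  shows "gauge_map \<epsilon> (\<lambda>z. - v z) (\<lambda>z. - vx z) (\<lambda>z. - vy z) (\<lambda>z. - \<epsilon> * h z) lam z (gauge_map \<epsilon> v vx vy h lam z r) = r"
proof -
  define l w w' where "l = 1 / lam" and "w = (vx z - \<i> * vy z) / 2" and "w' = (vx z + \<i> * vy z) / 2"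
  have neg: "(complex_of_real (- vx z) - \<i> * complex_of_real (- vy z)) / 2 = - w"
    "(complex_of_real (- vx z) + \<i> * complex_of_real (- vy z)) / 2 = - w'"
    by (simp_all add: w_def w'_def field_simps)
  have e1: "complex_of_real (exp (- v z)) * complex_of_real (exp (v z)) = 1"
    "complex_of_real (exp (v z)) * complex_of_real (exp (- v z)) = 1"
    by (simp_all flip: of_real_mult exp_add)
  then have e: "complex_of_real (exp (- v z)) * (complex_of_real (exp (v z)) * x) = x"
    "complex_of_real (exp (v z)) * (complex_of_real (exp (- v z)) * x) = x" for x
    by (metis mult.assoc mult.commute mult_1)+
  show ?thesis
    unfolding C4_eq_iff gauge_map_def Let_def fst_conv snd_conv vector_2 neg
    unfolding l_def[symmetric] w_def[symmetric] w'_def[symmetric]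
    using assms by (auto simp: e e1 algebra_simps simp del: exp_minus)
qed

section \<open>The closed system in complex form and the gauged equations\<close>

context conformal_change
begin

lemma conf_exponent_partials:
  "has_partials (conf_exponent X) (dir_deriv (conf_exponent X) 1 z) (dir_deriv (conf_exponent X) \<i> z) z"
  by (rule has_partials_dir_deriv) (rule differentiable_conf_exponent)

lemma alpha_z_eq: "alpha_z X z = (dir_deriv (conf_exponent X) 1 z - \<i> * dir_deriv (conf_exponent X) \<i> z) / 2"
  and alpha_zbar_eq: "alpha_zbar X z = (dir_deriv (conf_exponent X) 1 z + \<i> * dir_deriv (conf_exponent X) \<i> z) / 2"
  unfolding alpha_z_def alpha_zbar_def
  using has_wirtinger_imp(2,3)[OF has_wirtinger_of_real[OF conf_exponent_partials]] .

definition w where "w z = (vx z - \<i> * vy z) / 2"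
definition w' where "w' z = (vx z + \<i> * vy z) / 2"

lemma v_wirtinger: "has_wirtinger (\<lambda>z. of_real (v z)) (w z) (w' z) z"
  unfolding w_def w'_def by (rule has_wirtinger_of_real[OF v_partials])

lemma exp_alpha_curv:
  "exp (conf_exponent X z) * curv1 X z = 2 * (Re (mean_coeff X z) + Re (hopf_coeff X z))"
  "exp (conf_exponent X z) * curv2 X z = 2 * (Re (mean_coeff X z) - Re (hopf_coeff X z))"
  by (simp_all add: mean_coeff_def hopf_coeff_def field_simps)

lemma coeff_real: "Im (mean_coeff X z) = 0" "Im (hopf_coeff X z) = 0"
  by (simp_all add: mean_coeff_def hopf_coeff_def)

text \<open>\<open>w\<close> and \<open>w'\<close> are v_z and v_zbar. In complex notation the two
  equations for \<open>vx\<close> and \<open>vy\<close> separate: the trace-free part of the second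
  derivatives of v carries the Hopf coefficient, the Laplacian carries the mean curvature.\<close>

lemma w_wirtinger: "has_wirtinger w
    ((w z)\<^sup>2 + 2 * alpha_z X z * w z + 2 * hopf_coeff X z * h z)
    (- (h z)\<^sup>2 + 2 * mean_coeff X z * h z) z"
  using has_wirtinger_cmult[OF has_wirtinger_diff[OF has_wirtinger_of_real[OF vx_partials]
      has_wirtinger_cmult[OF has_wirtinger_of_real[OF vy_partials], of \<i>]], of "1 / 2" z]
  unfolding exp_alpha_curv
  by (simp add: w_def[abs_def])
    (erule has_wirtinger_eq_rhs, simp_all add: alpha_z_eq complex_eq_iff coeff_real power2_eq_square field_simps)

lemma w'_wirtinger: "has_wirtinger w'
    (- (h z)\<^sup>2 + 2 * mean_coeff X z * h z)
    ((w' z)\<^sup>2 + 2 * alpha_zbar X z * w' z + 2 * hopf_coeff X z * h z) z"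
  using has_wirtinger_cmult[OF has_wirtinger_add[OF has_wirtinger_of_real[OF vx_partials]
      has_wirtinger_cmult[OF has_wirtinger_of_real[OF vy_partials], of \<i>]], of "1 / 2" z]
  unfolding exp_alpha_curv
  by (simp add: w'_def[abs_def])
    (erule has_wirtinger_eq_rhs, simp_all add: alpha_zbar_eq complex_eq_iff coeff_real power2_eq_square field_simps)

lemma h_wirtinger: "has_wirtinger (\<lambda>z. of_real (h z))
    (alpha_z X z * h z + w z * h z - mean_coeff X z * w z - hopf_coeff X z * w' z)
    (alpha_zbar X z * h z + w' z * h z - mean_coeff X z * w' z - hopf_coeff X z * w z) z"
  using has_wirtinger_of_real[OF h_partials, of z] unfolding exp_alpha_curv
  by (rule has_wirtinger_eq_rhs)
    (simp_all add: w_def w'_def alpha_z_eq alpha_zbar_eq complex_eq_iff coeff_real field_simps)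

lemma mean_coeff_Y: "mean_coeff Y z = \<epsilon> * (mean_coeff X z - h z)"
proof -
  have "(curv1 Y z + curv2 Y z) / 4 * exp (conf_exponent Y z) =
      \<epsilon> * ((curv1 X z + curv2 X z) / 4 * exp (conf_exponent X z) - h z)"
    using curv1_Y[of z] curv2_Y[of z] by (simp add: field_simps)
  then show ?thesis
    unfolding mean_coeff_def by simp
qed

lemma hopf_coeff_Y: "hopf_coeff Y z = \<epsilon> * hopf_coeff X z"
proof -
  have "(curv1 Y z - curv2 Y z) / 4 * exp (conf_exponent Y z) =
      \<epsilon> * ((curv1 X z - curv2 X z) / 4 * exp (conf_exponent X z))"
    using curv1_Y[of z] curv2_Y[of z] by (simp add: field_simps)
  then show ?thesis
    unfolding hopf_coeff_def by simp
qed

lemma conf_exponent_Y_partials: "has_partials (conf_exponent Y)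
   (dir_deriv (conf_exponent X) 1 z + vx z) (dir_deriv (conf_exponent X) \<i> z + vy z) z"
  using has_derivative_add[OF conf_exponent_partials[unfolded has_partials_def] v_partials[unfolded has_partials_def]]
  unfolding has_partials_def conf_exponent_Y[abs_def] by (simp add: algebra_simps)

lemma alpha_z_Y: "alpha_z Y z = alpha_z X z + w z"
  and alpha_zbar_Y: "alpha_zbar Y z = alpha_zbar X z + w' z"
  unfolding alpha_z_def[of Y] alpha_zbar_def[of Y] alpha_z_eq alpha_zbar_eq w_def w'_def
  unfolding has_wirtinger_imp(2,3)[OF has_wirtinger_of_real[OF conf_exponent_Y_partials]]
  by (simp_all add: field_simps)

text \<open>The closed system keeps its form when the surfaces are exchanged and v is negated;
  \<open>h\<close> becomes \<open>- \<epsilon> * h\<close> because it is then measured along the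
  other normal. The reverse inclusion of the spectra rests on this symmetry.\<close>

lemma conformal_change_inverse:
  "conformal_change Y X \<epsilon> (\<lambda>z. - v z) (\<lambda>z. - vx z) (\<lambda>z. - vy z) (\<lambda>z. - \<epsilon> * h z)"
proof -
  have neg: "has_partials (\<lambda>z. k * f z) (k * a) (k * b) z"
    if "has_partials f a b z" for f :: "complex \<Rightarrow> real" and k a b z
    using has_derivative_mult_right[OF that[unfolded has_partials_def], of k]
    by (simp add: has_partials_def algebra_simps)
  note \<alpha>Y = has_partials_imp[OF conf_exponent_Y_partials]
  show ?thesis
  proof (unfold_locales, unfold \<alpha>Y curv1_Y curv2_Y)
    show "\<epsilon> = 1 \<or> \<epsilon> = - 1"
      by (rule \<epsilon>)
    fix z
    show "conf_exponent Y differentiable at z"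
      by (rule \<alpha>Y)
    show "conf_exponent X z = conf_exponent Y z + - v z"
      by (simp add: conf_exponent_Y)
    show "exp (conf_exponent X z) * curv1 X z =
         \<epsilon> * (\<epsilon> * (exp (conf_exponent X z) * curv1 X z - 2 * h z) - 2 * (- \<epsilon> * h z))"
      "exp (conf_exponent X z) * curv2 X z =
         \<epsilon> * (\<epsilon> * (exp (conf_exponent X z) * curv2 X z - 2 * h z) - 2 * (- \<epsilon> * h z))"
      using \<epsilon> by auto
    show "has_partials (\<lambda>z. - v z) (- vx z) (- vy z) z"
      using neg[OF v_partials, of "-1"] by simp
    show "has_partials (\<lambda>z. - vx z)
      (((- vx z)\<^sup>2 - (- vy z)\<^sup>2) / 2 - 2 * (- \<epsilon> * h z)\<^sup>2 + (dir_deriv (conf_exponent X) 1 z + vx z) * - vx z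
        - (dir_deriv (conf_exponent X) \<i> z + vy z) * - vy z
        + 2 * (\<epsilon> * (exp (conf_exponent X z) * curv1 X z - 2 * h z)) * (- \<epsilon> * h z))
      (- vx z * - vy z + (dir_deriv (conf_exponent X) \<i> z + vy z) * - vx z
        + (dir_deriv (conf_exponent X) 1 z + vx z) * - vy z) z"
      using neg[OF vx_partials, of "-1" z] \<epsilon>
      by (elim has_partials_eq_rhs[of "\<lambda>z. - vx z", simplified, rotated] disjE)
        (simp_all add: power2_eq_square field_simps)
    show "has_partials (\<lambda>z. - vy z)
      (- vx z * - vy z + (dir_deriv (conf_exponent X) \<i> z + vy z) * - vx z
        + (dir_deriv (conf_exponent X) 1 z + vx z) * - vy z)
      (((- vy z)\<^sup>2 - (- vx z)\<^sup>2) / 2 - 2 * (- \<epsilon> * h z)\<^sup>2 - (dir_deriv (conf_exponent X) 1 z + vx z) * - vx z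
        + (dir_deriv (conf_exponent X) \<i> z + vy z) * - vy z
        + 2 * (\<epsilon> * (exp (conf_exponent X z) * curv2 X z - 2 * h z)) * (- \<epsilon> * h z)) z"
      using neg[OF vy_partials, of "-1" z] \<epsilon>
      by (elim has_partials_eq_rhs[of "\<lambda>z. - vy z", simplified, rotated] disjE)
        (simp_all add: power2_eq_square field_simps)
    show "has_partials (\<lambda>z. - \<epsilon> * h z)
      ((dir_deriv (conf_exponent X) 1 z + vx z) * (- \<epsilon> * h z) + - vx z * (- \<epsilon> * h z)
        - \<epsilon> * (exp (conf_exponent X z) * curv1 X z - 2 * h z) * - vx z / 2)
      ((dir_deriv (conf_exponent X) \<i> z + vy z) * (- \<epsilon> * h z) + - vy z * (- \<epsilon> * h z)
        - \<epsilon> * (exp (conf_exponent X z) * curv2 X z - 2 * h z) * - vy z / 2) z"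
      using neg[OF h_partials, of "- \<epsilon>" z]
      by (rule has_partials_eq_rhs) (simp_all add: field_simps)
  qed
qed

text \<open>Compare powers of \<open>lam\<close>. In the equations for the new \<open>q\<close>, the
  terms with 1/\<open>lam\<close> cancel by \<open>w_wirtinger\<close>, \<open>w'_wirtinger\<close>
  and \<open>h_wirtinger\<close>. Where differentiating \<open>p\<close> brings in
  \<open>lam\<close> times \<open>q\<close>, the factor 1/\<open>lam\<close> is cancelled: this
  yields the shift of the mean coefficient by \<open>h\<close> and the second summand
  \<open>w\<close> (or \<open>w'\<close>) that the doubled \<alpha>-derivative of the lower block
  demands.\<close>

lemma gauge_solution:
  assumes sol: "solution X lam \<phi>" and lam: "lam \<noteq> 0"
  shows "solution Y lam (\<lambda>z. gauge_map \<epsilon> v vx vy h lam z (\<phi> z))"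
proof -
  have gauge_components: "fst (gauge_map \<epsilon> v vx vy h lam z r) $ 1 = complex_of_real (exp (v z)) * fst r $ 1"
    "fst (gauge_map \<epsilon> v vx vy h lam z r) $ 2 = complex_of_real (exp (v z)) * (\<epsilon> * fst r $ 2)"
    "snd (gauge_map \<epsilon> v vx vy h lam z r) $ 1 =
      complex_of_real (exp (v z)) * (\<epsilon> * (snd r $ 1 + (1 / lam) * (w z * fst r $ 2 - h z * fst r $ 1)))"
    "snd (gauge_map \<epsilon> v vx vy h lam z r) $ 2 =
      complex_of_real (exp (v z)) * (snd r $ 2 + (1 / lam) * (w' z * fst r $ 1 + h z * fst r $ 2))" for z r
    by (simp_all add: gauge_map_def Let_def w_def w'_def)
  \<comment> \<open>With \<open>l\<close> as a separate unknown the eight identities are polynomial,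
    to be checked modulo \<open>lam * l = 1\<close> and the relation that \<epsilon> squared is
    1.\<close>
  obtain l where l: "1 / lam = l" "lam * l = 1"
    using lam by simp
  have \<epsilon>2: "complex_of_real \<epsilon> * complex_of_real \<epsilon> = 1"
    using \<epsilon> by auto
  note rules = has_wirtinger_exp[OF v_wirtinger] has_wirtinger_cmult has_wirtinger_mult has_wirtinger_add
    has_wirtinger_diff w_wirtinger w'_wirtinger h_wirtinger
  note sols = sol[unfolded solution_iff, rule_format]
  let ?p1 = "\<lambda>z. complex_of_real (exp (v z)) * fst (\<phi> z) $ 1"
  let ?p2 = "\<lambda>z. complex_of_real (exp (v z)) * (\<epsilon> * fst (\<phi> z) $ 2)"
  let ?q1 = "\<lambda>z. complex_of_real (exp (v z)) * (\<epsilon> * (snd (\<phi> z) $ 1 + l * (w z * fst (\<phi> z) $ 2 - h z * fst (\<phi> z) $ 1)))"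
  let ?q2 = "\<lambda>z. complex_of_real (exp (v z)) * (snd (\<phi> z) $ 2 + l * (w' z * fst (\<phi> z) $ 1 + h z * fst (\<phi> z) $ 2))"
  show ?thesis
    unfolding solution_iff gauge_components l(1)
  proof (intro allI conjI)
    fix z
    note s = sols[of z, THEN conjunct1] sols[of z, THEN conjunct2, THEN conjunct1]
      sols[of z, THEN conjunct2, THEN conjunct2, THEN conjunct1]
      sols[of z, THEN conjunct2, THEN conjunct2, THEN conjunct2]
    show "has_wirtinger ?p1
      (alpha_z Y z * ?p1 z + hopf_coeff Y z * ?p2 z)
      (mean_coeff Y z * ?p2 z + lam * ?q2 z) z"
      by (rule has_wirtinger_eq_rhs, (rule rules s)+)
        (insert \<epsilon>2 l(2), unfold mean_coeff_Y hopf_coeff_Y alpha_z_Y alpha_zbar_Y,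
          (algebra | simp add: algebra_simps)+)
    show "has_wirtinger ?p2
      (- mean_coeff Y z * ?p1 z + lam * ?q1 z)
      (- hopf_coeff Y z * ?p1 z + alpha_zbar Y z * ?p2 z) z"
      by (rule has_wirtinger_eq_rhs, (rule rules s)+)
        (insert \<epsilon>2 l(2), unfold mean_coeff_Y hopf_coeff_Y alpha_z_Y alpha_zbar_Y,
          (algebra | simp add: algebra_simps)+)
    show "has_wirtinger ?q1
      (lam * ?p2 z + 2 * alpha_z Y z * ?q1 z + hopf_coeff Y z * ?q2 z)
      (alpha_zbar Y z * ?q1 z + mean_coeff Y z * ?q2 z) z"
      by (rule has_wirtinger_eq_rhs, (rule rules s)+)
        (insert \<epsilon>2 l(2), unfold mean_coeff_Y hopf_coeff_Y alpha_z_Y alpha_zbar_Y,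
          (algebra | simp add: algebra_simps)+)
    show "has_wirtinger ?q2
      (- mean_coeff Y z * ?q1 z + alpha_z Y z * ?q2 z)
      (lam * ?p1 z - hopf_coeff Y z * ?q1 z + 2 * alpha_zbar Y z * ?q2 z) z"
      by (rule has_wirtinger_eq_rhs, (rule rules s)+)
        (insert \<epsilon>2 l(2), unfold mean_coeff_Y hopf_coeff_Y alpha_z_Y alpha_zbar_Y,
          (algebra | simp add: algebra_simps)+)
  qed
qed

end

section \<open>Multipliers and the spectrum\<close>

lemma cscale_1 [simp]: "cscale 1 r = r"
  by (simp add: cscale_def)

lemma cscale_cscale: "cscale a (cscale b r) = cscale (a * b) r"
  by (simp add: cscale_def vector_smult_assoc)

lemma cscale_cancel: "cscale a r = cscale b r \<Longrightarrow> r \<noteq> 0 \<Longrightarrow> a = b"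
  by (auto simp: cscale_def prod_eq_iff vector_mul_rcancel)

lemma mem_complex_line: "\<phi> \<in> complex_line \<phi>"
  unfolding complex_line_def by (rule range_eqI[of _ _ 1]) simp

lemma multiplier_eq:
  assumes "\<phi> z \<noteq> 0" and tr: "translation \<gamma> \<phi> = (\<lambda>z. cscale m (\<phi> z))"
  shows "multiplier \<gamma> (lam, complex_line \<phi>) = m"
  unfolding multiplier_def snd_conv
proof (rule the_equality)
  show "\<forall>\<psi>\<in>complex_line \<phi>. translation \<gamma> \<psi> = (\<lambda>z. cscale m (\<psi> z))"
  proof
    fix \<psi> assume "\<psi> \<in> complex_line \<phi>"
    then obtain k where \<psi>: "\<psi> = (\<lambda>z. cscale k (\<phi> z))"
      by (auto simp: complex_line_def)
    have "\<phi> (z + \<gamma>) = cscale m (\<phi> z)" for z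
      using fun_cong[OF tr, of z] by (simp add: translation_def)
    then show "translation \<gamma> \<psi> = (\<lambda>z. cscale m (\<psi> z))"
      by (simp add: \<psi> translation_def cscale_cscale mult.commute fun_eq_iff)
  qed
next
  fix m' assume "\<forall>\<psi>\<in>complex_line \<phi>. translation \<gamma> \<psi> = (\<lambda>z. cscale m' (\<psi> z))"
  then have "translation \<gamma> \<phi> = (\<lambda>z. cscale m' (\<phi> z))"
    using mem_complex_line by blast
  with tr have "cscale m' (\<phi> z) = cscale m (\<phi> z)"
    by metis
  then show "m' = m"
    using assms(1) cscale_cancel by blast
qed

definition \<sigma>_fun :: "(complex \<Rightarrow> C4) \<Rightarrow> complex \<Rightarrow> C4" where
  "\<sigma>_fun \<phi> z = (fst (\<phi> z), - snd (\<phi> z))"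

lemma sigma_line: "sigma (lam, complex_line \<phi>) = (- lam, complex_line (\<sigma>_fun \<phi>))"
proof -
  have "(\<lambda>z. (fst (cscale k (\<phi> z)), - snd (cscale k (\<phi> z)))) = (\<lambda>z. cscale k (\<sigma>_fun \<phi> z))" for k
    by (simp add: \<sigma>_fun_def cscale_def fun_eq_iff vec_eq_iff)
  then show ?thesis
    by (simp add: sigma_def complex_line_def image_image)
qed

lemma multiplier_sigma:
  assumes "\<phi> z \<noteq> 0" and tr: "translation \<gamma> \<phi> = (\<lambda>z. cscale m (\<phi> z))"
  shows "multiplier \<gamma> (sigma (lam, complex_line \<phi>)) = m"
  unfolding sigma_line
proof (rule multiplier_eq)
  show "\<sigma>_fun \<phi> z \<noteq> 0"
    using assms(1) by (auto simp: \<sigma>_fun_def prod_eq_iff)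
  have "\<phi> (z + \<gamma>) = cscale m (\<phi> z)" for z
    using fun_cong[OF tr, of z] by (simp add: translation_def)
  then show "translation \<gamma> (\<sigma>_fun \<phi>) = (\<lambda>z. cscale m (\<sigma>_fun \<phi> z))"
    by (simp add: translation_def \<sigma>_fun_def cscale_def fun_eq_iff vec_eq_iff)
qed

text \<open>Changing the sign of the lower half commutes with translations, so multipliers are
  constant on each class of the quotient, and the class of a point contains that point.\<close>

lemma spectrum_eq_multipliers: "spectrum \<gamma>\<^sub>1 \<gamma>\<^sub>2 X = multipliers \<gamma>\<^sub>1 \<gamma>\<^sub>2 ` spectral_curve \<gamma>\<^sub>1 \<gamma>\<^sub>2 X"
proof -
  let ?C = "spectral_curve \<gamma>\<^sub>1 \<gamma>\<^sub>2 X" and ?R = "sigma_rel \<gamma>\<^sub>1 \<gamma>\<^sub>2 X" and ?m = "multipliers \<gamma>\<^sub>1 \<gamma>\<^sub>2"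
  have "?m (sigma P) = ?m P" if P_in: "P \<in> ?C" for P
  proof -
    obtain lam \<phi> where P: "P = (lam, complex_line \<phi>)" and \<phi>: "joint_eigenfunction \<gamma>\<^sub>1 \<gamma>\<^sub>2 X lam \<phi>"
      using P_in unfolding spectral_curve_def by blast
    then obtain z m1 m2 where "\<phi> z \<noteq> 0" "translation \<gamma>\<^sub>1 \<phi> = (\<lambda>z. cscale m1 (\<phi> z))"
        "translation \<gamma>\<^sub>2 \<phi> = (\<lambda>z. cscale m2 (\<phi> z))"
      by (auto simp: joint_eigenfunction_def)
    then show ?thesis
      by (simp add: P multipliers_def multiplier_eq multiplier_sigma)
  qed
  then have eq: "?m Q = ?m P" if "Q \<in> ?R `` {P}" for P Q
    using that unfolding sigma_rel_def Image_singleton_iff mem_Collect_eq case_prod_conv by metis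
  have "?m ` (?R `` {P}) = {?m P}" if "P \<in> ?C" for P
  proof -
    have "P \<in> ?R `` {P}"
      using that by (simp add: sigma_rel_def)
    with eq show ?thesis
      by blast
  qed
  then have "the_elem (?m ` (?R `` {P})) = ?m P" if "P \<in> ?C" for P
    using that by simp
  moreover have "?C // ?R = (\<lambda>P. ?R `` {P}) ` ?C"
    unfolding quotient_def by blast
  ultimately show ?thesis
    unfolding spectrum_def by (simp add: image_image cong: image_cong)
qed

definition multiplicative :: "complex \<Rightarrow> complex \<Rightarrow> (complex \<Rightarrow> C4) \<Rightarrow> bool" where
  "multiplicative \<gamma> m \<phi> \<longleftrightarrow> (\<forall>z. \<phi> (z + \<gamma>) = cscale m (\<phi> z))"

lemma translation_iff: "translation \<gamma> \<phi> = (\<lambda>z. cscale m (\<phi> z)) \<longleftrightarrow> multiplicative \<gamma> m \<phi>"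
  by (simp add: translation_def multiplicative_def fun_eq_iff)

lemma joint_eigenfunction_iff: "joint_eigenfunction \<gamma>\<^sub>1 \<gamma>\<^sub>2 X lam \<phi> \<longleftrightarrow>
    solution X lam \<phi> \<and> (\<exists>z. \<phi> z \<noteq> 0) \<and> (\<exists>m. multiplicative \<gamma>\<^sub>1 m \<phi>) \<and> (\<exists>m. multiplicative \<gamma>\<^sub>2 m \<phi>)"
  by (simp add: joint_eigenfunction_def translation_iff)

text \<open>The working form for all comparisons of spectra: lines and definite descriptions are
  gone, and eigenfunctions appear with explicit multipliers.\<close>

lemma spectrum_iff:
  "(m1, m2) \<in> spectrum \<gamma>\<^sub>1 \<gamma>\<^sub>2 X \<longleftrightarrow> (\<exists>lam \<phi> lams \<phi>s.
    solution X lam \<phi> \<and> (\<exists>z. \<phi> z \<noteq> 0) \<and> multiplicative \<gamma>\<^sub>1 m1 \<phi> \<and> multiplicative \<gamma>\<^sub>2 m2 \<phi> \<and>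
    lams \<longlonglongrightarrow> lam \<and> (\<forall>z. (\<lambda>n. \<phi>s n z) \<longlonglongrightarrow> \<phi> z) \<and>
    (\<forall>n. generic_parameter \<gamma>\<^sub>1 \<gamma>\<^sub>2 X (lams n) \<and> joint_eigenfunction \<gamma>\<^sub>1 \<gamma>\<^sub>2 X (lams n) (\<phi>s n)))"
  (is "?l \<longleftrightarrow> ?r")
proof
  assume ?l
  then obtain lam \<phi> lams \<phi>s where *: "(m1, m2) = multipliers \<gamma>\<^sub>1 \<gamma>\<^sub>2 (lam, complex_line \<phi>)"
    "joint_eigenfunction \<gamma>\<^sub>1 \<gamma>\<^sub>2 X lam \<phi>" "lams \<longlonglongrightarrow> lam" "\<forall>z. (\<lambda>n. \<phi>s n z) \<longlonglongrightarrow> \<phi> z"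
    "\<forall>n. generic_parameter \<gamma>\<^sub>1 \<gamma>\<^sub>2 X (lams n) \<and> joint_eigenfunction \<gamma>\<^sub>1 \<gamma>\<^sub>2 X (lams n) (\<phi>s n)"
    unfolding spectrum_eq_multipliers spectral_curve_def by auto
  obtain z m1' m2' where m: "solution X lam \<phi>" "\<phi> z \<noteq> 0" "multiplicative \<gamma>\<^sub>1 m1' \<phi>" "multiplicative \<gamma>\<^sub>2 m2' \<phi>"
    using *(2) by (auto simp: joint_eigenfunction_iff)
  then have "m1 = m1'" "m2 = m2'"
    using *(1) by (auto simp: multipliers_def multiplier_eq translation_iff)
  with m * show ?r
    by blast
next
  assume ?r
  then obtain lam \<phi> lams \<phi>s z where *: "solution X lam \<phi>" "\<phi> z \<noteq> 0" "multiplicative \<gamma>\<^sub>1 m1 \<phi>"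
    "multiplicative \<gamma>\<^sub>2 m2 \<phi>" "lams \<longlonglongrightarrow> lam" "\<forall>z. (\<lambda>n. \<phi>s n z) \<longlonglongrightarrow> \<phi> z"
    "\<forall>n. generic_parameter \<gamma>\<^sub>1 \<gamma>\<^sub>2 X (lams n) \<and> joint_eigenfunction \<gamma>\<^sub>1 \<gamma>\<^sub>2 X (lams n) (\<phi>s n)"
    by blast
  then have "(lam, complex_line \<phi>) \<in> spectral_curve \<gamma>\<^sub>1 \<gamma>\<^sub>2 X"
    unfolding spectral_curve_def joint_eigenfunction_iff by blast
  moreover have "multipliers \<gamma>\<^sub>1 \<gamma>\<^sub>2 (lam, complex_line \<phi>) = (m1, m2)"
    using * by (auto simp: multipliers_def multiplier_eq translation_iff)
  ultimately show ?l
    unfolding spectrum_eq_multipliers by (metis imageI)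
qed

section \<open>The fibre over the spectral parameter 0\<close>

lemma conf_exponent_wirtinger:
  assumes "conf_exponent X differentiable at z"
  shows "has_wirtinger (\<lambda>z. of_real (conf_exponent X z)) (alpha_z X z) (alpha_zbar X z) z"
  using has_wirtinger_of_real[OF has_partials_dir_deriv[OF assms]] has_wirtinger_imp
  unfolding alpha_z_def alpha_zbar_def by metis

lemma conf_exponent_uminus_wirtinger:
  assumes "conf_exponent X differentiable at z"
  shows "has_wirtinger (\<lambda>z. of_real (- conf_exponent X z)) (- alpha_z X z) (- alpha_zbar X z) z"
  using has_wirtinger_cmult[OF conf_exponent_wirtinger[OF assms], of "- 1"] by simp

text \<open>For \<open>\<lambda> = 0\<close> the two halves of the system decouple and become equivalent under the factor \<open>e\<^bsup>\<alpha>\<^esup>\<close>.\<close>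

lemma solution_0_lift:
  assumes diff: "\<And>z. conf_exponent X differentiable at z" and sol: "solution X 0 \<phi>"
  shows "solution X 0 (\<lambda>z. (fst (\<phi> z), (k * of_real (exp (conf_exponent X z))) *s fst (\<phi> z)))"
  unfolding solution_iff
proof (intro allI conjI)
  fix z
  note s = sol[unfolded solution_iff, rule_format, of z]
  note e = has_wirtinger_cmult[OF has_wirtinger_exp[OF conf_exponent_wirtinger[OF diff]], of k z]
  let ?\<psi> = "\<lambda>z. (fst (\<phi> z), (k * of_real (exp (conf_exponent X z))) *s fst (\<phi> z))"
  show "has_wirtinger (\<lambda>z. snd (?\<psi> z) $ 1)
     (0 * fst (?\<psi> z) $ 2 +
      2 * alpha_z X z * snd (?\<psi> z) $ 1 +
      hopf_coeff X z * snd (?\<psi> z) $ 2)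
     (alpha_zbar X z * snd (?\<psi> z) $ 1 +
      mean_coeff X z * snd (?\<psi> z) $ 2) z"
    using has_wirtinger_mult[OF e s[THEN conjunct1]]
    by (simp add: algebra_simps)
  show "has_wirtinger (\<lambda>z. snd (?\<psi> z) $ 2)
     (- mean_coeff X z * snd (?\<psi> z) $ 1 +
      alpha_z X z * snd (?\<psi> z) $ 2)
     (0 * fst (?\<psi> z) $ 1 -
      hopf_coeff X z * snd (?\<psi> z) $ 1 +
      2 * alpha_zbar X z * snd (?\<psi> z) $ 2) z"
    using has_wirtinger_mult[OF e s[THEN conjunct2, THEN conjunct1]]
    by (simp add: algebra_simps)
qed (use sol[unfolded solution_iff] in simp_all)

lemma solution_0_drop:
  assumes diff: "\<And>z. conf_exponent X differentiable at z" and sol: "solution X 0 \<phi>"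
  shows "solution X 0 (\<lambda>z. (of_real (exp (- conf_exponent X z)) *s snd (\<phi> z), 0))"
  unfolding solution_iff
proof (intro allI conjI)
  fix z
  note s = sol[unfolded solution_iff, rule_format, of z]
  note e = has_wirtinger_exp[OF conf_exponent_uminus_wirtinger[OF diff], of z]
  let ?\<psi> = "\<lambda>z. (of_real (exp (- conf_exponent X z)) *s snd (\<phi> z), 0) :: C4"
  show "has_wirtinger (\<lambda>z. fst (?\<psi> z) $ 1) (alpha_z X z * fst (?\<psi> z) $ 1 + hopf_coeff X z * fst (?\<psi> z) $ 2)
      (mean_coeff X z * fst (?\<psi> z) $ 2 + 0 * snd (?\<psi> z) $ 2) z"
    using has_wirtinger_mult[OF e s[THEN conjunct2, THEN conjunct2, THEN conjunct1]]
    by (simp add: algebra_simps)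
  show "has_wirtinger (\<lambda>z. fst (?\<psi> z) $ 2) (- mean_coeff X z * fst (?\<psi> z) $ 1 + 0 * snd (?\<psi> z) $ 1)
      (- hopf_coeff X z * fst (?\<psi> z) $ 1 + alpha_zbar X z * fst (?\<psi> z) $ 2) z"
    using has_wirtinger_mult[OF e s[THEN conjunct2, THEN conjunct2, THEN conjunct2]]
    by (simp add: algebra_simps)
qed (simp_all add: has_wirtinger_const)

text \<open>One eigenfunction produces the family (p, k e^\<alpha> p) with k in the complex plane.
  As \<alpha> is periodic, all its members have the same multipliers, and they span pairwise
  different lines; so the number of eigenlines is zero or infinite.\<close>

lemma not_generic_parameter_0:
  assumes diff: "\<And>z. conf_exponent X differentiable at z"
    and per: "\<And>z \<gamma>. \<gamma> \<in> {\<gamma>\<^sub>1, \<gamma>\<^sub>2} \<Longrightarrow> conf_exponent X (z + \<gamma>) = conf_exponent X z"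
  shows "\<not> generic_parameter \<gamma>\<^sub>1 \<gamma>\<^sub>2 X 0"
proof
  assume gen: "generic_parameter \<gamma>\<^sub>1 \<gamma>\<^sub>2 X 0"
  let ?L = "eigenlines \<gamma>\<^sub>1 \<gamma>\<^sub>2 X 0" and ?e = "\<lambda>z. complex_of_real (exp (conf_exponent X z))"
  \<comment> \<open>\<open>card\<close> is 0 on infinite sets, so cardinality 4 yields finiteness as
    well as an eigenline to start from.\<close>
  have "card ?L \<noteq> 0"
    using gen by (simp add: generic_parameter_def)
  then have fin: "finite ?L" and "?L \<noteq> {}"
    by (auto simp: card_eq_0_iff)
  then obtain \<phi> z0 m1 m2 where \<phi>: "solution X 0 \<phi>" "\<phi> z0 \<noteq> 0" "multiplicative \<gamma>\<^sub>1 m1 \<phi>" "multiplicative \<gamma>\<^sub>2 m2 \<phi>"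
    by (auto simp: eigenlines_def joint_eigenfunction_iff)
  \<comment> \<open>If the upper half vanishes at \<open>z0\<close>, the lower half divided by
    e^\<alpha> takes its place.\<close>
  obtain \<psi> where \<psi>: "solution X 0 \<psi>" "fst (\<psi> z0) \<noteq> 0" "multiplicative \<gamma>\<^sub>1 m1 \<psi>" "multiplicative \<gamma>\<^sub>2 m2 \<psi>"
  proof (cases "fst (\<phi> z0) = 0")
    case True
    then have "snd (\<phi> z0) \<noteq> 0"
      using \<phi>(2) by (auto simp: prod_eq_iff)
    then show thesis
      using \<phi>(3,4) per by (intro that[OF solution_0_drop[OF diff \<phi>(1)]])
        (auto simp: multiplicative_def cscale_def vec_eq_iff)
  qed (use \<phi> that in blast)
  define \<Psi> where "\<Psi> k = (\<lambda>z. (fst (\<psi> z), (k * ?e z) *s fst (\<psi> z)))" for k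
  have "joint_eigenfunction \<gamma>\<^sub>1 \<gamma>\<^sub>2 X 0 (\<Psi> k)" for k
    unfolding joint_eigenfunction_iff
  proof (intro conjI exI)
    show "solution X 0 (\<Psi> k)"
      unfolding \<Psi>_def by (rule solution_0_lift[OF diff \<psi>(1)])
    show "\<Psi> k z0 \<noteq> 0"
      using \<psi>(2) by (auto simp: \<Psi>_def prod_eq_iff)
    show "multiplicative \<gamma>\<^sub>1 m1 (\<Psi> k)" "multiplicative \<gamma>\<^sub>2 m2 (\<Psi> k)"
      using \<psi>(3,4) per by (auto simp: \<Psi>_def multiplicative_def cscale_def vec_eq_iff)
  qed
  then have "range (\<lambda>k. complex_line (\<Psi> k)) \<subseteq> ?L"
    by (auto simp: eigenlines_def)
  \<comment> \<open>The upper half is the same for all k, so a factor between two members must be 1;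
    the lower half then determines k.\<close>
  moreover have "inj (\<lambda>k. complex_line (\<Psi> k))"
  proof (rule injI)
    fix a b assume "complex_line (\<Psi> a) = complex_line (\<Psi> b)"
    then have "\<Psi> a \<in> complex_line (\<Psi> b)"
      using mem_complex_line by metis
    then obtain k where "\<Psi> a = (\<lambda>z. cscale k (\<Psi> b z))"
      by (auto simp: complex_line_def)
    then have "\<Psi> a z0 = cscale k (\<Psi> b z0)"
      by metis
    then have *: "fst (\<psi> z0) = k *s fst (\<psi> z0)" "(a * ?e z0) *s fst (\<psi> z0) = (k * (b * ?e z0)) *s fst (\<psi> z0)"
      by (simp_all add: \<Psi>_def cscale_def vector_smult_assoc)
    from *(1) have "1 *s fst (\<psi> z0) = k *s fst (\<psi> z0)"
      by simp
    then have "k = 1"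
      using \<psi>(2) unfolding vector_mul_rcancel by simp
    with *(2) \<psi>(2) show "a = b"
      by (simp add: vector_mul_rcancel)
  qed
  ultimately have "finite (UNIV :: complex set)"
    using fin by (meson finite_imageD finite_subset)
  then show False
    by (simp add: infinite_UNIV_char_0)
qed

section \<open>Continuous dependence on the spectral parameter\<close>

text \<open>Gronwall along the ray from 0 to z, applied to |d|^2 + \<delta>^2, which is
  differentiable even where d vanishes. The rate 2 K + 1 comes from 2 |d| \<delta> \<le> |d|^2 +
  \<delta>^2.\<close>

lemma gronwall_cball:
  fixes d :: "complex \<Rightarrow> 'b::real_inner"
  assumes der: "\<And>z. z \<in> cball 0 R \<Longrightarrow> (d has_derivative D z) (at z)"
    and bound: "\<And>z t. z \<in> cball 0 R \<Longrightarrow> norm (D z t) \<le> (K * norm (d z) + \<delta>) * norm t"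
    and K: "K \<ge> 0" and \<delta>: "\<delta> \<ge> 0" and z: "z \<in> cball 0 R"
  shows "(norm (d z))\<^sup>2 \<le> ((norm (d 0))\<^sup>2 + \<delta>\<^sup>2) * exp ((2 * K + 1) * R)"
proof -
  define L where "L = (2 * K + 1) * norm z"
  define y where "y s = (d (s *\<^sub>R z) \<bullet> d (s *\<^sub>R z) + \<delta>\<^sup>2) * exp (- L * s)" for s :: real
  have "\<exists>y'. DERIV y s :> y' \<and> y' \<le> 0" if s: "0 \<le> s" "s \<le> 1" for s
  proof -
    let ?x = "s *\<^sub>R z"
    have x: "?x \<in> cball 0 R"
      using s z mult_left_le_one_le[of "norm z" s] by auto
    have "((\<lambda>s. s *\<^sub>R z) has_derivative (\<lambda>h. h *\<^sub>R z)) (at s)"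
      by (auto intro!: derivative_eq_intros)
    from has_derivative_compose[OF this der[OF x]]
    have dz: "((\<lambda>s. d (s *\<^sub>R z)) has_derivative (\<lambda>h. h *\<^sub>R D ?x z)) (at s)"
      using linear_cmul[OF has_derivative_linear[OF der[OF x]]] by simp
    have "DERIV (\<lambda>s. d (s *\<^sub>R z) \<bullet> d (s *\<^sub>R z)) s :> 2 * (d ?x \<bullet> D ?x z)"
      unfolding has_field_derivative_def
      by (rule has_derivative_eq_rhs[OF has_derivative_inner[OF dz dz]])
        (simp add: fun_eq_iff inner_commute algebra_simps)
    then have "DERIV y s :> 2 * (d ?x \<bullet> D ?x z) * exp (- L * s)
        + (d ?x \<bullet> d ?x + \<delta>\<^sup>2) * (exp (- L * s) * (- L))"
      unfolding y_def[abs_def] by (auto intro!: derivative_eq_intros)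
    moreover have "2 * (d ?x \<bullet> D ?x z) \<le> L * (d ?x \<bullet> d ?x + \<delta>\<^sup>2)"
    proof -
      have "2 * (d ?x \<bullet> D ?x z) \<le> 2 * (norm (d ?x) * ((K * norm (d ?x) + \<delta>) * norm z))"
        using norm_cauchy_schwarz[of "d ?x" "D ?x z"] bound[OF x, of z]
        by (smt (verit) mult_left_mono norm_ge_zero)
      also have "\<dots> = (2 * K * (norm (d ?x))\<^sup>2 + 2 * norm (d ?x) * \<delta>) * norm z"
        by (simp add: algebra_simps power2_eq_square)
      also have "\<dots> \<le> ((2 * K + 1) * ((norm (d ?x))\<^sup>2 + \<delta>\<^sup>2)) * norm z"
      proof (rule mult_right_mono)
        have "2 * norm (d ?x) * \<delta> \<le> (norm (d ?x))\<^sup>2 + \<delta>\<^sup>2"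
          using sum_squares_bound[of "norm (d ?x)" \<delta>] by simp
        moreover have "0 \<le> K * \<delta>\<^sup>2"
          using K by simp
        ultimately show "2 * K * (norm (d ?x))\<^sup>2 + 2 * norm (d ?x) * \<delta> \<le> (2 * K + 1) * ((norm (d ?x))\<^sup>2 + \<delta>\<^sup>2)"
          by (simp add: algebra_simps)
      qed simp
      finally show ?thesis
        by (simp add: L_def power2_norm_eq_inner algebra_simps)
    qed
    then have "2 * (d ?x \<bullet> D ?x z) * exp (- L * s) \<le> L * (d ?x \<bullet> d ?x + \<delta>\<^sup>2) * exp (- L * s)"
      by (rule mult_right_mono) simp
    then have "2 * (d ?x \<bullet> D ?x z) * exp (- L * s)
        + (d ?x \<bullet> d ?x + \<delta>\<^sup>2) * (exp (- L * s) * (- L)) \<le> 0"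
      by (simp add: algebra_simps)
    ultimately show ?thesis
      by blast
  qed
  then have "y 1 \<le> y 0"
    by (intro DERIV_nonpos_imp_nonincreasing[of 0 1 y]) auto
  then have "((norm (d z))\<^sup>2 + \<delta>\<^sup>2) * exp (- L) \<le> (norm (d 0))\<^sup>2 + \<delta>\<^sup>2"
    by (simp add: y_def power2_norm_eq_inner)
  then have "(norm (d z))\<^sup>2 + \<delta>\<^sup>2 \<le> ((norm (d 0))\<^sup>2 + \<delta>\<^sup>2) * exp L"
    by (simp add: exp_minus field_simps)
  also have "\<dots> \<le> ((norm (d 0))\<^sup>2 + \<delta>\<^sup>2) * exp ((2 * K + 1) * R)"
    using z K by (intro mult_left_mono) (auto simp: L_def intro!: mult_left_mono)
  finally show ?thesis
    using zero_le_power2[of \<delta>] by linarith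
qed

text \<open>Both equations of the system as one total differential in the direction t, the form
  needed for estimates along rays and for differentiating limits.\<close>

definition system_rhs :: "(complex \<Rightarrow> real^3) \<Rightarrow> complex \<Rightarrow> complex \<Rightarrow> C4 \<Rightarrow> complex \<Rightarrow> C4" where
  "system_rhs X lam z r t =
    (vector [(alpha_z X z * fst r $ 1 + hopf_coeff X z * fst r $ 2) * t
        + (mean_coeff X z * fst r $ 2 + lam * snd r $ 2) * cnj t,
      (- mean_coeff X z * fst r $ 1 + lam * snd r $ 1) * t
        + (- hopf_coeff X z * fst r $ 1 + alpha_zbar X z * fst r $ 2) * cnj t],
     vector [(lam * fst r $ 2 + 2 * alpha_z X z * snd r $ 1 + hopf_coeff X z * snd r $ 2) * t
        + (alpha_zbar X z * snd r $ 1 + mean_coeff X z * snd r $ 2) * cnj t,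
      (- mean_coeff X z * snd r $ 1 + alpha_z X z * snd r $ 2) * t
        + (lam * fst r $ 1 - hopf_coeff X z * snd r $ 1 + 2 * alpha_zbar X z * snd r $ 2) * cnj t])"

lemma has_derivative_C4_components:
  fixes \<phi> :: "complex \<Rightarrow> C4"
  assumes "(\<phi> has_derivative D) (at z)"
  shows "((\<lambda>z. fst (\<phi> z) $ i) has_derivative (\<lambda>t. fst (D t) $ i)) (at z)"
    and "((\<lambda>z. snd (\<phi> z) $ i) has_derivative (\<lambda>t. snd (D t) $ i)) (at z)"
  using bounded_linear.has_derivative[OF bounded_linear_vec_nth has_derivative_fst[OF assms]]
    bounded_linear.has_derivative[OF bounded_linear_vec_nth has_derivative_snd[OF assms]] .

lemma has_derivative_C4_iff:
  fixes \<phi> :: "complex \<Rightarrow> C4"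
  shows "(\<phi> has_derivative D) (at z) \<longleftrightarrow>
    ((\<lambda>z. fst (\<phi> z) $ 1) has_derivative (\<lambda>t. fst (D t) $ 1)) (at z) \<and>
    ((\<lambda>z. fst (\<phi> z) $ 2) has_derivative (\<lambda>t. fst (D t) $ 2)) (at z) \<and>
    ((\<lambda>z. snd (\<phi> z) $ 1) has_derivative (\<lambda>t. snd (D t) $ 1)) (at z) \<and>
    ((\<lambda>z. snd (\<phi> z) $ 2) has_derivative (\<lambda>t. snd (D t) $ 2)) (at z)" (is "_ \<longleftrightarrow> ?r")
proof
  assume "(\<phi> has_derivative D) (at z)"
  then show ?r
    using has_derivative_C4_components by blast
next
  assume r: ?r
  then have "\<phi> differentiable at z"
    unfolding differentiable_C4_iff by (meson differentiableI)
  then obtain D' where D': "(\<phi> has_derivative D') (at z)"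
    by (auto simp: differentiable_def)
  have "D' = D"
    using r has_derivative_C4_components[OF D'] has_derivative_unique
    unfolding fun_eq_iff C4_eq_iff by meson
  with D' show "(\<phi> has_derivative D) (at z)"
    by simp
qed

lemma solution_iff_rhs: "solution X lam \<phi> \<longleftrightarrow> (\<forall>z. (\<phi> has_derivative system_rhs X lam z (\<phi> z)) (at z))"
  unfolding solution_iff has_derivative_C4_iff has_wirtinger_def by (simp add: system_rhs_def)

lemma C4_component_le: "norm (fst r $ i) \<le> norm (r::C4)" "norm (snd r $ i) \<le> norm (r::C4)"
  using Finite_Cartesian_Product.norm_nth_le[of "fst r" i] Finite_Cartesian_Product.norm_nth_le[of "snd r" i]
    norm_fst_le[of "fst r" "snd r"] norm_snd_le[of "snd r" "fst r"] by simp_all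

lemma norm_C4_le:
  "norm (r::C4) \<le> norm (fst r $ 1) + norm (fst r $ 2) + norm (snd r $ 1) + norm (snd r $ 2)"
proof -
  have "norm x \<le> norm (x $ 1) + norm (x $ 2)" for x :: "complex^2"
    using L2_set_le_sum[of UNIV "\<lambda>i. norm (x $ i)"] by (simp add: norm_vec_def sum_2)
  from this[of "fst r"] this[of "snd r"] show ?thesis
    using norm_Pair_le[of "fst r" "snd r"] by simp
qed

lemma norm_six_terms:
  fixes t :: complex
  assumes "norm a1 \<le> C" "norm a2 \<le> C" "norm a3 \<le> C" "norm b1 \<le> C" "norm b2 \<le> C" "norm b3 \<le> C"
    "norm x1 \<le> r" "norm x2 \<le> r" "norm x3 \<le> r" "norm y1 \<le> r" "norm y2 \<le> r" "norm y3 \<le> r"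
  shows "norm ((a1 * x1 + a2 * x2 + a3 * x3) * t + (b1 * y1 + b2 * y2 + b3 * y3) * cnj t) \<le> 6 * (C * r * norm t)"
proof -
  have "norm (a * x) \<le> C * r" if "norm a \<le> C" "norm x \<le> r" for a x :: complex
    unfolding norm_mult using that by (intro mult_mono) (auto intro: order_trans[OF norm_ge_zero])
  then have "norm (a1 * x1 + a2 * x2 + a3 * x3) \<le> 3 * (C * r)" "norm (b1 * y1 + b2 * y2 + b3 * y3) \<le> 3 * (C * r)"
    using assms by (smt (verit) norm_triangle_ineq)+
  then have "norm (a1 * x1 + a2 * x2 + a3 * x3) * norm t \<le> 3 * (C * r) * norm t"
    "norm (b1 * y1 + b2 * y2 + b3 * y3) * norm t \<le> 3 * (C * r) * norm t"
    by (simp_all add: mult_right_mono)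
  then show ?thesis
    using norm_triangle_ineq[of "(a1 * x1 + a2 * x2 + a3 * x3) * t" "(b1 * y1 + b2 * y2 + b3 * y3) * cnj t"]
    by (simp add: norm_mult)
qed

text \<open>The constant 48 counts four components with six products each, whose coefficients are
  bounded by 2 C because of the doubled \<alpha>-derivatives. Components with fewer products are
  padded with zeros.\<close>

lemma norm_rhs_le:
  assumes "norm (alpha_z X z) \<le> C" "norm (alpha_zbar X z) \<le> C" "norm (mean_coeff X z) \<le> C"
    "norm (hopf_coeff X z) \<le> C" "norm lam \<le> C"
  shows "norm (system_rhs X lam z r t) \<le> 48 * C * norm r * norm t"
proof -
  have C: "0 \<le> C"
    using assms(1) norm_ge_zero order_trans by blast
  have c: "norm (alpha_z X z) \<le> 2 * C" "norm (alpha_zbar X z) \<le> 2 * C" "norm (mean_coeff X z) \<le> 2 * C"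
    "norm (hopf_coeff X z) \<le> 2 * C" "norm lam \<le> 2 * C" "norm (2 * alpha_z X z) \<le> 2 * C"
    "norm (2 * alpha_zbar X z) \<le> 2 * C" "norm (0::complex) \<le> 2 * C" "norm (- mean_coeff X z) \<le> 2 * C"
    "norm (- hopf_coeff X z) \<le> 2 * C"
    using assms C by (simp_all add: norm_mult)
  have "norm (fst (system_rhs X lam z r t) $ 1) \<le> 6 * (2 * C * norm r * norm t)"
    using norm_six_terms[of "alpha_z X z" "2 * C" "hopf_coeff X z" 0 "mean_coeff X z" lam 0
      "fst r $ 1" "norm r" "fst r $ 2" "fst r $ 1" "fst r $ 2" "snd r $ 2" "fst r $ 1" t] c
    by (simp add: system_rhs_def C4_component_le)
  moreover have "norm (fst (system_rhs X lam z r t) $ 2) \<le> 6 * (2 * C * norm r * norm t)"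
    using norm_six_terms[of "- mean_coeff X z" "2 * C" lam 0 "- hopf_coeff X z" "alpha_zbar X z" 0
      "fst r $ 1" "norm r" "snd r $ 1" "fst r $ 1" "fst r $ 1" "fst r $ 2" "fst r $ 1" t] c
    by (simp add: system_rhs_def C4_component_le)
  moreover have "norm (snd (system_rhs X lam z r t) $ 1) \<le> 6 * (2 * C * norm r * norm t)"
    using norm_six_terms[of lam "2 * C" "2 * alpha_z X z" "hopf_coeff X z" "alpha_zbar X z" "mean_coeff X z" 0
      "fst r $ 2" "norm r" "snd r $ 1" "snd r $ 2" "snd r $ 1" "snd r $ 2" "fst r $ 1" t] c
    by (simp add: system_rhs_def C4_component_le)
  moreover have "norm (snd (system_rhs X lam z r t) $ 2) \<le> 6 * (2 * C * norm r * norm t)"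
    using norm_six_terms[of "- mean_coeff X z" "2 * C" "alpha_z X z" 0 lam "- hopf_coeff X z" "2 * alpha_zbar X z"
      "snd r $ 1" "norm r" "snd r $ 2" "fst r $ 1" "fst r $ 1" "snd r $ 1" "snd r $ 2" t] c
    by (simp add: system_rhs_def C4_component_le)
  ultimately show ?thesis
    using norm_C4_le[of "system_rhs X lam z r t"] by simp
qed

lemma rhs_diff: "system_rhs X lam z r t - system_rhs X lam z r' t = system_rhs X lam z (r - r') t"
  by (simp add: C4_eq_iff system_rhs_def algebra_simps)

text \<open>The factor 4 arises because \<open>lam\<close> occurs in exactly one product of each of
  the four components.\<close>

lemma norm_rhs_diff_parameter_le:
  "norm (system_rhs X lam z r t - system_rhs X lam' z r t) \<le> 4 * norm (lam - lam') * norm r * norm t"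
proof -
  have "norm ((lam - lam') * x * t') \<le> norm (lam - lam') * norm r * norm t"
    if "norm x \<le> norm r" "norm t' = norm t" for x t'
    using that by (simp add: norm_mult mult_left_mono mult_right_mono)
  note * = this[OF C4_component_le(1)] this[OF C4_component_le(2)]
  have "norm (fst (system_rhs X lam z r t - system_rhs X lam' z r t) $ 1) \<le> norm (lam - lam') * norm r * norm t"
    using *(2)[of "cnj t" 2] by (simp add: system_rhs_def algebra_simps)
  moreover have "norm (fst (system_rhs X lam z r t - system_rhs X lam' z r t) $ 2) \<le> norm (lam - lam') * norm r * norm t"
    using *(2)[of t 1] by (simp add: system_rhs_def algebra_simps)
  moreover have "norm (snd (system_rhs X lam z r t - system_rhs X lam' z r t) $ 1) \<le> norm (lam - lam') * norm r * norm t"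
    using *(1)[of t 2] by (simp add: system_rhs_def algebra_simps)
  moreover have "norm (snd (system_rhs X lam z r t - system_rhs X lam' z r t) $ 2) \<le> norm (lam - lam') * norm r * norm t"
    using *(1)[of "cnj t" 1] by (simp add: system_rhs_def algebra_simps)
  ultimately show ?thesis
    using norm_C4_le[of "system_rhs X lam z r t - system_rhs X lam' z r t"] by simp
qed

section \<open>Uniqueness and compactness of solutions\<close>

definition continuous_coeffs :: "(complex \<Rightarrow> real^3) \<Rightarrow> bool" where
  "continuous_coeffs X \<longleftrightarrow> continuous_on UNIV (alpha_z X) \<and> continuous_on UNIV (alpha_zbar X) \<and>
    continuous_on UNIV (mean_coeff X) \<and> continuous_on UNIV (hopf_coeff X)"

lemma rhs_bound:
  assumes "continuous_coeffs X"
  shows "\<exists>K\<ge>0. \<forall>lam z r t. norm lam \<le> \<Lambda> \<longrightarrow> z \<in> cball 0 R \<longrightarrow> norm (system_rhs X lam z r t) \<le> K * norm r * norm t"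
proof -
  have "\<exists>C. \<forall>z\<in>cball 0 R. norm (f z) \<le> C" if "continuous_on UNIV f" for f :: "complex \<Rightarrow> complex"
  proof -
    have "compact (f ` cball 0 R)"
      using that by (intro compact_continuous_image) (auto intro: continuous_on_subset)
    then show ?thesis
      using compact_imp_bounded[of "f ` cball 0 R"] by (auto simp: bounded_iff)
  qed
  then obtain C1 C2 C3 C4 where C: "\<forall>z\<in>cball 0 R. norm (alpha_z X z) \<le> C1"
    "\<forall>z\<in>cball 0 R. norm (alpha_zbar X z) \<le> C2" "\<forall>z\<in>cball 0 R. norm (mean_coeff X z) \<le> C3"
    "\<forall>z\<in>cball 0 R. norm (hopf_coeff X z) \<le> C4"
    using assms unfolding continuous_coeffs_def by metis
  define C where "C = Max {0, C1, C2, C3, C4, \<Lambda>}"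
  have le: "C1 \<le> C" "C2 \<le> C" "C3 \<le> C" "C4 \<le> C" "\<Lambda> \<le> C" "0 \<le> C"
    by (simp_all add: C_def)
  have "norm (system_rhs X lam z r t) \<le> 48 * C * norm r * norm t" if "norm lam \<le> \<Lambda>" "z \<in> cball 0 R" for lam z r t
    using that bspec[OF C(1), of z] bspec[OF C(2), of z] bspec[OF C(3), of z] bspec[OF C(4), of z] le
    by (intro norm_rhs_le) linarith+
  with le show ?thesis
    by (intro exI[of _ "48 * C"]) auto
qed

lemma solution_eq_0:
  assumes "continuous_coeffs X" and sol: "solution X lam \<phi>" and 0: "\<phi> 0 = 0"
  shows "\<phi> z = 0"
proof -
  obtain K where K: "K \<ge> 0" "\<And>w r t. w \<in> cball 0 (norm z) \<Longrightarrow> norm (system_rhs X lam w r t) \<le> K * norm r * norm t"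
    using rhs_bound[OF assms(1), of "norm lam" "norm z"] by blast
  have "(norm (\<phi> z))\<^sup>2 \<le> ((norm (\<phi> 0))\<^sup>2 + 0\<^sup>2) * exp ((2 * K + 1) * norm z)"
    by (rule gronwall_cball[where D = "\<lambda>w. system_rhs X lam w (\<phi> w)"])
      (use sol K in \<open>auto simp: solution_iff_rhs\<close>)
  then show ?thesis
    by (simp add: 0)
qed

text \<open>Initial values on the unit sphere have a convergent subsequence. Gronwall makes the
  corresponding solutions uniformly Cauchy on every disc, the equation carries this over to the
  differentials, and so the limit solves the system; its value at 0 has norm 1.\<close>

lemma solutions_subconvergent:
  assumes cc: "continuous_coeffs X" and lams: "lams \<longlonglongrightarrow> lam"
    and sol: "\<And>n. solution X (lams n) (\<phi>s n)" and norm1: "\<And>n. norm (\<phi>s n 0) = 1"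
  shows "\<exists>r \<phi>. strict_mono (r :: nat \<Rightarrow> nat) \<and> solution X lam \<phi> \<and> \<phi> 0 \<noteq> 0 \<and> (\<forall>z. (\<lambda>n. \<phi>s (r n) z) \<longlonglongrightarrow> \<phi> z)"
proof -
  have "\<forall>n. \<phi>s n 0 \<in> sphere 0 1"
    by (simp add: norm1)
  then obtain r c where r: "strict_mono (r :: nat \<Rightarrow> nat)" and c: "c \<in> sphere 0 1" "((\<lambda>n. \<phi>s n 0) \<circ> r) \<longlonglongrightarrow> c"
    using compact_sphere[of "0::C4" 1] unfolding compact_def by metis
  define \<psi> where "\<psi> n = \<phi>s (r n)" for n
  define \<mu> where "\<mu> n = lams (r n)" for n
  have \<psi>0: "(\<lambda>n. \<psi> n 0) \<longlonglongrightarrow> c"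
    using c(2) by (simp add: \<psi>_def comp_def)
  have \<mu>: "\<mu> \<longlonglongrightarrow> lam"
    using LIMSEQ_subseq_LIMSEQ[OF lams r] by (simp add: \<mu>_def[abs_def] comp_def)
  have der: "(\<psi> n has_derivative system_rhs X (\<mu> n) z (\<psi> n z)) (at z)" for n z
    using sol by (simp add: solution_iff_rhs \<psi>_def \<mu>_def)
  obtain \<Lambda> where \<Lambda>: "\<And>n. norm (\<mu> n) \<le> \<Lambda>"
    using convergent_imp_Bseq[OF convergentI[OF \<mu>]] by (auto simp: Bseq_def)
  have ball: "\<exists>K Q. K \<ge> 0 \<and> Q \<ge> 1 \<and>
      (\<forall>lam z r t. norm lam \<le> \<Lambda> \<longrightarrow> z \<in> cball 0 R \<longrightarrow> norm (system_rhs X lam z r t) \<le> K * norm r * norm t) \<and>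
      (\<forall>n. \<forall>z\<in>cball 0 R. norm (\<psi> n z) \<le> Q) \<and>
      (\<forall>e>0. \<exists>N. \<forall>n\<ge>N. \<forall>m\<ge>N. \<forall>z\<in>cball 0 R. norm (\<psi> n z - \<psi> m z) < e)" if R: "R \<ge> 0" for R
  proof -
    obtain K where K: "K \<ge> 0" "\<And>lam z r t. norm lam \<le> \<Lambda> \<Longrightarrow> z \<in> cball 0 R \<Longrightarrow> norm (system_rhs X lam z r t) \<le> K * norm r * norm t"
      using rhs_bound[OF cc, of \<Lambda> R] by blast
    define Q where "Q = exp ((2 * K + 1) * R)"
    \<comment> \<open>Gronwall bounds the squared norm by \<open>Q\<close>; as \<open>Q\<close> is
      at least 1, it then bounds the norm itself.\<close>
    have Q: "Q \<ge> 1"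
      using K(1) R by (simp add: Q_def)
    have \<psi>Q: "norm (\<psi> n z) \<le> Q" if z: "z \<in> cball 0 R" for n z
    proof -
      have "(norm (\<psi> n z))\<^sup>2 \<le> ((norm (\<psi> n 0))\<^sup>2 + 0\<^sup>2) * exp ((2 * K + 1) * R)"
        by (rule gronwall_cball[OF der]) (use K \<Lambda> z in auto)
      then have "(norm (\<psi> n z))\<^sup>2 \<le> Q * 1"
        by (simp add: Q_def \<psi>_def norm1)
      also have "\<dots> \<le> Q * Q"
        using Q by (intro mult_left_mono) auto
      finally have "(norm (\<psi> n z))\<^sup>2 \<le> Q\<^sup>2"
        unfolding power2_eq_square[of Q] .
      then show ?thesis
        by (rule power2_le_imp_le) (use Q in simp)
    qed
    \<comment> \<open>The difference solves the system with parameter \<open>\<mu> n\<close> up to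
      an error caused by the change of parameter; that error is the inhomogeneity in
      \<open>gronwall_cball\<close>.\<close>
    have diff: "(norm (\<psi> n z - \<psi> m z))\<^sup>2 \<le> ((norm (\<psi> n 0 - \<psi> m 0))\<^sup>2 + (4 * norm (\<mu> n - \<mu> m) * Q)\<^sup>2) * Q"
      if z: "z \<in> cball 0 R" for n m z
      unfolding Q_def
    proof (rule gronwall_cball[where D = "\<lambda>z t. system_rhs X (\<mu> n) z (\<psi> n z) t - system_rhs X (\<mu> m) z (\<psi> m z) t"])
      fix z t :: complex assume z: "z \<in> cball 0 R"
      show "((\<lambda>z. \<psi> n z - \<psi> m z) has_derivative (\<lambda>t. system_rhs X (\<mu> n) z (\<psi> n z) t - system_rhs X (\<mu> m) z (\<psi> m z) t)) (at z)"
        by (intro has_derivative_diff der)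
      have "norm (system_rhs X (\<mu> n) z (\<psi> n z) t - system_rhs X (\<mu> m) z (\<psi> m z) t)
          = norm (system_rhs X (\<mu> n) z (\<psi> n z - \<psi> m z) t + (system_rhs X (\<mu> n) z (\<psi> m z) t - system_rhs X (\<mu> m) z (\<psi> m z) t))"
        by (simp flip: rhs_diff)
      also have "\<dots> \<le> K * norm (\<psi> n z - \<psi> m z) * norm t + 4 * norm (\<mu> n - \<mu> m) * norm (\<psi> m z) * norm t"
        by (rule norm_triangle_mono[OF K(2)[OF \<Lambda> z] norm_rhs_diff_parameter_le])
      also have "\<dots> \<le> K * norm (\<psi> n z - \<psi> m z) * norm t + 4 * norm (\<mu> n - \<mu> m) * Q * norm t"
        using \<psi>Q[OF z, of m] by (intro add_left_mono mult_right_mono mult_left_mono) auto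
      finally show "norm (system_rhs X (\<mu> n) z (\<psi> n z) t - system_rhs X (\<mu> m) z (\<psi> m z) t)
          \<le> (K * norm (\<psi> n z - \<psi> m z) + 4 * norm (\<mu> n - \<mu> m) * exp ((2 * K + 1) * R)) * norm t"
        by (simp add: Q_def distrib_right)
    qed (use K z in auto)
    have "\<exists>N. \<forall>n\<ge>N. \<forall>m\<ge>N. \<forall>z\<in>cball 0 R. norm (\<psi> n z - \<psi> m z) < e" if e: "e > 0" for e
    proof -
      \<comment> \<open>With both differences below \<eta>, the bound in \<open>diff\<close> is at
        most \<eta>^2 B; \<eta> = e / (2 B) makes this e^2 / (4 B), which is below e^2.\<close>
      define B where "B = (1 + 16 * Q\<^sup>2) * Q"
      have B: "B \<ge> 1"
        using Q mult_mono[of 1 "1 + 16 * Q\<^sup>2" 1 Q] by (simp add: B_def)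
      define \<eta> where "\<eta> = e / (2 * B)"
      have \<eta>: "\<eta> > 0"
        using e B by (simp add: \<eta>_def)
      obtain N1 where N1: "\<And>n m. n \<ge> N1 \<Longrightarrow> m \<ge> N1 \<Longrightarrow> norm (\<psi> n 0 - \<psi> m 0) < \<eta>"
        using LIMSEQ_imp_Cauchy[OF \<psi>0] \<eta> unfolding Cauchy_iff by blast
      obtain N2 where N2: "\<And>n m. n \<ge> N2 \<Longrightarrow> m \<ge> N2 \<Longrightarrow> norm (\<mu> n - \<mu> m) < \<eta>"
        using LIMSEQ_imp_Cauchy[OF \<mu>] \<eta> unfolding Cauchy_iff by blast
      have "norm (\<psi> n z - \<psi> m z) < e" if "n \<ge> max N1 N2" "m \<ge> max N1 N2" "z \<in> cball 0 R" for n m z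
      proof (rule power2_less_imp_less)
        have "(norm (\<psi> n 0 - \<psi> m 0))\<^sup>2 \<le> \<eta>\<^sup>2"
          using N1[of n m] that by (intro power_mono) auto
        moreover have "(4 * norm (\<mu> n - \<mu> m) * Q)\<^sup>2 \<le> (4 * \<eta> * Q)\<^sup>2"
          using N2[of n m] that Q \<eta> by (intro power_mono mult_right_mono) auto
        ultimately have "((norm (\<psi> n 0 - \<psi> m 0))\<^sup>2 + (4 * norm (\<mu> n - \<mu> m) * Q)\<^sup>2) * Q
            \<le> (\<eta>\<^sup>2 + (4 * \<eta> * Q)\<^sup>2) * Q"
          using Q by (intro mult_right_mono add_mono) auto
        also have "\<dots> = \<eta>\<^sup>2 * B"
          by (simp add: B_def power_mult_distrib algebra_simps)
        also have "\<dots> = e\<^sup>2 / (4 * B)"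
          using B by (simp add: \<eta>_def power2_eq_square)
        also have "\<dots> < e\<^sup>2"
          using B e by (simp add: field_simps)
        finally show "(norm (\<psi> n z - \<psi> m z))\<^sup>2 < e\<^sup>2"
          using diff[OF that(3), of n m] by linarith
      qed (use e in simp)
      then show ?thesis
        by blast
    qed
    with K Q \<psi>Q show ?thesis
      by blast
  qed
  define \<phi> where "\<phi> z = lim (\<lambda>n. \<psi> n z)" for z
  have lim: "(\<lambda>n. \<psi> n z) \<longlonglongrightarrow> \<phi> z" for z
  proof -
    obtain K Q where "\<forall>e>0. \<exists>N. \<forall>n\<ge>N. \<forall>m\<ge>N. \<forall>w\<in>cball 0 (norm z). norm (\<psi> n w - \<psi> m w) < e"
      using ball[of "norm z"] by auto
    then have "Cauchy (\<lambda>n. \<psi> n z)"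
      unfolding Cauchy_iff by (metis cball_trivial mem_cball_0 order_refl)
    then show ?thesis
      unfolding \<phi>_def by (simp add: Cauchy_convergent_iff convergent_LIMSEQ_iff)
  qed
  have "(\<phi> has_derivative system_rhs X lam z0 (\<phi> z0)) (at z0)" for z0
  proof -
    \<comment> \<open>The margin 1 puts \<open>z0\<close> into the interior, so that the derivative
      within the disc is the full derivative.\<close>
    define R where "R = norm z0 + 1"
    have R: "R \<ge> 0" "z0 \<in> interior (cball 0 R)"
      by (simp_all add: R_def)
    obtain K Q where K: "K \<ge> 0" "\<And>lam z r t. norm lam \<le> \<Lambda> \<Longrightarrow> z \<in> cball 0 R \<Longrightarrow> norm (system_rhs X lam z r t) \<le> K * norm r * norm t"
      and Q: "Q \<ge> 1" "\<And>n z. z \<in> cball 0 R \<Longrightarrow> norm (\<psi> n z) \<le> Q"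
      and cau: "\<And>e. e > 0 \<Longrightarrow> \<exists>N. \<forall>n\<ge>N. \<forall>m\<ge>N. \<forall>z\<in>cball 0 R. norm (\<psi> n z - \<psi> m z) < e"
      using ball[OF R(1)] by metis
    have \<phi>Q: "norm (\<phi> z) \<le> Q" if "z \<in> cball 0 R" for z
      by (rule Lim_bounded[OF tendsto_norm[OF lim]]) (use Q(2) that in auto)
    have "\<forall>\<^sub>F n in sequentially. \<forall>z\<in>cball 0 R. \<forall>t. norm (system_rhs X (\<mu> n) z (\<psi> n z) t - system_rhs X lam z (\<phi> z) t) \<le> e * norm t"
      if e: "e > 0" for e
    proof -
      \<comment> \<open>Half of e is for the distance of the solutions, the other half for the
        parameters, whose tolerance e / (8 Q) compensates the factor 4 and the bound
        \<open>Q\<close>.\<close>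
      define \<eta> where "\<eta> = e / (2 * (K + 1))"
      have \<eta>: "\<eta> > 0" "K * \<eta> \<le> e / 2"
        using e K(1) by (simp_all add: \<eta>_def field_simps)
      obtain N where N: "\<And>n m z. n \<ge> N \<Longrightarrow> m \<ge> N \<Longrightarrow> z \<in> cball 0 R \<Longrightarrow> norm (\<psi> n z - \<psi> m z) < \<eta>"
        using cau[OF \<eta>(1)] by blast
      have N': "norm (\<psi> n z - \<phi> z) \<le> \<eta>" if "n \<ge> N" "z \<in> cball 0 R" for n z
      proof (rule Lim_bounded)
        show "(\<lambda>m. norm (\<psi> n z - \<psi> m z)) \<longlonglongrightarrow> norm (\<psi> n z - \<phi> z)"
          by (intro tendsto_intros lim)
        show "\<forall>m\<ge>N. norm (\<psi> n z - \<psi> m z) \<le> \<eta>"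
          using N[OF that(1) _ that(2)] by (auto intro: less_imp_le)
      qed
      have "\<forall>\<^sub>F n in sequentially. norm (\<mu> n - lam) < e / (8 * Q)"
        using tendstoD[OF \<mu>, of "e / (8 * Q)"] e Q by (simp add: dist_norm)
      moreover have "\<forall>\<^sub>F n in sequentially. n \<ge> N"
        by (rule eventually_ge_at_top)
      ultimately show ?thesis
      proof eventually_elim
        case (elim n)
        show ?case
        proof (intro ballI allI)
          fix z t :: complex assume z: "z \<in> cball 0 R"
          have "norm (system_rhs X (\<mu> n) z (\<psi> n z) t - system_rhs X lam z (\<phi> z) t) =
              norm (system_rhs X (\<mu> n) z (\<psi> n z - \<phi> z) t + (system_rhs X (\<mu> n) z (\<phi> z) t - system_rhs X lam z (\<phi> z) t))"
            by (simp flip: rhs_diff)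
          also have "\<dots> \<le> K * norm (\<psi> n z - \<phi> z) * norm t + 4 * norm (\<mu> n - lam) * norm (\<phi> z) * norm t"
            by (rule norm_triangle_mono[OF K(2)[OF \<Lambda> z] norm_rhs_diff_parameter_le])
          also have "\<dots> \<le> e / 2 * norm t + e / 2 * norm t"
          proof (intro add_mono mult_right_mono)
            show "K * norm (\<psi> n z - \<phi> z) \<le> e / 2"
              using mult_left_mono[OF N'[OF elim(2) z] K(1)] \<eta>(2) by linarith
            have "norm (\<mu> n - lam) * norm (\<phi> z) \<le> e / (8 * Q) * Q"
              using elim(1) \<phi>Q[OF z] e Q by (intro mult_mono) auto
            then show "4 * norm (\<mu> n - lam) * norm (\<phi> z) \<le> e / 2"
              using Q by simp
          qed auto
          finally show "norm (system_rhs X (\<mu> n) z (\<psi> n z) t - system_rhs X lam z (\<phi> z) t) \<le> e * norm t"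
            by (simp add: field_simps)
        qed
      qed
    qed
    then have "\<exists>g. \<forall>z\<in>cball 0 R. (\<lambda>n. \<psi> n z) \<longlonglongrightarrow> g z \<and> (g has_derivative system_rhs X lam z (\<phi> z)) (at z within cball 0 R)"
      using R der lim
      by (intro has_derivative_sequence[where f = \<psi> and f' = "\<lambda>n z. system_rhs X (\<mu> n) z (\<psi> n z)",
            OF _ _ _ _ lim[of 0]])
        (auto intro: has_derivative_at_withinI)
    then obtain g where g: "\<And>z. z \<in> cball 0 R \<Longrightarrow> (\<lambda>n. \<psi> n z) \<longlonglongrightarrow> g z"
      "\<And>z. z \<in> cball 0 R \<Longrightarrow> (g has_derivative system_rhs X lam z (\<phi> z)) (at z within cball 0 R)"
      by blast
    have \<phi>g: "\<phi> z = g z" if "z \<in> cball 0 R" for z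
      using LIMSEQ_unique[OF lim g(1)[OF that]] .
    have z0: "z0 \<in> cball 0 R"
      by (simp add: R_def)
    have "(\<phi> has_derivative system_rhs X lam z0 (\<phi> z0)) (at z0 within cball 0 R)"
      by (rule has_derivative_transform[OF z0 \<phi>g g(2)[OF z0]])
    then show ?thesis
      using at_within_interior[OF R(2)] by simp
  qed
  moreover have "\<phi> 0 = c"
    using LIMSEQ_unique[OF lim \<psi>0] .
  ultimately show ?thesis
    using r c(1) lim unfolding solution_iff_rhs \<psi>_def
    by (intro exI[of _ r] exI[of _ \<phi>]) auto
qed

section \<open>Invariance of the spectrum\<close>

lemma tendsto_C4_iff:
  fixes f :: "'a \<Rightarrow> C4"
  shows "(f \<longlongrightarrow> l) F \<longleftrightarrow>
    ((\<lambda>n. fst (f n) $ 1) \<longlongrightarrow> fst l $ 1) F \<and> ((\<lambda>n. fst (f n) $ 2) \<longlongrightarrow> fst l $ 2) F \<and>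
    ((\<lambda>n. snd (f n) $ 1) \<longlongrightarrow> snd l $ 1) F \<and> ((\<lambda>n. snd (f n) $ 2) \<longlongrightarrow> snd l $ 2) F" (is "_ \<longleftrightarrow> ?r")
proof
  assume "(f \<longlongrightarrow> l) F"
  then show ?r
    by (auto intro!: tendsto_vec_nth tendsto_fst tendsto_snd)
next
  assume ?r
  then have "\<forall>i. ((\<lambda>n. fst (f n) $ i) \<longlongrightarrow> fst l $ i) F" "\<forall>i. ((\<lambda>n. snd (f n) $ i) \<longlongrightarrow> snd l $ i) F"
    by (simp_all add: forall_2)
  then have "((\<lambda>n. fst (f n)) \<longlongrightarrow> fst l) F" "((\<lambda>n. snd (f n)) \<longlongrightarrow> snd l) F"
    by (blast intro: vec_tendstoI)+
  from tendsto_Pair[OF this] show "(f \<longlongrightarrow> l) F"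
    by simp
qed

lemma cscale_nth [simp]: "fst (cscale k r) $ i = k * fst r $ i" "snd (cscale k r) $ i = k * snd r $ i"
  by (simp_all add: cscale_def)

lemma tendsto_cscale:
  assumes "(k \<longlongrightarrow> k0) F" "(r \<longlongrightarrow> r0) F"
  shows "((\<lambda>n. cscale (k n) (r n)) \<longlongrightarrow> cscale k0 r0) F"
  using assms by (auto simp: tendsto_C4_iff intro!: tendsto_mult)

text \<open>Division by a component of the limit that does not vanish. It turns convergence of
  eigenfunctions into convergence of their multipliers.\<close>

lemma tendsto_cscale_imp:
  assumes lim: "((\<lambda>n. cscale (k n) (r n)) \<longlongrightarrow> cscale k0 r0) F" and r: "(r \<longlongrightarrow> r0) F" and "r0 \<noteq> 0"
  shows "(k \<longlongrightarrow> k0) F"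
proof -
  have quot: "(k \<longlongrightarrow> k0) F" if "((\<lambda>n. k n * x n) \<longlongrightarrow> k0 * x0) F" "(x \<longlongrightarrow> x0) F" "x0 \<noteq> 0" for x x0
  proof -
    have "((\<lambda>n. k n * x n / x n) \<longlongrightarrow> k0 * x0 / x0) F"
      by (intro tendsto_divide that)
    moreover have "\<forall>\<^sub>F n in F. k n * x n / x n = k n"
      using tendsto_imp_eventually_ne[OF that(2,3)] by eventually_elim simp
    ultimately show ?thesis
      using \<open>x0 \<noteq> 0\<close> by (simp add: filterlim_cong)
  qed
  have "fst r0 $ 1 \<noteq> 0 \<or> fst r0 $ 2 \<noteq> 0 \<or> snd r0 $ 1 \<noteq> 0 \<or> snd r0 $ 2 \<noteq> 0"
    using \<open>r0 \<noteq> 0\<close> by (auto simp: C4_eq_iff)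
  then show ?thesis
    using quot lim r unfolding tendsto_C4_iff cscale_nth by meson
qed

lemma cscale_of_real: "cscale (of_real a) r = a *\<^sub>R r"
  by (simp add: C4_eq_iff scaleR_conv_of_real[where 'a = complex])

lemma solution_cscale: "solution X lam \<phi> \<Longrightarrow> solution X lam (\<lambda>z. cscale k (\<phi> z))"
  unfolding solution_iff
proof (intro allI, elim allE conjE, intro conjI)
qed (auto simp: algebra_simps dest: has_wirtinger_cmult[where k = k])

lemma multiplicative_cscale: "multiplicative \<gamma> m \<phi> \<Longrightarrow> multiplicative \<gamma> m (\<lambda>z. cscale k (\<phi> z))"
  by (simp add: multiplicative_def cscale_cscale mult.commute)

lemma joint_eigenfunction_cscale:
  assumes "joint_eigenfunction \<gamma>\<^sub>1 \<gamma>\<^sub>2 X lam \<phi>" "k \<noteq> 0"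
  shows "joint_eigenfunction \<gamma>\<^sub>1 \<gamma>\<^sub>2 X lam (\<lambda>z. cscale k (\<phi> z))"
  using assms solution_cscale multiplicative_cscale unfolding joint_eigenfunction_iff
  by (simp add: C4_eq_iff) blast

lemma gauge_0: "gauge_map \<epsilon> v vx vy h lam z 0 = 0"
  by (simp add: C4_eq_iff gauge_map_def Let_def)

lemma gauge_inverse':
  assumes "\<epsilon> = 1 \<or> \<epsilon> = - 1"
  shows "gauge_map \<epsilon> v vx vy h lam z (gauge_map \<epsilon> (\<lambda>z. - v z) (\<lambda>z. - vx z) (\<lambda>z. - vy z) (\<lambda>z. - \<epsilon> * h z) lam z r) = r"
proof -
  have "(\<lambda>z. - \<epsilon> * (- \<epsilon> * h z)) = h"
    using assms by auto
  then show ?thesis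
    using gauge_inverse[OF assms, of "\<lambda>z. - v z" "\<lambda>z. - vx z" "\<lambda>z. - vy z" "\<lambda>z. - \<epsilon> * h z"] by simp
qed

lemma tendsto_gauge:
  assumes "(lams \<longlongrightarrow> lam) F" "lam \<noteq> 0" "(r \<longlongrightarrow> r0) F"
  shows "((\<lambda>n. gauge_map \<epsilon> v vx vy h (lams n) z (r n)) \<longlongrightarrow> gauge_map \<epsilon> v vx vy h lam z r0) F"
  using assms unfolding tendsto_C4_iff gauge_map_def Let_def
  by (auto intro!: tendsto_intros)

section \<open>Transport of eigenfunctions, generic parameters and spectra\<close>

context conformal_change
begin

abbreviation T where "T lam \<phi> z \<equiv> gauge_map \<epsilon> v vx vy h lam z (\<phi> z)"

abbreviation periodic_data where "periodic_data \<gamma> \<equiv>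
  (\<forall>z. v (z + \<gamma>) = v z \<and> vx (z + \<gamma>) = vx z \<and> vy (z + \<gamma>) = vy z \<and> h (z + \<gamma>) = h z)"

lemma multiplicative_gauge:
  assumes "periodic_data \<gamma>" "multiplicative \<gamma> m \<phi>"
  shows "multiplicative \<gamma> m (T lam \<phi>)"
proof -
  have "gauge_map \<epsilon> v vx vy h lam (z + \<gamma>) = gauge_map \<epsilon> v vx vy h lam z" for z
    using assms(1) by (simp add: fun_eq_iff gauge_map_def)
  then show ?thesis
    using assms(2) by (simp add: multiplicative_def gauge_cscale)
qed

lemma joint_eigenfunction_gauge:
  assumes per: "periodic_data \<gamma>\<^sub>1" "periodic_data \<gamma>\<^sub>2" and lam: "lam \<noteq> 0"
    and \<phi>: "joint_eigenfunction \<gamma>\<^sub>1 \<gamma>\<^sub>2 X lam \<phi>"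
  shows "joint_eigenfunction \<gamma>\<^sub>1 \<gamma>\<^sub>2 Y lam (T lam \<phi>)"
proof -
  obtain z m1 m2 where *: "solution X lam \<phi>" "\<phi> z \<noteq> 0" "multiplicative \<gamma>\<^sub>1 m1 \<phi>" "multiplicative \<gamma>\<^sub>2 m2 \<phi>"
    using \<phi> by (auto simp: joint_eigenfunction_iff)
  have "T lam \<phi> z \<noteq> 0"
    using gauge_inverse[OF \<epsilon>, of v vx vy h lam z "\<phi> z"] *(2) by (auto simp: gauge_0)
  then show ?thesis
    using gauge_solution[OF *(1) lam] multiplicative_gauge[OF per(1) *(3), of lam]
      multiplicative_gauge[OF per(2) *(4), of lam]
    unfolding joint_eigenfunction_iff by blast
qed

text \<open>The gauge map is complex homogeneous and therefore maps lines to lines; the gauge of the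
  inverse change maps them back, so the eigenlines of the two surfaces are in bijection.\<close>

lemma generic_parameter_gauge:
  assumes per: "periodic_data \<gamma>\<^sub>1" "periodic_data \<gamma>\<^sub>2" and lam: "lam \<noteq> 0"
    and gen: "generic_parameter \<gamma>\<^sub>1 \<gamma>\<^sub>2 X lam"
  shows "generic_parameter \<gamma>\<^sub>1 \<gamma>\<^sub>2 Y lam"
proof -
  let ?T' = "\<lambda>\<psi> z. gauge_map \<epsilon> (\<lambda>z. - v z) (\<lambda>z. - vx z) (\<lambda>z. - vy z) (\<lambda>z. - \<epsilon> * h z) lam z (\<psi> z)"
  have line: "complex_line (T lam \<phi>) = T lam ` complex_line \<phi>" for \<phi>
    by (auto simp: complex_line_def image_image gauge_cscale)
  have "eigenlines \<gamma>\<^sub>1 \<gamma>\<^sub>2 Y lam = (`) (T lam) ` eigenlines \<gamma>\<^sub>1 \<gamma>\<^sub>2 X lam"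
  proof (intro equalityI subsetI)
    fix L assume "L \<in> eigenlines \<gamma>\<^sub>1 \<gamma>\<^sub>2 Y lam"
    then obtain \<psi> where L: "L = complex_line \<psi>" and \<psi>: "joint_eigenfunction \<gamma>\<^sub>1 \<gamma>\<^sub>2 Y lam \<psi>"
      by (auto simp: eigenlines_def)
    have "joint_eigenfunction \<gamma>\<^sub>1 \<gamma>\<^sub>2 X lam (?T' \<psi>)"
      using per by (intro conformal_change.joint_eigenfunction_gauge[OF conformal_change_inverse _ _ lam \<psi>]) auto
    moreover have "T lam (?T' \<psi>) = \<psi>"
      by (simp only: gauge_inverse'[OF \<epsilon>])
    then have "L = T lam ` complex_line (?T' \<psi>)"
      using line[of "?T' \<psi>"] by (simp add: L)
    ultimately show "L \<in> (`) (T lam) ` eigenlines \<gamma>\<^sub>1 \<gamma>\<^sub>2 X lam"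
      by (auto simp: eigenlines_def)
  next
    fix L assume "L \<in> (`) (T lam) ` eigenlines \<gamma>\<^sub>1 \<gamma>\<^sub>2 X lam"
    then obtain \<phi> where L: "L = T lam ` complex_line \<phi>" and "joint_eigenfunction \<gamma>\<^sub>1 \<gamma>\<^sub>2 X lam \<phi>"
      by (auto simp: eigenlines_def)
    then have "joint_eigenfunction \<gamma>\<^sub>1 \<gamma>\<^sub>2 Y lam (T lam \<phi>)"
      by (intro joint_eigenfunction_gauge per lam)
    then show "L \<in> eigenlines \<gamma>\<^sub>1 \<gamma>\<^sub>2 Y lam"
      unfolding L line[symmetric] eigenlines_def by blast
  qed
  moreover have "inj (T lam)"
  proof (rule inj_on_inverseI)
    show "?T' (T lam \<phi>) = \<phi>" for \<phi>
      by (simp only: gauge_inverse[OF \<epsilon>])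
  qed
  then have "inj_on ((`) (T lam)) (eigenlines \<gamma>\<^sub>1 \<gamma>\<^sub>2 X lam)"
    by (meson inj_image_eq_iff inj_onI)
  ultimately show ?thesis
    using gen by (simp add: generic_parameter_def card_image)
qed

text \<open>The gauge transformation has a pole at \<open>\<lambda> = 0\<close>.  The points of the curve over \<open>0\<close> are limits of
  points over \<open>\<lambda> \<noteq> 0\<close>, though, so they are recovered as limits of normalised eigenfunctions, whose
  multipliers converge.\<close>

lemma spectrum_subset:
  assumes per: "periodic_data \<gamma>\<^sub>1" "periodic_data \<gamma>\<^sub>2"
    and perX: "\<And>z \<gamma>. \<gamma> \<in> {\<gamma>\<^sub>1, \<gamma>\<^sub>2} \<Longrightarrow> conf_exponent X (z + \<gamma>) = conf_exponent X z"
    and cc: "continuous_coeffs Y"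
  shows "spectrum \<gamma>\<^sub>1 \<gamma>\<^sub>2 X \<subseteq> spectrum \<gamma>\<^sub>1 \<gamma>\<^sub>2 Y"
proof (rule subrelI)
  fix m1 m2 assume "(m1, m2) \<in> spectrum \<gamma>\<^sub>1 \<gamma>\<^sub>2 X"
  then obtain lam \<phi> lams \<phi>s z0 where \<phi>: "solution X lam \<phi>" "\<phi> z0 \<noteq> 0"
      "multiplicative \<gamma>\<^sub>1 m1 \<phi>" "multiplicative \<gamma>\<^sub>2 m2 \<phi>"
    and lims: "lams \<longlonglongrightarrow> lam" "\<And>z. (\<lambda>n. \<phi>s n z) \<longlonglongrightarrow> \<phi> z"
    and gen: "\<And>n. generic_parameter \<gamma>\<^sub>1 \<gamma>\<^sub>2 X (lams n)"
    and joint: "\<And>n. joint_eigenfunction \<gamma>\<^sub>1 \<gamma>\<^sub>2 X (lams n) (\<phi>s n)"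
    unfolding spectrum_iff by blast
  have nz: "lams n \<noteq> 0" for n
    using gen[of n] not_generic_parameter_0[OF differentiable_conf_exponent perX] by metis
  have genY: "generic_parameter \<gamma>\<^sub>1 \<gamma>\<^sub>2 Y (lams n)" for n
    by (rule generic_parameter_gauge[OF per nz gen])
  have jointY: "joint_eigenfunction \<gamma>\<^sub>1 \<gamma>\<^sub>2 Y (lams n) (T (lams n) (\<phi>s n))" for n
    by (rule joint_eigenfunction_gauge[OF per nz joint])
  show "(m1, m2) \<in> spectrum \<gamma>\<^sub>1 \<gamma>\<^sub>2 Y"
  proof (cases "lam = 0")
    case False
    have "T lam \<phi> z0 \<noteq> 0"
      using gauge_inverse[OF \<epsilon>, of v vx vy h lam z0 "\<phi> z0"] \<phi>(2) by (auto simp: gauge_0)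
    then show ?thesis
      unfolding spectrum_iff
      using gauge_solution[OF \<phi>(1) False] multiplicative_gauge[OF per(1) \<phi>(3), of lam]
        multiplicative_gauge[OF per(2) \<phi>(4), of lam] lims(1) tendsto_gauge[OF lims(1) False lims(2)] genY jointY
      by (intro exI[of _ lam] exI[of _ "T lam \<phi>"] exI[of _ lams] exI[of _ "\<lambda>n. T (lams n) (\<phi>s n)"]) blast
  next
    case True
    define \<xi> where "\<xi> n = T (lams n) (\<phi>s n)" for n
    \<comment> \<open>The factor 1/\<open>lam\<close> may make the transported functions blow up,
      hence the normalisation at 0.\<close>
    define \<psi> where "\<psi> n z = cscale (of_real (1 / norm (\<xi> n 0))) (\<xi> n z)" for n z
    \<comment> \<open>A solution that vanishes at 0 vanishes everywhere, so no eigenfunction is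
      lost.\<close>
    have \<xi>0: "\<xi> n 0 \<noteq> 0" for n
      using jointY[of n] solution_eq_0[OF cc, of "lams n" "\<xi> n"] unfolding joint_eigenfunction_iff \<xi>_def by metis
    have joint\<psi>: "joint_eigenfunction \<gamma>\<^sub>1 \<gamma>\<^sub>2 Y (lams n) (\<psi> n)" for n
      unfolding \<psi>_def[abs_def] using jointY[of n] \<xi>0[of n]
      by (intro joint_eigenfunction_cscale) (auto simp: \<xi>_def)
    have norm1: "norm (\<psi> n 0) = 1" for n
      using \<xi>0[of n] unfolding \<psi>_def cscale_of_real by simp
    obtain r \<psi>0 where r: "strict_mono (r :: nat \<Rightarrow> nat)" and \<psi>0: "solution Y lam \<psi>0" "\<psi>0 0 \<noteq> 0"
      "\<And>z. (\<lambda>n. \<psi> (r n) z) \<longlonglongrightarrow> \<psi>0 z"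
      using solutions_subconvergent[OF cc lims(1), of \<psi>] joint\<psi> norm1 unfolding joint_eigenfunction_iff by blast
    \<comment> \<open>Neither the gauge nor the normalisation changes the multipliers. Their limit
      is therefore read off from the original eigenfunctions at \<open>z0\<close>, where the limit
      function is nonzero.\<close>
    have mult: "multiplicative \<gamma> m \<psi>0"
      if \<gamma>: "periodic_data \<gamma>" and m: "multiplicative \<gamma> m \<phi>" and ex: "\<And>n. \<exists>m. multiplicative \<gamma> m (\<phi>s n)" for \<gamma> m
    proof -
      obtain \<mu> where \<mu>: "\<And>n. multiplicative \<gamma> (\<mu> n) (\<phi>s n)"
        using ex by metis
      have "(\<lambda>n. \<phi>s n (z0 + \<gamma>)) \<longlonglongrightarrow> \<phi> (z0 + \<gamma>)"
        by (rule lims)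
      then have "(\<lambda>n. cscale (\<mu> n) (\<phi>s n z0)) \<longlonglongrightarrow> cscale m (\<phi> z0)"
        using \<mu> m by (simp add: multiplicative_def)
      then have "\<mu> \<longlonglongrightarrow> m"
        by (rule tendsto_cscale_imp[OF _ lims(2) \<phi>(2)])
      then have \<mu>r: "(\<lambda>n. \<mu> (r n)) \<longlonglongrightarrow> m"
        using LIMSEQ_subseq_LIMSEQ[OF _ r] by (auto simp: comp_def)
      have "multiplicative \<gamma> (\<mu> n) (\<psi> n)" for n
        unfolding \<psi>_def[abs_def] \<xi>_def by (intro multiplicative_cscale multiplicative_gauge \<gamma> \<mu>)
      then have "\<psi> n (z + \<gamma>) = cscale (\<mu> n) (\<psi> n z)" for n z
        by (simp add: multiplicative_def)
      then have "(\<lambda>n. cscale (\<mu> (r n)) (\<psi> (r n) z)) \<longlonglongrightarrow> \<psi>0 (z + \<gamma>)" for z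
        using \<psi>0(3)[of "z + \<gamma>"] by simp
      moreover have "(\<lambda>n. cscale (\<mu> (r n)) (\<psi> (r n) z)) \<longlonglongrightarrow> cscale m (\<psi>0 z)" for z
        by (intro tendsto_cscale \<mu>r \<psi>0(3))
      ultimately show ?thesis
        unfolding multiplicative_def using LIMSEQ_unique by blast
    qed
    have "multiplicative \<gamma>\<^sub>1 m1 \<psi>0" "multiplicative \<gamma>\<^sub>2 m2 \<psi>0"
      using joint per \<phi>(3,4) by (auto intro!: mult simp: joint_eigenfunction_iff)
    moreover have "(\<lambda>n. lams (r n)) \<longlonglongrightarrow> lam"
      using LIMSEQ_subseq_LIMSEQ[OF lims(1) r] by (simp add: comp_def)
    ultimately show ?thesis
      unfolding spectrum_iff using \<psi>0 genY joint\<psi>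
      by (intro exI[of _ lam] exI[of _ \<psi>0] exI[of _ "\<lambda>n. lams (r n)"] exI[of _ "\<lambda>n. \<psi> (r n)"]) blast
  qed
qed

lemma continuous_coeffs_Y:
  assumes "continuous_coeffs X"
  shows "continuous_coeffs Y"
proof -
  have "continuous_on UNIV f" if "\<And>z. f differentiable at z" for f :: "complex \<Rightarrow> real"
    using that by (meson differentiable_at_withinI differentiable_imp_continuous_on differentiable_on_def)
  then have "continuous_on UNIV vx" "continuous_on UNIV vy" "continuous_on UNIV h"
    using vx_partials[THEN has_partials_imp(1)] vy_partials[THEN has_partials_imp(1)]
      h_partials[THEN has_partials_imp(1)] by blast+
  then show ?thesis
    using assms unfolding continuous_coeffs_def mean_coeff_Y[abs_def] hopf_coeff_Y[abs_def]
      alpha_z_Y[abs_def] alpha_zbar_Y[abs_def] w_def w'_def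
    by (auto intro!: continuous_intros)
qed

lemma spectrum_eq:
  assumes per: "periodic_data \<gamma>\<^sub>1" "periodic_data \<gamma>\<^sub>2"
    and perX: "\<And>z \<gamma>. \<gamma> \<in> {\<gamma>\<^sub>1, \<gamma>\<^sub>2} \<Longrightarrow> conf_exponent X (z + \<gamma>) = conf_exponent X z"
    and cc: "continuous_coeffs X"
  shows "spectrum \<gamma>\<^sub>1 \<gamma>\<^sub>2 X = spectrum \<gamma>\<^sub>1 \<gamma>\<^sub>2 Y"
proof
  show "spectrum \<gamma>\<^sub>1 \<gamma>\<^sub>2 X \<subseteq> spectrum \<gamma>\<^sub>1 \<gamma>\<^sub>2 Y"
    by (rule spectrum_subset[OF per perX continuous_coeffs_Y[OF cc]])
  show "spectrum \<gamma>\<^sub>1 \<gamma>\<^sub>2 Y \<subseteq> spectrum \<gamma>\<^sub>1 \<gamma>\<^sub>2 X"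
    using per perX by (intro conformal_change.spectrum_subset[OF conformal_change_inverse _ _ _ cc])
      (auto simp: conf_exponent_Y)
qed

end

section \<open>Periodicity, continuity of the coefficients and the conclusion for tori\<close>

lemma dir_deriv_periodic:
  assumes "f differentiable at (z + \<gamma>)" "\<And>z. f (z + \<gamma>) = f z"
  shows "dir_deriv f t (z + \<gamma>) = dir_deriv f t z"
proof -
  have "((\<lambda>w. w + \<gamma>) has_derivative (\<lambda>t. t)) (at z)"
    by (auto intro!: derivative_eq_intros)
  from has_derivative_compose[OF this dir_deriv_works[OF assms(1)]]
  have "(f has_derivative (\<lambda>t. dir_deriv f t (z + \<gamma>))) (at z)"
    by (simp add: assms(2))
  then show ?thesis
    by (simp add: dir_deriv_at)
qed

context isothermic_surface
begin

lemma continuous_coeffs_X: "continuous_coeffs X"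
proof -
  have diff_cont: "continuous_on UNIV f" if "\<And>z. f differentiable at z" for f :: "complex \<Rightarrow> 'b::real_normed_vector"
    using that by (meson differentiable_at_withinI differentiable_imp_continuous_on differentiable_on_def)
  note cont = diff_cont[OF differentiable_\<alpha>] diff_cont[OF differentiable_N] diff_cont[OF differentiable_X1] continuous_X2
  \<comment> \<open>The Gauss equations read backwards: the coefficients become quotients of
    continuous expressions in the first and second derivatives of \<open>X\<close>.\<close>
  have eq: "\<alpha>x = (\<lambda>z. (dir_deriv Xx 1 z \<bullet> Xx z) / E z)" "\<alpha>y = (\<lambda>z. (dir_deriv Xx \<i> z \<bullet> Xx z) / E z)"
    "k1 = (\<lambda>z. (dir_deriv Xx 1 z \<bullet> N z) / E z)" "k2 = (\<lambda>z. (dir_deriv Xy \<i> z \<bullet> N z) / E z)"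
    by (simp_all add: X2_tangent X2_normal)
  have c: "continuous_on UNIV \<alpha>x" "continuous_on UNIV \<alpha>y" "continuous_on UNIV k1" "continuous_on UNIV k2"
    unfolding eq by (auto intro!: continuous_intros cont)
  have "alpha_z X z = (\<alpha>x z - \<i> * \<alpha>y z) / 2" "alpha_zbar X z = (\<alpha>x z + \<i> * \<alpha>y z) / 2" for z
    using has_wirtinger_imp(2,3)[OF conf_exponent_wirtinger[OF differentiable_\<alpha>]]
      has_wirtinger_imp(2,3)[OF has_wirtinger_of_real[OF has_partials_dir_deriv[OF differentiable_\<alpha>]]]
    by metis+
  then have "alpha_z X = (\<lambda>z. (\<alpha>x z - \<i> * \<alpha>y z) / 2)" "alpha_zbar X = (\<lambda>z. (\<alpha>x z + \<i> * \<alpha>y z) / 2)"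
    by auto
  then show ?thesis
    unfolding continuous_coeffs_def mean_coeff_def[abs_def] hopf_coeff_def[abs_def]
    by (auto intro!: continuous_intros c cont)
qed

lemma
  assumes per: "\<And>z. X (z + \<gamma>) = X z"
  shows X1_periodic: "dir_deriv X t (z + \<gamma>) = dir_deriv X t z"
    and \<alpha>_periodic: "\<alpha> (z + \<gamma>) = \<alpha> z"
    and N_periodic: "N (z + \<gamma>) = N z"
proof -
  have 1: "dir_deriv X t (z + \<gamma>) = dir_deriv X t z" for t
    by (rule dir_deriv_periodic[OF differentiable_X per])
  then show "dir_deriv X t (z + \<gamma>) = dir_deriv X t z" .
  show "\<alpha> (z + \<gamma>) = \<alpha> z" "N (z + \<gamma>) = N z"
    unfolding conf_exponent_def first_form_def unit_normal_def 1 by (rule refl)+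
qed

end

lemma (in conformal_image) spectrum_conformal_image:
  assumes per: "\<And>z. X (z + \<gamma>\<^sub>1) = X z" "\<And>z. X (z + \<gamma>\<^sub>2) = X z"
  shows "spectrum \<gamma>\<^sub>1 \<gamma>\<^sub>2 X = spectrum \<gamma>\<^sub>1 \<gamma>\<^sub>2 Y"
proof -
  obtain \<epsilon> where cc: "conformal_change X Y \<epsilon> v vx vy h"
    using conformal_change by blast
  have "v (z + \<gamma>) = v z \<and> vx (z + \<gamma>) = vx z \<and> vy (z + \<gamma>) = vy z \<and> h (z + \<gamma>) = h z"
    if "\<And>z. X (z + \<gamma>) = X z" for z \<gamma>
    by (simp add: v_def vx_def vy_def h_def that X1_periodic \<alpha>_periodic N_periodic)
  then show ?thesis
    using per by (intro conformal_change.spectrum_eq[OF cc] continuous_coeffs_X) (auto simp: \<alpha>_periodic)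
qed

text \<open>\<open>F\<close> is injective, so at most one point is sent to infinity and the domain
  is the complement of a finite set, hence open. Smoothness and conformality come from the chart
  \<open>id\<close> on both sides.\<close>

lemma conformal_transformation_imp_conformal_map:
  assumes "conformal_transformation F"
  shows "conformal_map {x. F (Some x) \<noteq> None} (\<lambda>x. the (F (Some x)))"
proof
  have inj: "inj F"
    using assms unfolding conformal_transformation_def
    by (metis UNIV_option_conv homeomorphic_imp_injective_map topspace_Alexandroff_compactification
        topspace_euclidean)
  have "finite {x. F (Some x) = None}"
  proof (cases "\<exists>x. F (Some x) = None")
    case True
    then obtain x where "F (Some x) = None" ..
    then have "{x. F (Some x) = None} \<subseteq> {x}"
      using injD[OF inj, of _ "Some x"] by auto
    then show ?thesis
      by (rule finite_subset) simp
  next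
    case False
    then have "{x. F (Some x) = None} = {}"
      by blast
    then show ?thesis
      by (simp only: finite.emptyI)
  qed
  then have "closed {x. F (Some x) = None}"
    by (rule finite_imp_closed)
  then show "open {x. F (Some x) \<noteq> None}"
    unfolding closed_def Collect_neg_eq[symmetric] .
  have "let S = {x. (id \<circ> F \<circ> id) (Some x) \<noteq> None}; f = (\<lambda>x. the ((id \<circ> F \<circ> id) (Some x)))
    in smooth_on S f \<and> conformal_on S f"
    using assms unfolding conformal_transformation_def by blast
  then show "smooth_on {x. F (Some x) \<noteq> None} (\<lambda>x. the (F (Some x)))"
    "conformal_on {x. F (Some x) \<noteq> None} (\<lambda>x. the (F (Some x)))"
    by (simp_all add: Let_def)
qed

theorem theorem10:
  fixes \<gamma>\<^sub>1 \<gamma>\<^sub>2 :: complex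
    and X :: "complex \<Rightarrow> real^3"
    and F :: "R3bar \<Rightarrow> R3bar"
  assumes "isothermic_torus \<gamma>\<^sub>1 \<gamma>\<^sub>2 X"
    and "conformal_transformation F"
    and "\<And>z. F (Some (X z)) \<noteq> None"
  shows "spectrum \<gamma>\<^sub>1 \<gamma>\<^sub>2 X = spectrum \<gamma>\<^sub>1 \<gamma>\<^sub>2 (\<lambda>z. the (F (Some (X z))))"
proof -
  let ?S = "{x. F (Some x) \<noteq> None}" and ?f = "\<lambda>x. the (F (Some x))"
  interpret conformal_map ?S ?f
    by (rule conformal_transformation_imp_conformal_map) (rule assms)
  interpret conformal_image X ?S ?f
    using assms(1,3) by unfold_locales (auto simp: isothermic_torus_def)
  have "spectrum \<gamma>\<^sub>1 \<gamma>\<^sub>2 X = spectrum \<gamma>\<^sub>1 \<gamma>\<^sub>2 Y"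
    using assms(1) by (intro spectrum_conformal_image) (auto simp: isothermic_torus_def)
  then show ?thesis
    by (simp add: Y_def[abs_def])
qed

end
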